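(* Let $X$ be a separable symmetric space on $[0,1]$ and let $f\in X$ satisfy $\int_0^1f(t)\,dt\ne0$. The following are equivalent: (i) $f\in\mathscr{M}(X)$; (ii) there is a constant $C>0$ such that for every $k_0\ge0$ the system $\{V^\alpha f\}_{|\alpha|\ge k_0}$ is an absolutely representing system in $X$ with constant $C$, i.e. for every $x\in X$ there exist real coefficients $\{\xi_\alpha\}_{|\alpha|\ge k_0}$ with $$x=\sum_{k=k_0}^{\infty}\sum_{|\alpha|=k}\xi_\alpha V^\alpha f\ \ (\text{convergence in }X)\quad\text{and}\quad \sum_{k=k_0}^\infty\Bigl\|\sum_{|\alpha|=k}\xi_\alpha V^\alpha f\Bigr\|_X\le C\|x\|_X.$$
   Context: A symmetric space $X$ on $[0,1]$ is a Banach space of (equivalence classes of) real-valued Lebesgue measurable functions on $[0,1]$ such that: (a) if $y\in X$ and $x$ is measurable with $|x|\le|y|$ a.e., then $x\in X$ and $\|x\|_X\le\|y\|_X$; (b) if $x,y$ are equimeasurable and $y\in X$, then $x\in X$ and $\|x\|_X=\|y\|_X$; normalized so that $\|\chi_{[0,1]}\|_X=1$. For $f\in L_1[0,1]$: $V_0f(t)=f(2t)$ on $[0,\frac12]$, $0$ on $(\frac12,1]$; $V_1f(t)=0$ on $[0,\frac12)$, $f(2t-1)$ on $[\frac12,1]$. For $\alpha=(\alpha_1,\dots,\alpha_k)\in\{0,1\}^k$, $|\alpha|=k$ and $V^\alpha f=V_{\alpha_1}\cdots V_{\alpha_k}f$ (identity for $k=0$), i.e. $V^\alpha f(t)=f(2^kt-i)$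 on $[i2^{-k},(i+1)2^{-k}]$, $0$ elsewhere, $i=\sum\alpha_\nu2^{k-\nu}$. Multiplicator space: $X(I\times I)$ consists of measurable $x$ on $[0,1]^2$ whose decreasing rearrangement w.r.t. planar Lebesgue measure lies in $X$, normed by the $X$-norm of that rearrangement; $\mathscr{M}(X)$ is the set of measurable $x$ on $[0,1]$ such that $y\mapsto x\otimes y$, $(x\otimes y)(s,t)=x(s)y(t)$, is bounded from $X$ into $X(I\times I)$, normed by the operator norm. *)

theory Defs
  imports "HOL-Analysis.Analysis"
begin

type_synonym fn = "real \<Rightarrow> real"

text \<open>Functions on [0,1] are represented by total functions real => real; only the
values on [0,1] matter (all conditions are stated on [0,1], a.e.).\<close>

definition meas01 :: "fn \<Rightarrow> bool" where
  "meas01 x \<longleftrightarrow> x \<in> borel_measurable (lebesgue_on {0..1})"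

definition distr :: "fn \<Rightarrow> real \<Rightarrow> real" where
  "distr x s = measure (lebesgue_on {0..1}) {t\<in>{0..1}. s < \<bar>x t\<bar>}"

definition equimeasurable :: "fn \<Rightarrow> fn \<Rightarrow> bool" where
  "equimeasurable x y \<longleftrightarrow> (\<forall>s. distr x s = distr y s)"

definition symmetric_space :: "fn set \<Rightarrow> (fn \<Rightarrow> real) \<Rightarrow> bool" where
  "symmetric_space X N \<longleftrightarrow>
     \<comment> \<open>a linear space of measurable functions\<close>
     (\<forall>x\<in>X. meas01 x) \<and> (\<lambda>t. 0) \<in> X \<and>
     (\<forall>x\<in>X. \<forall>y\<in>X. (\<lambda>t. x t + y t) \<in> X) \<and>
     (\<forall>x\<in>X. \<forall>c::real. (\<lambda>t. c * x t) \<in> X) \<and>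
     \<comment> \<open>N is a norm on X (modulo a.e. equality on [0,1])\<close>
     (\<forall>x\<in>X. N x \<ge> 0) \<and>
     (\<forall>x\<in>X. N x = 0 \<longleftrightarrow> (AE t in lebesgue_on {0..1}. x t = 0)) \<and>
     (\<forall>x\<in>X. \<forall>y\<in>X. N (\<lambda>t. x t + y t) \<le> N x + N y) \<and>
     (\<forall>x\<in>X. \<forall>c. N (\<lambda>t. c * x t) = \<bar>c\<bar> * N x) \<and>
     \<comment> \<open>completeness\<close>
     (\<forall>s. (\<forall>n. s n \<in> X) \<longrightarrow>
          (\<forall>e>0. \<exists>M. \<forall>m\<ge>M. \<forall>n\<ge>M. N (\<lambda>t. s m t - s n t) < e) \<longrightarrow>
          (\<exists>x\<in>X. (\<lambda>n. N (\<lambda>t. s n t - x t)) \<longlonglongrightarrow> 0)) \<and>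
     \<comment> \<open>(a) ideal property\<close>
     (\<forall>x y. y \<in> X \<longrightarrow> meas01 x \<longrightarrow> (AE t in lebesgue_on {0..1}. \<bar>x t\<bar> \<le> \<bar>y t\<bar>)
            \<longrightarrow> x \<in> X \<and> N x \<le> N y) \<and>
     \<comment> \<open>(b) rearrangement invariance\<close>
     (\<forall>x y. y \<in> X \<longrightarrow> meas01 x \<longrightarrow> equimeasurable x y \<longrightarrow> x \<in> X \<and> N x = N y) \<and>
     \<comment> \<open>normalization\<close>
     N (\<lambda>t. 1) = 1"

definition separable_fnspace :: "fn set \<Rightarrow> (fn \<Rightarrow> real) \<Rightarrow> bool" where
  "separable_fnspace X N \<longleftrightarrow>
     (\<exists>D. countable D \<and> D \<subseteq> X \<and> (\<forall>x\<in>X. \<forall>e>0. \<exists>d\<in>D. N (\<lambda>t. x t - d t) < e))"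

definition distr2 :: "(real \<times> real \<Rightarrow> real) \<Rightarrow> real \<Rightarrow> real" where
  "distr2 x s = measure (lebesgue_on ({0..1} \<times> {0..1}))
                   {p\<in>{0..1} \<times> {0..1}. s < \<bar>x p\<bar>}"

definition drearr2 :: "(real \<times> real \<Rightarrow> real) \<Rightarrow> fn" where
  "drearr2 x t = Inf {s. s \<ge> 0 \<and> distr2 x s \<le> t}"

definition in_X2 :: "fn set \<Rightarrow> (real \<times> real \<Rightarrow> real) \<Rightarrow> bool" where
  "in_X2 X x \<longleftrightarrow> x \<in> borel_measurable (lebesgue_on ({0..1} \<times> {0..1})) \<and> drearr2 x \<in> X"

definition norm_X2 :: "(fn \<Rightarrow> real) \<Rightarrow> (real \<times> real \<Rightarrow> real) \<Rightarrow> real" where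
  "norm_X2 N x = N (drearr2 x)"

definition tensor :: "fn \<Rightarrow> fn \<Rightarrow> (real \<times> real \<Rightarrow> real)" where
  "tensor x y = (\<lambda>(s,t). x s * y t)"

definition multiplicator :: "fn set \<Rightarrow> (fn \<Rightarrow> real) \<Rightarrow> fn set" where
  "multiplicator X N = {x. meas01 x \<and>
      (\<exists>C. \<forall>y\<in>X. in_X2 X (tensor x y) \<and> norm_X2 N (tensor x y) \<le> C * N y)}"

text \<open>Operators V_0, V_1 and V^alpha (False = 0, True = 1)\<close>
definition V0 :: "fn \<Rightarrow> fn" where
  "V0 f t = (if t \<in> {0..1/2} then f (2*t) else 0)"

definition V1 :: "fn \<Rightarrow> fn" where
  "V1 f t = (if t \<in> {1/2..1} then f (2*t - 1) else 0)"

definition Vb :: "bool \<Rightarrow> fn \<Rightarrow> fn" where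
  "Vb a = (if a then V1 else V0)"

fun Valpha :: "bool list \<Rightarrow> fn \<Rightarrow> fn" where
  "Valpha [] f = f"
| "Valpha (a # as) f = Vb a (Valpha as f)"

definition block :: "(bool list \<Rightarrow> real) \<Rightarrow> fn \<Rightarrow> nat \<Rightarrow> fn" where
  "block \<xi> f k = (\<lambda>t. \<Sum>\<alpha>\<in>{\<alpha>::bool list. length \<alpha> = k}. \<xi> \<alpha> * Valpha \<alpha> f t)"

definition abs_representing :: "fn set \<Rightarrow> (fn \<Rightarrow> real) \<Rightarrow> fn \<Rightarrow> nat \<Rightarrow> real \<Rightarrow> bool" where
  "abs_representing X N f k0 C \<longleftrightarrow>
     (\<forall>x\<in>X. \<exists>\<xi>::bool list \<Rightarrow> real.
        (\<lambda>n. N (\<lambda>t. x t - (\<Sum>k=k0..n. block \<xi> f k t))) \<longlonglongrightarrow> 0 \<and>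
        summable (\<lambda>j. N (block \<xi> f (k0 + j))) \<and>
        (\<Sum>j. N (block \<xi> f (k0 + j))) \<le> C * N x)"

end

theory Submission
  imports Defs
begin

text \<open>The operators \<open>V\<^sup>\<alpha>\<close> are governed by the doubling map: off the dyadic rationals a block
  \<open>\<Sum>\<^bsub>|\<alpha>|=k\<^esub> \<xi>\<^sub>\<alpha> V\<^sup>\<alpha> f\<close> is the product of the step function with the values \<open>\<xi>\<^sub>\<alpha>\<close> and of \<open>f\<close> composed with
  the \<open>k\<close>-th power of the doubling map, so it is equimeasurable with the tensor product of \<open>f\<close> and that
  step function. Hence \<open>f\<close> is a multiplicator iff the norm of every block is at most a constant times
  the norm of its step function (for a general second factor, dominate its rearrangement by a
  function constant on the intervals \<open>(2^-(i+1), 2^-i]\<close> and use completeness and order continuity).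

  If these bounds hold and \<open>f\<close> has integral 1, a step function \<open>y\<close> is approximated by averages, over
  sufficiently spread levels, of the blocks with step function \<open>y\<close>: the error is \<open>y\<close> times an average of
  almost independent copies of the mean-zero function \<open>1 - f\<close>. Iterating on the remainders gives
  the expansion.

  Conversely, expand a step function of level \<open>k\<close> into blocks of levels at least \<open>k\<close> and average the
  coefficients of each block over the dyadic intervals of level \<open>k\<close>. This does not increase norms, by
  rearrangement invariance, and the averaged coefficients sum up to the original ones.\<close>

section \<open>The doubling map and dyadic blocks\<close>

text \<open>Three obstacles shape the argument. The norm of X is not assumed to have the Fatou
  property, so block bounds do not pass to a general second factor by taking limits of norms.
  Instead the approximants form a norm Cauchy sequence of functions on [0,1] that extend each other,
  and their limit dominates the tensor product in distribution. Separability enters as order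
  continuity, extracted by a pigeonhole argument on an uncountable family; it yields density of step
  functions and turns L2 smallness of bounded functions into smallness in X. The nonzero integral a
  of \<open>f\<close> ties coefficients to functions: averages of blocks with step function y tend
  to a y, and the integral of a block over a dyadic interval is a times the mean coefficient there
  times the length of the interval. The constant in (ii) has to be uniform in the starting level,
  because step functions of level k are expanded from level k on; only then can every block be
  averaged down to that level.\<close>

abbreviation L01 :: "real measure" where "L01 \<equiv> lebesgue_on {0..1}"

text \<open>The point 1/2 goes with the left half, in agreement with the strict comparison in
  \<open>dig\<close>. Hence words code dyadic intervals that are open on the left and closed on the
  right (0 goes with the word of zeros), which fits the shells (2^-(i+1), 2^-i].\<close>

definition dbl :: "real \<Rightarrow> real" where
  "dbl t = (if t \<le> 1/2 then 2 * t else 2 * t - 1)"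

primrec dig :: "nat \<Rightarrow> real \<Rightarrow> bool list" where
  "dig 0 t = []"
| "dig (Suc k) t = (1/2 < t) # dig k (dbl t)"

abbreviation words :: "nat \<Rightarrow> bool list set" where
  "words k \<equiv> {\<alpha>. length \<alpha> = k}"

lemma length_dig [simp]: "length (dig k t) = k"
  by (induction k arbitrary: t) auto

lemma finite_words [simp, intro]: "finite (words k)"
  using finite_lists_length_eq[of "UNIV :: bool set" k] by simp

lemma sum_words_Suc:
  fixes F :: "bool list \<Rightarrow> 'a::comm_monoid_add"
  shows "(\<Sum>\<alpha>\<in>words (Suc k). F \<alpha>) = (\<Sum>\<alpha>\<in>words k. F (False # \<alpha>)) + (\<Sum>\<alpha>\<in>words k. F (True # \<alpha>))"
proof -
  have eq: "words (Suc k) = (#) False ` words k \<union> (#) True ` words k"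
    by (auto simp: length_Suc_conv)
  show ?thesis unfolding eq
    by (subst sum.union_disjoint) (auto simp: sum.reindex inj_on_def)
qed

lemma sum_words_snoc:
  fixes F :: "bool list \<Rightarrow> 'a::comm_monoid_add"
  shows "(\<Sum>\<alpha>\<in>words (Suc k). F \<alpha>) = (\<Sum>\<alpha>\<in>words k. F (\<alpha> @ [False]) + F (\<alpha> @ [True]))"
  proof (induction k arbitrary: F)
  case 0
  have "words 0 = {[]}" "words (Suc 0) = {[False], [True]}"
    by (auto simp: length_Suc_conv)
  then show ?case by simp
next
  case (Suc k)
  show ?case
    unfolding sum_words_Suc[of F "Suc k"] Suc.IH[of "\<lambda>\<alpha>. F (False # \<alpha>)"] Suc.IH[of "\<lambda>\<alpha>. F (True # \<alpha>)"] sum_words_Suc[of "\<lambda>\<alpha>. F (\<alpha> @ [False]) + F (\<alpha> @ [True])" k]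
    by simp
qed

lemma dig_add: "dig (k + m) t = dig k t @ dig m ((dbl ^^ k) t)"
  by (induction k arbitrary: t) (auto simp: funpow_swap1)

lemma take_dig: "k \<le> m \<Longrightarrow> take k (dig m t) = dig k t"
  using dig_add[of k "m - k" t] by simp

lemma dbl_in01: "t \<in> {0..1} \<Longrightarrow> dbl t \<in> {0..1}"
  by (auto simp: dbl_def)

section \<open>Measurability, integrals and distributions under the doubling map\<close>

lemma borel_measurable_join:
  fixes u v :: "real \<Rightarrow> real"
  assumes "u \<in> borel_measurable L01" "v \<in> borel_measurable L01"
  shows "(\<lambda>t. if t \<le> 1/2 then u (2 * t) else v (2 * t - 1)) \<in> borel_measurable L01"
proof -
  define u' where "u' = (\<lambda>x. if x \<in> {0..1} then u x else 0)"
  define v' where "v' = (\<lambda>x. if x \<in> {0..1} then v x else 0)"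
  have [measurable]: "u' \<in> borel_measurable lebesgue" "v' \<in> borel_measurable lebesgue"
    unfolding u'_def v'_def by (rule borel_measurable_if_I[OF assms(1)], simp, rule borel_measurable_if_I[OF assms(2)], simp)
  have "(\<lambda>x. 0 + 2 * x) \<in> lebesgue \<rightarrow>\<^sub>M (lebesgue :: real measure)"
    using lebesgue_affine_measurable[of "\<lambda>_::real. 2" 0] by simp
  from measurable_compose[OF this \<open>u' \<in> _\<close>]
  have [measurable]: "(\<lambda>x. u' (2 * x)) \<in> borel_measurable lebesgue" by simp
  have "(\<lambda>x. -1 + 2 * x) \<in> lebesgue \<rightarrow>\<^sub>M (lebesgue :: real measure)"
    using lebesgue_affine_measurable[of "\<lambda>_::real. 2" "-1"] by simp
  from measurable_compose[OF this \<open>v' \<in> _\<close>]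
  have [measurable]: "(\<lambda>x. v' (-1 + 2 * x)) \<in> borel_measurable lebesgue" by simp
  have [measurable]: "Measurable.pred lebesgue (\<lambda>x::real. x \<le> 1/2)"
    by (auto simp: pred_def)
  have "(\<lambda>t. if t \<le> 1/2 then u' (2 * t) else v' (-1 + 2 * t)) \<in> borel_measurable lebesgue"
    by measurable
  then have "(\<lambda>t. if t \<le> 1/2 then u' (2 * t) else v' (-1 + 2 * t)) \<in> borel_measurable L01"
    by (rule measurable_restrict_space1)
  then show ?thesis
    by (subst measurable_lebesgue_cong[where g = "\<lambda>t. if t \<le> 1/2 then u' (2 * t) else v' (-1 + 2 * t)"])
       (auto simp: u'_def v'_def)
qed

lemma has_bochner_integral_L01:
  fixes f :: "real \<Rightarrow> real"
  shows "has_bochner_integral L01 f i \<longleftrightarrow> has_bochner_integral lebesgue (\<lambda>x. indicator {0..1} x * f x) i"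
  by (auto simp: has_bochner_integral_iff integrable_restrict_space integral_restrict_space)

lemma AE_lebesgue_neq: "AE t in lebesgue. t \<noteq> (c::real)"
  by (rule AE_I'[of "{c}"]) auto

lemma has_bochner_integral_join:
  fixes u v :: "real \<Rightarrow> real"
  assumes "has_bochner_integral L01 u i" "has_bochner_integral L01 v j"
  shows "has_bochner_integral L01 (\<lambda>t. if t \<le> 1/2 then u (2 * t) else v (2 * t - 1)) ((i + j) / 2)"
proof -
  have 1: "has_bochner_integral lebesgue (\<lambda>x. indicator {0..1} (0 + 2 * x) * u (0 + 2 * x)) (i /\<^sub>R \<bar>2\<bar>)"
    using assms(1) unfolding has_bochner_integral_L01
    by (subst (asm) has_bochner_integral_lebesgue_real_affine_iff[of 2 _ _ 0]) auto
  have 2: "has_bochner_integral lebesgue (\<lambda>x. indicator {0..1} (-1 + 2 * x) * v (-1 + 2 * x)) (j /\<^sub>R \<bar>2\<bar>)"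
    using assms(2) unfolding has_bochner_integral_L01
    by (subst (asm) has_bochner_integral_lebesgue_real_affine_iff[of 2 _ _ "-1"]) auto
  have sum: "has_bochner_integral lebesgue (\<lambda>x. indicator {0..1} (0 + 2 * x) * u (0 + 2 * x) +
      indicator {0..1} (-1 + 2 * x) * v (-1 + 2 * x)) ((i + j) / 2)"
    using has_bochner_integral_add[OF 1 2] by (simp add: add_divide_distrib)
  have m: "(\<lambda>t. indicator {0..1} t *\<^sub>R (if t \<le> 1/2 then u (2 * t) else v (2 * t - 1))) \<in> borel_measurable lebesgue"
    using borel_measurable_join[of u v] assms
    by (subst borel_measurable_restrict_space_iff[symmetric]) (auto simp: has_bochner_integral_iff)
  show ?thesis
    unfolding has_bochner_integral_L01
  proof (rule iffD1[OF has_bochner_integral_cong_AE sum])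
    \<comment> \<open>At x = 1/2 both indicators equal 1, so the identity holds only off this
      point.\<close>
    show "AE x in lebesgue. indicator {0..1} (0 + 2 * x) * u (0 + 2 * x) +
            indicator {0..1} (-1 + 2 * x) * v (-1 + 2 * x) =
          indicator {0..1} x * (if x \<le> 1/2 then u (2 * x) else v (2 * x - 1))"
      using AE_lebesgue_neq[of "1/2"] by eventually_elim (auto simp: indicator_def)
  qed (use sum m in \<open>auto simp: has_bochner_integral_iff\<close>)
qed

text \<open>Splitting off the first digit gives the shape required by the two joining lemmas. As
  \<open>F\<close> depends on the prefix and on the remaining point together, inductions over the
  level can be run with \<open>F\<close> generalised.\<close>

lemma dig_dbl_join:
  "F (dig (Suc k) t) ((dbl ^^ Suc k) t) =
    (if t \<le> 1/2 then F (False # dig k (2 * t)) ((dbl ^^ k) (2 * t))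
     else F (True # dig k (2 * t - 1)) ((dbl ^^ k) (2 * t - 1)))"
  by (simp add: funpow_swap1) (auto simp: dbl_def)

lemma borel_measurable_dig:
  fixes F :: "bool list \<Rightarrow> real \<Rightarrow> real"
  assumes "\<And>\<alpha>. length \<alpha> = k \<Longrightarrow> F \<alpha> \<in> borel_measurable L01"
  shows "(\<lambda>t. F (dig k t) ((dbl ^^ k) t)) \<in> borel_measurable L01"
  using assms
proof (induction k arbitrary: F)
  case (Suc k)
  show ?case unfolding dig_dbl_join[of F]
    by (rule borel_measurable_join) (rule Suc.IH; use Suc.prems in simp)+
qed simp

text \<open>The first k digits and the remaining point are independent: together they carry Lebesgue
  measure to the product of the uniform measure on words with Lebesgue measure. The
  equimeasurability of blocks and the orthogonality of shifted copies derive from this.\<close>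

lemma has_bochner_integral_dig:
  fixes F :: "bool list \<Rightarrow> real \<Rightarrow> real"
  assumes "\<And>\<alpha>. length \<alpha> = k \<Longrightarrow> has_bochner_integral L01 (F \<alpha>) (i \<alpha>)"
  shows "has_bochner_integral L01 (\<lambda>t. F (dig k t) ((dbl ^^ k) t)) ((\<Sum>\<alpha>\<in>words k. i \<alpha>) / 2 ^ k)"
  using assms
proof (induction k arbitrary: F i)
  case 0
  have "words 0 = {[]}" by auto
  then show ?case using 0[of "[]"] by simp
next
  case (Suc k)
  have "has_bochner_integral L01 (\<lambda>t. F (dig (Suc k) t) ((dbl ^^ Suc k) t))
     (((\<Sum>\<alpha>\<in>words k. i (False # \<alpha>)) / 2 ^ k + (\<Sum>\<alpha>\<in>words k. i (True # \<alpha>)) / 2 ^ k) / 2)"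
    unfolding dig_dbl_join[of F]
    by (rule has_bochner_integral_join) (rule Suc.IH; use Suc.prems in simp)+
  then show ?case by (simp add: sum_words_Suc add_divide_distrib mult.commute)
qed

lemma integral_dig:
  fixes F :: "bool list \<Rightarrow> real \<Rightarrow> real"
  assumes "\<And>\<alpha>. length \<alpha> = k \<Longrightarrow> integrable L01 (F \<alpha>)"
  shows "integrable L01 (\<lambda>t. F (dig k t) ((dbl ^^ k) t))"
    and "integral\<^sup>L L01 (\<lambda>t. F (dig k t) ((dbl ^^ k) t)) = (\<Sum>\<alpha>\<in>words k. integral\<^sup>L L01 (F \<alpha>)) / 2 ^ k"
  using has_bochner_integral_dig[of k F "\<lambda>\<alpha>. integral\<^sup>L L01 (F \<alpha>)"] assms
  by (auto simp: has_bochner_integral_iff)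

lemma finite_measure_L01: "finite_measure L01"
  by (rule finite_measure_lebesgue_on) auto

lemma measure_L01: "measure L01 {0..1} = 1"
  by (subst measure_restrict_space) auto

interpretation L01: finite_measure L01 by (rule finite_measure_L01)

lemma distr_set: "meas01 x \<Longrightarrow> {t\<in>{0..1}. s < \<bar>x t\<bar>} \<in> sets L01"
proof -
  assume "meas01 x"
  then have [measurable]: "x \<in> borel_measurable L01" by (simp add: meas01_def)
  have "{t\<in>space L01. s < \<bar>x t\<bar>} \<in> sets L01" by measurable
  then show ?thesis by simp
qed

lemma card_words: "card (words k) = 2 ^ k"
  using card_lists_length_eq[of "UNIV :: bool set" k] by simp

lemma distr_integral: "meas01 x \<Longrightarrow> distr x s = integral\<^sup>L L01 (\<lambda>t. of_bool (s < \<bar>x t\<bar>))"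
proof -
  assume x: "meas01 x"
  have "distr x s = integral\<^sup>L L01 (indicator {t\<in>{0..1}. s < \<bar>x t\<bar>})"
    using distr_set[OF x, of s] unfolding distr_def by (simp add: Int_absorb2 subset_eq)
  also have "\<dots> = integral\<^sup>L L01 (\<lambda>t. of_bool (s < \<bar>x t\<bar>))"
    by (rule Bochner_Integration.integral_cong) (auto simp: indicator_def)
  finally show ?thesis .
qed

lemma integrable_L01_bounded:
  assumes "meas01 x" "\<And>t. t \<in> {0..1} \<Longrightarrow> \<bar>x t\<bar> \<le> B"
  shows "integrable L01 x"
  using assms by (intro L01.integrable_const_bound[of _ B]) (auto simp: meas01_def intro!: AE_I2)

lemma meas01_distr_pred: "meas01 x \<Longrightarrow> meas01 (\<lambda>t. of_bool (s < \<bar>x t\<bar>))"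
  unfolding meas01_def by measurable

text \<open>For indicator functions, independence turns distribution functions into averages over
  words. The distribution of a block therefore depends only on the proportion of words carrying each
  coefficient, not on their order or level.\<close>

lemma distr_dig:
  assumes "\<And>\<alpha>. length \<alpha> = k \<Longrightarrow> meas01 (F \<alpha>)"
  shows "distr (\<lambda>t. F (dig k t) ((dbl ^^ k) t)) s = (\<Sum>\<alpha>\<in>words k. distr (F \<alpha>) s) / 2 ^ k"
proof -
  have m: "meas01 (\<lambda>t. F (dig k t) ((dbl ^^ k) t))"
    using assms borel_measurable_dig[of k F] by (auto simp: meas01_def)
  have i: "integrable L01 (\<lambda>t. of_bool (s < \<bar>F \<alpha> t\<bar>) :: real)" if "length \<alpha> = k" for \<alpha>
    by (rule integrable_L01_bounded[of _ 1]) (use assms that meas01_distr_pred in auto)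
  have "distr (\<lambda>t. F (dig k t) ((dbl ^^ k) t)) s = (\<Sum>\<alpha>\<in>words k. integral\<^sup>L L01 (\<lambda>t. of_bool (s < \<bar>F \<alpha> t\<bar>))) / 2 ^ k"
    unfolding distr_integral[OF m]
    by (rule integral_dig(2)[where F = "\<lambda>\<alpha> t. of_bool (s < \<bar>F \<alpha> t\<bar>)"]) (rule i)
  also have "\<dots> = (\<Sum>\<alpha>\<in>words k. distr (F \<alpha>) s) / 2 ^ k"
    using assms by (simp add: distr_integral)
  finally show ?thesis .
qed

text \<open>\<open>V0\<close> and \<open>V1\<close> overlap at 1/2, so the formula may fail at
  dyadic points. All rationals are excluded instead: irrationality passes from t to
  \<open>dbl t\<close>, and the exceptional set is still null.\<close>

lemma Valpha_off_rationals:
  assumes "t \<in> {0..1}" "t \<notin> \<rat>"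
  shows "Valpha \<alpha> f t = (if dig (length \<alpha>) t = \<alpha> then f ((dbl ^^ length \<alpha>) t) else 0)"
  using assms
proof (induction \<alpha> arbitrary: t)
  case (Cons a \<alpha>)
  have "dbl t \<notin> \<rat>"
  proof
    assume "dbl t \<in> \<rat>"
    moreover have "t = dbl t / 2 \<or> t = (dbl t + 1) / 2" by (auto simp: dbl_def)
    ultimately have "t \<in> \<rat>"
      by (metis Rats_1 Rats_add Rats_divide Rats_number_of)
    then show False using Cons.prems by simp
  qed
  with Cons.IH[of "dbl t"] dbl_in01[OF Cons.prems(1)]
  have IH: "Valpha \<alpha> f (dbl t) = (if dig (length \<alpha>) (dbl t) = \<alpha> then f ((dbl ^^ length \<alpha>) (dbl t)) else 0)"
    by simp
  have "t \<noteq> 1/2" using Cons.prems Rats_divide[OF Rats_1 Rats_number_of] by metis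
  then have "Valpha (a # \<alpha>) f t = (if a = (1/2 < t) then Valpha \<alpha> f (dbl t) else 0)"
    using Cons.prems by (auto simp: Vb_def V0_def V1_def dbl_def)
  then show ?case unfolding IH by (auto simp: funpow_swap1)
qed simp

lemma AE_off_rationals: "AE t in L01. t \<in> {0..1} \<and> t \<notin> \<rat>"
proof -
  have "(\<rat> :: real set) \<in> null_sets lebesgue"
    using countable_imp_null_set_lborel[OF countable_rat] by (rule null_sets_completionI)
  then have "AE t in lebesgue. t \<notin> (\<rat> :: real set)"
    by (rule AE_not_in)
  then show ?thesis by (subst AE_restrict_space_iff) auto
qed

lemma block_AE: "AE t in L01. block \<xi> f k t = \<xi> (dig k t) * f ((dbl ^^ k) t)"
  using AE_off_rationals
proof eventually_elim
  case (elim t)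
  have "block \<xi> f k t = (\<Sum>\<alpha>\<in>words k. if \<alpha> = dig k t then \<xi> \<alpha> * f ((dbl ^^ k) t) else 0)"
    unfolding block_def by (rule sum.cong) (use elim in \<open>auto simp: Valpha_off_rationals\<close>)
  then show ?case by simp
qed

section \<open>Rearrangements and tensor products\<close>

text \<open>The generalised inverse of a distribution function. Taking the distribution function as
  argument treats functions on the interval and on the square alike; \<open>drearr2 z\<close> is the
  instance \<open>rearr (distr2 z)\<close>.\<close>

definition rearr :: "(real \<Rightarrow> real) \<Rightarrow> real \<Rightarrow> real" where
  "rearr d t = Inf {s. 0 \<le> s \<and> d s \<le> t}"

text \<open>What the calculus of rearrangements uses: monotonicity, right continuity (one sequence
  decreasing to s is enough by monotonicity) and decay at infinity, which makes the set in
  \<open>rearr\<close> nonempty for t > 0.\<close>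

definition distribution_fun :: "(real \<Rightarrow> real) \<Rightarrow> bool" where
  "distribution_fun d \<longleftrightarrow>
     (\<forall>s. 0 \<le> d s \<and> d s \<le> 1) \<and> (\<forall>s s'. s \<le> s' \<longrightarrow> d s' \<le> d s) \<and>
     (\<forall>s. (\<lambda>n. d (s + 1 / Suc n)) \<longlonglongrightarrow> d s) \<and> (\<lambda>n. d (real n)) \<longlonglongrightarrow> 0"

lemma distribution_fun_measure:
  assumes "finite_measure M" "measure M (space M) = 1" "g \<in> borel_measurable M"
  shows "distribution_fun (\<lambda>s. measure M {p\<in>space M. s < \<bar>g p :: real\<bar>})"
proof -
  interpret finite_measure M by fact
  have [measurable]: "g \<in> borel_measurable M" by fact
  have le: "measure M {p\<in>space M. s < \<bar>g p\<bar>} \<le> 1" for s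
    using finite_measure_mono[of "{p\<in>space M. s < \<bar>g p\<bar>}" "space M"] assms(2) by auto
  have mono: "measure M {p\<in>space M. s' < \<bar>g p\<bar>} \<le> measure M {p\<in>space M. s < \<bar>g p\<bar>}" if "s \<le> s'" for s s'
    by (rule finite_measure_mono) (use that in auto)
  have rc: "(\<lambda>n. measure M {p\<in>space M. s + 1 / Suc n < \<bar>g p\<bar>}) \<longlonglongrightarrow> measure M {p\<in>space M. s < \<bar>g p\<bar>}" for s
  proof -
    have "(\<Union>n. {p\<in>space M. s + 1 / Suc n < \<bar>g p\<bar>}) = {p\<in>space M. s < \<bar>g p\<bar>}"
    proof (intro set_eqI iffI)
      fix p assume "p \<in> {p\<in>space M. s < \<bar>g p\<bar>}"
      then have p: "p \<in> space M" "0 < \<bar>g p\<bar> - s" by auto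
      from reals_Archimedean[OF p(2)] obtain n where "inverse (real (Suc n)) < \<bar>g p\<bar> - s" ..
      then show "p \<in> (\<Union>n. {p\<in>space M. s + 1 / Suc n < \<bar>g p\<bar>})"
        using p by (auto simp: field_simps intro!: exI[of _ n])
    next
      fix p assume "p \<in> (\<Union>n. {p\<in>space M. s + 1 / Suc n < \<bar>g p\<bar>})"
      then obtain n where "p \<in> space M" "s + 1 / Suc n < \<bar>g p\<bar>" by blast
      moreover have "0 < 1 / real (Suc n)" by simp
      ultimately have "s < \<bar>g p\<bar>" by linarith
      with \<open>p \<in> space M\<close> show "p \<in> {p\<in>space M. s < \<bar>g p\<bar>}" by simp
    qed
    moreover have "(\<lambda>n. measure M {p\<in>space M. s + 1 / Suc n < \<bar>g p\<bar>}) \<longlonglongrightarrow>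
        measure M (\<Union>n. {p\<in>space M. s + 1 / Suc n < \<bar>g p\<bar>})"
    proof (rule finite_Lim_measure_incseq)
      show "incseq (\<lambda>n. {p\<in>space M. s + 1 / Suc n < \<bar>g p\<bar>})"
      proof (rule incseq_SucI, rule Collect_mono, rule impI)
        fix n p assume "p \<in> space M \<and> s + 1 / Suc n < \<bar>g p\<bar>"
        moreover have "1 / real (Suc (Suc n)) \<le> 1 / real (Suc n)" by (rule divide_left_mono) auto
        ultimately show "p \<in> space M \<and> s + 1 / Suc (Suc n) < \<bar>g p\<bar>" by linarith
      qed
    qed auto
    ultimately show ?thesis by simp
  qed
  have lim: "(\<lambda>n. measure M {p\<in>space M. real n < \<bar>g p\<bar>}) \<longlonglongrightarrow> 0"
  proof -
    have "(\<Inter>n. {p\<in>space M. real n < \<bar>g p\<bar>}) = {}"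
    proof (rule equals0I)
      fix p assume "p \<in> (\<Inter>n. {p\<in>space M. real n < \<bar>g p\<bar>})"
      then have "real n < \<bar>g p\<bar>" for n by blast
      then show False using reals_Archimedean2[of "\<bar>g p\<bar>"] less_asym by blast
    qed
    moreover have "(\<lambda>n. measure M {p\<in>space M. real n < \<bar>g p\<bar>}) \<longlonglongrightarrow>
        measure M (\<Inter>n. {p\<in>space M. real n < \<bar>g p\<bar>})"
      by (rule finite_Lim_measure_decseq) (auto intro!: decseq_SucI)
    ultimately show ?thesis by simp
  qed
  show ?thesis
    unfolding distribution_fun_def using le mono rc lim by auto
qed

lemma distribution_fun_distr: "meas01 x \<Longrightarrow> distribution_fun (distr x)"
  using distribution_fun_measure[of L01 x] finite_measure_L01 measure_L01
  by (simp add: meas01_def distr_def[abs_def])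

lemma distribution_fun_distr2:
  assumes "z \<in> borel_measurable (lebesgue_on ({0..1} \<times> {0..1}))"
  shows "distribution_fun (distr2 z)"
proof -
  have [simp]: "{0..1::real} \<times> {0..1::real} = cbox (0,0) (1,1)"
    by (simp add: cbox_Pair_eq)
  have "measure (lebesgue_on ({0..1::real} \<times> {0..1::real})) ({0..1::real} \<times> {0..1::real}) = 1"
    by (simp add: measure_restrict_space content_Pair)
  moreover have "finite_measure (lebesgue_on ({0..1::real} \<times> {0..1::real}))"
    by (simp add: finite_measure_lebesgue_on)
  ultimately show ?thesis
    using distribution_fun_measure[of "lebesgue_on ({0..1} \<times> {0..1})" z] assms
    by (simp add: distr2_def[abs_def])
qed

lemma distr_le_1: "meas01 x \<Longrightarrow> distr x s \<le> 1"
  and distr_mono_arg: "meas01 x \<Longrightarrow> s \<le> s' \<Longrightarrow> distr x s' \<le> distr x s"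
  using distribution_fun_distr[of x] by (auto simp: distribution_fun_def)

lemma distr_nonneg: "0 \<le> distr x s"
  by (simp add: distr_def)

lemma distr_negative: "s < 0 \<Longrightarrow> distr x s = 1"
proof -
  assume "s < 0"
  then have "{t \<in> {0..1}. s < \<bar>x t\<bar>} = {0..1}" by auto
  then show ?thesis using measure_L01 by (simp add: distr_def)
qed

lemma equimeasurableI: "(\<And>s. 0 \<le> s \<Longrightarrow> distr x s = distr y s) \<Longrightarrow> equimeasurable x y"
  unfolding equimeasurable_def by (metis distr_negative not_less)

lemma rearr_bdd: "bdd_below {s. 0 \<le> s \<and> d s \<le> t}"
  by (auto simp: bdd_below_def)

lemma rearr_nonempty:
  assumes "distribution_fun d" "0 < t"
  shows "{s. 0 \<le> s \<and> d s \<le> t} \<noteq> {}"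
proof -
  have "(\<lambda>n. d (real n)) \<longlonglongrightarrow> 0" using assms by (simp add: distribution_fun_def)
  from order_tendstoD(2)[OF this \<open>0 < t\<close>] obtain n where "d (real n) < t"
    by (auto simp: eventually_sequentially)
  then have "real n \<in> {s. 0 \<le> s \<and> d s \<le> t}" by auto
  then show ?thesis by blast
qed

lemma rearr_nonneg: "distribution_fun d \<Longrightarrow> 0 < t \<Longrightarrow> 0 \<le> rearr d t"
  unfolding rearr_def by (rule cInf_greatest) (use rearr_nonempty in auto)

text \<open>Passing from \<open>t < d s\<close> to the strict inequality on the left uses right
  continuity, which leaves room to enlarge s a little. The value t = 0 is excluded because the
  infimum may then run over the empty set.\<close>

lemma less_rearr_iff:
  assumes d: "distribution_fun d" and "0 < t" "0 \<le> s"
  shows "s < rearr d t \<longleftrightarrow> t < d s"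
proof
  assume "s < rearr d t"
  then have "s \<notin> {s. 0 \<le> s \<and> d s \<le> t}"
    unfolding rearr_def using cInf_lower[OF _ rearr_bdd, of s d t] by auto
  then show "t < d s" using \<open>0 \<le> s\<close> by auto
next
  assume "t < d s"
  have "(\<lambda>n. d (s + 1 / Suc n)) \<longlonglongrightarrow> d s" using d by (simp add: distribution_fun_def)
  from order_tendstoD(1)[OF this \<open>t < d s\<close>] obtain n where n: "t < d (s + 1 / Suc n)"
    by (auto simp: eventually_sequentially)
  have "s + 1 / Suc n \<le> rearr d t"
    unfolding rearr_def
  proof (rule cInf_greatest[OF rearr_nonempty[OF d \<open>0 < t\<close>]])
    fix a assume "a \<in> {s. 0 \<le> s \<and> d s \<le> t}"
    then have "d a < d (s + 1 / Suc n)" using n by auto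
    moreover have "a \<le> s + 1 / Suc n \<Longrightarrow> d (s + 1 / Suc n) \<le> d a"
      using d by (simp add: distribution_fun_def)
    ultimately show "s + 1 / Suc n \<le> a" by linarith
  qed
  moreover have "s < s + 1 / Suc n" by simp
  ultimately show "s < rearr d t" by linarith
qed

lemma rearr_antimono:
  assumes "distribution_fun d" "0 < t" "t \<le> t'"
  shows "rearr d t' \<le> rearr d t"
  unfolding rearr_def
  by (rule cInf_superset_mono[OF rearr_nonempty]) (use assms rearr_bdd in auto)

lemma meas01_rearr:
  assumes d: "distribution_fun d"
  shows "meas01 (rearr d)"
  unfolding meas01_def borel_measurable_iff_greater
proof
  fix a
  \<comment> \<open>At 0 the infimum may run over the empty set; its unspecified value affects at
    most one point, which is harmless for measurability.\<close>
  have eq: "{w \<in> {0..1}. a < rearr d w} = ({0<..1} \<inter> (if 0 \<le> a then {..<d a} else UNIV)) \<union> (if a < rearr d 0 then {0} else {})"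
  proof (cases "0 \<le> a")
    case True
    show ?thesis
    proof (rule set_eqI)
      fix w :: real
      consider "w < 0" | "w = 0" | "0 < w" by linarith
      then show "w \<in> {w \<in> {0..1}. a < rearr d w} \<longleftrightarrow> w \<in> ({0<..1} \<inter> (if 0 \<le> a then {..<d a} else UNIV)) \<union> (if a < rearr d 0 then {0} else {})"
        by cases (use less_rearr_iff[OF d, of w a] True in auto)
    qed
  next
    case False
    then have "a < rearr d w" if "0 < w" for w
      using rearr_nonneg[OF d that] by linarith
    then show ?thesis using False by (force simp: order.order_iff_strict)
  qed
  have "{w \<in> {0..1}. a < rearr d w} \<in> sets lebesgue"
    unfolding eq by auto
  then show "{w \<in> space L01. a < rearr d w} \<in> sets L01"
    by (auto simp: sets_restrict_space_iff)
qed

lemma AE_L01_pos: "AE t in L01. 0 < t \<and> t \<le> 1"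
  using AE_off_rationals by eventually_elim (auto simp: order.order_iff_strict)

lemma measure_L01_eq:
  assumes "A \<in> sets L01" "B \<in> sets L01" "AE t in L01. t \<in> A \<longleftrightarrow> t \<in> B"
  shows "measure L01 A = measure L01 B"
  using assms by (intro measure_eq_AE) auto

lemma measure_L01_interval: "0 \<le> b \<Longrightarrow> b \<le> 1 \<Longrightarrow> measure L01 {0<..<b} = b"
  by (subst measure_restrict_space) auto

text \<open>By \<open>less_rearr_iff\<close> the level set is the interval (0, d s) up to a null
  set. Thus every such d, also one that comes from the square, is realised on [0,1].\<close>

lemma distr_rearr:
  assumes d: "distribution_fun d" and "0 \<le> s"
  shows "distr (rearr d) s = d s"
proof -
  have b: "0 \<le> d s" "d s \<le> 1" using d by (auto simp: distribution_fun_def)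
  have "distr (rearr d) s = measure L01 {0<..<d s}"
    unfolding distr_def
  proof (rule measure_L01_eq)
    show "AE t in L01. t \<in> {t \<in> {0..1}. s < \<bar>rearr d t\<bar>} \<longleftrightarrow> t \<in> {0<..<d s}"
      using AE_L01_pos
    proof eventually_elim
      case (elim t)
      then show ?case using less_rearr_iff[OF d, of t s] rearr_nonneg[OF d, of t] \<open>0 \<le> s\<close> b by auto
    qed
    show "{0<..<d s} \<in> sets L01"
      using b by (auto simp: sets_restrict_space_iff)
  qed (rule distr_set[OF meas01_rearr[OF d]])
  then show ?thesis using b by (simp add: measure_L01_interval)
qed

lemma rearr_mono:
  assumes "distribution_fun d" "distribution_fun d'" "\<And>s. 0 \<le> s \<Longrightarrow> d s \<le> d' s" "0 < t"
  shows "rearr d t \<le> rearr d' t"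
  unfolding rearr_def
proof (rule cInf_superset_mono)
  show "{s. 0 \<le> s \<and> d' s \<le> t} \<subseteq> {s. 0 \<le> s \<and> d s \<le> t}"
    using assms(3) by (auto intro: order_trans)
qed (use assms rearr_nonempty rearr_bdd in auto)

lemma drearr2_eq_rearr: "drearr2 z = rearr (distr2 z)"
  by (auto simp: drearr2_def rearr_def)

text \<open>Both factors are replaced by Borel functions equal to them almost everywhere, since Fubini's
  theorem is available for the product of Borel-Lebesgue measures, not for its completion.\<close>

lemma distr_scaled_borel:
  assumes y: "meas01 y" and [measurable]: "y' \<in> borel_measurable borel"
    and ae: "AE t in lborel. (if t \<in> {0..1} then y t else 0) = y' t"
  shows "emeasure lborel {t\<in>{0..1}. s < \<bar>c * y' t\<bar>} = ennreal (distr (\<lambda>t. c * y t) s)"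
proof -
  have cy: "meas01 (\<lambda>t. c * y t)" using y by (auto simp: meas01_def)
  have S: "{t\<in>{0..1}. s < \<bar>c * y t\<bar>} \<in> sets lebesgue"
    using distr_set[OF cy, of s] by (auto simp: sets_restrict_space_iff)
  have S': "{t\<in>{0..1}. s < \<bar>c * y' t\<bar>} \<in> sets borel"
    by measurable
  have "emeasure lborel {t\<in>{0..1}. s < \<bar>c * y' t\<bar>} = emeasure lebesgue {t\<in>{0..1}. s < \<bar>c * y' t\<bar>}"
    using S' by simp
  also have "\<dots> = emeasure lebesgue {t\<in>{0..1}. s < \<bar>c * y t\<bar>}"
  proof (rule emeasure_eq_AE)
    show "AE t in lebesgue. t \<in> {t\<in>{0..1}. s < \<bar>c * y' t\<bar>} \<longleftrightarrow> t \<in> {t\<in>{0..1}. s < \<bar>c * y t\<bar>}"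
      using AE_completion[OF ae] by eventually_elim (auto split: if_splits)
    show "{t\<in>{0..1}. s < \<bar>c * y' t\<bar>} \<in> sets lebesgue"
      by (rule sets_completionI_sets) (use S' in simp)
  qed (rule S)
  also have "\<dots> = emeasure L01 {t\<in>{0..1}. s < \<bar>c * y t\<bar>}"
    by (subst emeasure_restrict_space) auto
  also have "\<dots> = ennreal (distr (\<lambda>t. c * y t) s)"
    unfolding distr_def by (rule L01.emeasure_eq_measure)
  finally show ?thesis .
qed

lemma ex_borel_version:
  assumes "meas01 y"
  obtains y' :: "real \<Rightarrow> real" where "y' \<in> borel_measurable borel"
    "AE t in lborel. (if t \<in> {0..1} then y t else 0) = y' t"
proof -
  have "(\<lambda>t. if t \<in> {0..1} then y t else 0) \<in> borel_measurable lebesgue"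
    by (rule borel_measurable_if_I) (use assms in \<open>auto simp: meas01_def\<close>)
  from completion_ex_borel_measurable_real[OF this] show ?thesis
    using that by auto
qed

text \<open>The two slicings serve different ends. With the first variable fixed, second factors can
  be compared through their distributions; with the second fixed, a step function in that place
  reduces the integral to a finite average.\<close>

lemma tensor_fubini:
  assumes f: "meas01 f" and y: "meas01 y"
  shows borel_measurable_tensor: "tensor f y \<in> borel_measurable (lebesgue_on ({0..1} \<times> {0..1}))"
    and distr2_tensor_fst: "ennreal (distr2 (tensor f y) s) = (\<integral>\<^sup>+ u. ennreal (distr (\<lambda>t. f u * y t) s) \<partial>L01)"
    and distr2_tensor_snd: "ennreal (distr2 (tensor f y) s) = (\<integral>\<^sup>+ t. ennreal (distr (\<lambda>u. y t * f u) s) \<partial>L01)"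
proof -
  let ?I = "{0..1::real}"
  obtain f' where [measurable]: "f' \<in> borel_measurable borel" and f': "AE t in lborel. (if t \<in> ?I then f t else 0) = f' t"
    using ex_borel_version[OF f] .
  obtain y' where [measurable]: "y' \<in> borel_measurable borel" and y': "AE t in lborel. (if t \<in> ?I then y t else 0) = y' t"
    using ex_borel_version[OF y] .
  \<comment> \<open>\<open>h\<close> is the tensor product extended by zero and \<open>h'\<close>
    its Borel version; they differ only on a union of two null strips.\<close>
  define h where "h p = (if fst p \<in> ?I then f (fst p) else 0) * (if snd p \<in> ?I then y (snd p) else 0)" for p
  define h' where "h' p = f' (fst p) * y' (snd p)" for p
  have h'm[measurable]: "h' \<in> borel_measurable (borel \<Otimes>\<^sub>M borel)" unfolding h'_def by measurable
  have AEh: "AE p in lborel. h' p = h p"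
  proof -
    obtain A where A: "\<And>t. t \<notin> A \<Longrightarrow> (if t \<in> ?I then f t else 0) = f' t" "A \<in> null_sets lborel"
      by (rule AE_E3[OF f'], rule that) simp_all
    obtain B where B: "\<And>t. t \<notin> B \<Longrightarrow> (if t \<in> ?I then y t else 0) = y' t" "B \<in> null_sets lborel"
      by (rule AE_E3[OF y'], rule that) simp_all
    have "A \<times> UNIV \<in> null_sets (lborel \<Otimes>\<^sub>M lborel)"
      using A(2) lborel.emeasure_pair_measure_Times[of A lborel UNIV]
      by (auto simp: null_sets_def)
    moreover have "UNIV \<times> B \<in> null_sets (lborel \<Otimes>\<^sub>M lborel)"
      using B(2) lborel.emeasure_pair_measure_Times[of UNIV lborel B]
      by (auto simp: null_sets_def)
    ultimately have "A \<times> UNIV \<union> UNIV \<times> B \<in> null_sets (lborel :: (real \<times> real) measure)"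
      unfolding lborel_prod by (rule null_sets.Un)
    then show ?thesis
    proof (rule AE_I')
      show "{p \<in> space lborel. h' p \<noteq> h p} \<subseteq> A \<times> UNIV \<union> UNIV \<times> B"
      proof
        fix p assume "p \<in> {p \<in> space lborel. h' p \<noteq> h p}"
        then have "(if fst p \<in> ?I then f (fst p) else 0) \<noteq> f' (fst p) \<or> (if snd p \<in> ?I then y (snd p) else 0) \<noteq> y' (snd p)"
          unfolding h_def h'_def by auto
        then have "fst p \<in> A \<or> snd p \<in> B" using A(1) B(1) by blast
        then show "p \<in> A \<times> UNIV \<union> UNIV \<times> B" by (cases p) auto
      qed
    qed
  qed
  have h'b: "h' \<in> borel_measurable lborel"
    using h'm by (simp add: borel_prod)
  have hm: "h \<in> borel_measurable lebesgue"
    by (rule borel_measurable_AE[OF measurable_completion[OF h'b] AE_completion[OF AEh]])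
  have th: "tensor f y p = h p" if "p \<in> ?I \<times> ?I" for p
    using that by (auto simp: tensor_def h_def)
  have I2: "?I \<times> ?I \<in> sets (lborel :: (real \<times> real) measure)"
    by (simp add: borel_Times)
  show tm: "tensor f y \<in> borel_measurable (lebesgue_on (?I \<times> ?I))"
    using measurable_restrict_space1[OF hm, of "?I \<times> ?I"]
    by (subst measurable_lebesgue_cong[where g = h]) (use th in auto)
  define Q where "Q = {p \<in> ?I \<times> ?I. s < \<bar>h' p\<bar>}"
  have Qm: "Q \<in> sets (borel \<Otimes>\<^sub>M borel)"
  proof -
    have "{p \<in> space (borel \<Otimes>\<^sub>M borel). fst p \<in> ?I \<and> snd p \<in> ?I \<and> s < \<bar>h' p\<bar>} \<in> sets (borel \<Otimes>\<^sub>M borel)"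
      by measurable
    moreover have "{p \<in> space (borel \<Otimes>\<^sub>M borel). fst p \<in> ?I \<and> snd p \<in> ?I \<and> s < \<bar>h' p\<bar>} = Q"
      by (auto simp: Q_def space_pair_measure)
    ultimately show ?thesis by metis
  qed
  have QL: "Q \<in> sets (lborel \<Otimes>\<^sub>M lborel)"
    unfolding sets_pair_measure_cong[OF sets_lborel sets_lborel] by (rule Qm)
  have Qb: "Q \<in> sets (lborel :: (real \<times> real) measure)"
    using QL unfolding lborel_prod .
  have fin: "finite_measure (lebesgue_on (?I \<times> ?I))"
    by (rule finite_measure_lebesgue_on) (use lmeasurable_cbox[of "(0,0)" "(1::real,1::real)"] in \<open>simp add: cbox_Pair_eq\<close>)
  have "ennreal (distr2 (tensor f y) s) = emeasure (lebesgue_on (?I \<times> ?I)) {p\<in>?I \<times> ?I. s < \<bar>tensor f y p\<bar>}"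
    unfolding distr2_def by (rule finite_measure.emeasure_eq_measure[OF fin, symmetric])
  also have "\<dots> = emeasure lebesgue {p\<in>?I \<times> ?I. s < \<bar>tensor f y p\<bar>}"
    using I2 by (subst emeasure_restrict_space) (auto intro: sets_completionI_sets)
  also have "\<dots> = emeasure lebesgue Q"
  proof (rule emeasure_eq_AE)
    show "AE p in lebesgue. p \<in> {p\<in>?I \<times> ?I. s < \<bar>tensor f y p\<bar>} \<longleftrightarrow> p \<in> Q"
      using AE_completion[OF AEh] by eventually_elim (auto simp: Q_def th)
    show "Q \<in> sets lebesgue" using Qb by (rule sets_completionI_sets)
    have "{p\<in>space (lebesgue_on (?I \<times> ?I)). s < \<bar>tensor f y p\<bar>} \<in> sets (lebesgue_on (?I \<times> ?I))"
      using tm by measurable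
    then show "{p\<in>?I \<times> ?I. s < \<bar>tensor f y p\<bar>} \<in> sets lebesgue"
      using I2 by (subst (asm) sets_restrict_space_iff) (auto intro: sets_completionI_sets)
  qed
  also have "\<dots> = emeasure (lborel \<Otimes>\<^sub>M lborel) Q"
    using Qb by (simp add: lborel_prod)
  finally have E: "ennreal (distr2 (tensor f y) s) = emeasure (lborel \<Otimes>\<^sub>M lborel) Q" .
  have r: "(\<integral>\<^sup>+ u. g u \<partial>L01) = (\<integral>\<^sup>+ u. g u * indicator ?I u \<partial>lborel)" for g
    by (simp add: nn_integral_restrict_space nn_integral_completion)
  have "emeasure (lborel \<Otimes>\<^sub>M lborel) Q = (\<integral>\<^sup>+ u. ennreal (distr (\<lambda>t. f u * y t) s) * indicator ?I u \<partial>lborel)"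
    unfolding lborel.emeasure_pair_measure_alt[OF QL]
  proof (rule nn_integral_cong_AE, use f' in eventually_elim)
    case (elim u)
    show ?case
    proof (cases "u \<in> ?I")
      case True
      then have "Pair u -` Q = {t\<in>?I. s < \<bar>f u * y' t\<bar>}"
        using elim by (auto simp: Q_def h'_def)
      then show ?thesis using distr_scaled_borel[OF y \<open>y' \<in> _\<close> y', of s "f u"] True by simp
    next
      case False
      then have "Pair u -` Q = {}" by (auto simp: Q_def)
      then show ?thesis using False by simp
    qed
  qed
  then show "ennreal (distr2 (tensor f y) s) = (\<integral>\<^sup>+ u. ennreal (distr (\<lambda>t. f u * y t) s) \<partial>L01)"
    unfolding E r .
  have "emeasure (lborel \<Otimes>\<^sub>M lborel) Q = (\<integral>\<^sup>+ t. ennreal (distr (\<lambda>u. y t * f u) s) * indicator ?I t \<partial>lborel)"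
    unfolding lborel_pair.emeasure_pair_measure_alt2[OF QL]
  proof (rule nn_integral_cong_AE, use y' in eventually_elim)
    case (elim t)
    show ?case
    proof (cases "t \<in> ?I")
      case True
      then have "(\<lambda>u. (u, t)) -` Q = {u\<in>?I. s < \<bar>y t * f' u\<bar>}"
        using elim by (auto simp: Q_def h'_def mult.commute)
      then show ?thesis using distr_scaled_borel[OF f \<open>f' \<in> _\<close> f', of s "y t"] True by simp
    next
      case False
      then have "(\<lambda>u. (u, t)) -` Q = {}" by (auto simp: Q_def)
      then show ?thesis using False by simp
    qed
  qed
  then show "ennreal (distr2 (tensor f y) s) = (\<integral>\<^sup>+ t. ennreal (distr (\<lambda>u. y t * f u) s) \<partial>L01)"
    unfolding E r .
qed

lemma distr_cmult:
  assumes "c \<noteq> 0"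
  shows "distr (\<lambda>t. c * y t) s = distr y (s / \<bar>c\<bar>)"
  using assms by (simp add: distr_def abs_mult field_simps)

lemma distr_cmult_mono:
  assumes "0 \<le> s" "\<And>s. 0 \<le> s \<Longrightarrow> distr y s \<le> distr y' s"
  shows "distr (\<lambda>t. c * y t) s \<le> distr (\<lambda>t. c * y' t) s"
  using assms by (cases "c = 0") (auto simp: distr_cmult)

text \<open>Each slice with u fixed is a multiple of the second factor, so only the distribution of
  that factor matters. This permits replacing y by its decreasing rearrangement.\<close>

lemma distr2_tensor_mono:
  assumes "meas01 f" "meas01 y" "meas01 y'" "0 \<le> s" "\<And>s. 0 \<le> s \<Longrightarrow> distr y s \<le> distr y' s"
  shows "distr2 (tensor f y) s \<le> distr2 (tensor f y') s"
proof -
  have "ennreal (distr2 (tensor f y) s) \<le> ennreal (distr2 (tensor f y') s)"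
    unfolding distr2_tensor_fst[OF assms(1,2)] distr2_tensor_fst[OF assms(1,3)]
    by (intro nn_integral_mono ennreal_leI distr_cmult_mono assms)
  then show ?thesis by (simp add: distr2_def)
qed

lemma meas01_dig: "(\<And>\<alpha>. length \<alpha> = k \<Longrightarrow> meas01 (F \<alpha>)) \<Longrightarrow> meas01 (\<lambda>t. F (dig k t) ((dbl ^^ k) t))"
  unfolding meas01_def by (rule borel_measurable_dig)

lemma meas01_step: "meas01 (\<lambda>t. \<xi> (dig k t))"
  using meas01_dig[of k "\<lambda>\<alpha> t. \<xi> \<alpha>"] by (simp add: meas01_def)

text \<open>Both sides are the average over words of the distributions of
  \<open>\<xi> \<alpha> * f\<close>. This is the bridge between norms on the square and norms of
  blocks.\<close>

lemma distr2_tensor_step: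
  assumes "meas01 f"
  shows "distr2 (tensor f (\<lambda>t. \<xi> (dig k t))) s = distr (\<lambda>t. \<xi> (dig k t) * f ((dbl ^^ k) t)) s"
proof -
  have cf: "meas01 (\<lambda>t. c * f t)" for c using assms by (auto simp: meas01_def)
  have i: "integrable L01 (\<lambda>t. distr (\<lambda>u. \<xi> \<alpha> * f u) s)" for \<alpha>
    by simp
  have [simp]: "measure lebesgue {0..1::real} = 1" by simp
  have "ennreal (distr2 (tensor f (\<lambda>t. \<xi> (dig k t))) s) = (\<integral>\<^sup>+ t. ennreal (distr (\<lambda>u. \<xi> (dig k t) * f u) s) \<partial>L01)"
    by (rule distr2_tensor_snd[OF assms meas01_step])
  also have "\<dots> = ennreal (integral\<^sup>L L01 (\<lambda>t. distr (\<lambda>u. \<xi> (dig k t) * f u) s))"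
    by (rule nn_integral_eq_integral)
       (use integral_dig(1)[of k "\<lambda>\<alpha> t. distr (\<lambda>u. \<xi> \<alpha> * f u) s", OF i] in \<open>auto simp: distr_nonneg\<close>)
  also have "integral\<^sup>L L01 (\<lambda>t. distr (\<lambda>u. \<xi> (dig k t) * f u) s) = (\<Sum>\<alpha>\<in>words k. distr (\<lambda>u. \<xi> \<alpha> * f u) s) / 2 ^ k"
    using integral_dig(2)[of k "\<lambda>\<alpha> t. distr (\<lambda>u. \<xi> \<alpha> * f u) s", OF i] measure_L01 by simp
  also have "\<dots> = distr (\<lambda>t. \<xi> (dig k t) * f ((dbl ^^ k) t)) s"
    using distr_dig[of k "\<lambda>\<alpha> u. \<xi> \<alpha> * f u" s] cf by simp
  finally show ?thesis by (simp add: distr2_def distr_nonneg)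
qed

section \<open>Symmetric spaces and order continuity\<close>

lemma meas01_AE:
  assumes "meas01 x" "AE t in L01. y t = x t"
  shows "meas01 y"
proof -
  have "(\<lambda>t. if t \<in> {0..1} then x t else 0) \<in> borel_measurable lebesgue"
    by (rule borel_measurable_if_I) (use assms in \<open>auto simp: meas01_def\<close>)
  moreover have "AE t in lebesgue. (if t \<in> {0..1} then x t else 0) = (if t \<in> {0..1} then y t else 0)"
    using assms(2) by (subst (asm) AE_restrict_space_iff) auto
  ultimately have "(\<lambda>t. if t \<in> {0..1} then y t else 0) \<in> borel_measurable lebesgue"
    by (rule borel_measurable_AE)
  then show ?thesis
    unfolding meas01_def by (rule borel_measurable_if_D)
qed

lemma distr_const_of_bool: "0 \<le> s \<Longrightarrow> distr (\<lambda>t. of_bool b) s = of_bool (b \<and> s < 1)"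
proof -
  assume "0 \<le> s"
  then have "{t\<in>{0..1::real}. s < \<bar>of_bool b :: real\<bar>} = (if b \<and> s < 1 then {0..1} else {})"
    by auto
  then show ?thesis using measure_L01 by (simp add: distr_def)
qed

lemma distr_of_bool:
  "0 \<le> s \<Longrightarrow> distr (\<lambda>t. of_bool (P t)) s = (if s < 1 then measure L01 {t\<in>{0..1}. P t} else 0)"
proof -
  assume "0 \<le> s"
  then have "{t\<in>{0..1::real}. s < \<bar>of_bool (P t) :: real\<bar>} = (if s < 1 then {t\<in>{0..1}. P t} else {})"
    by auto
  then show ?thesis by (simp add: distr_def)
qed

lemma meas01_of_bool: "{t\<in>{0..1}. P t} \<in> sets L01 \<Longrightarrow> meas01 (\<lambda>t. of_bool (P t))"
proof -
  assume "{t\<in>{0..1}. P t} \<in> sets L01"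
  then have "(indicator {t\<in>{0..1}. P t} :: real \<Rightarrow> real) \<in> borel_measurable L01"
    by (rule borel_measurable_indicator)
  then show ?thesis unfolding meas01_def
    by (subst measurable_lebesgue_cong[where g = "indicator {t\<in>{0..1}. P t}"]) (auto simp: indicator_def)
qed

lemma measure_L01_Ioc: "0 \<le> a \<Longrightarrow> a \<le> b \<Longrightarrow> b \<le> 1 \<Longrightarrow> measure L01 {t\<in>{0..1}. a < t \<and> t \<le> b} = b - a"
proof -
  assume *: "0 \<le> a" "a \<le> b" "b \<le> 1"
  then have eq: "{t\<in>{0..1}. a < t \<and> t \<le> b} = {a<..b}" by auto
  have "{a<..b} \<subseteq> {0..1}" using * by auto
  then show ?thesis unfolding eq using * by (simp add: measure_restrict_space)
qed

lemma sets_L01_Ioc: "{t\<in>{0..1}. a < t \<and> t \<le> b} \<in> sets L01"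
proof -
  have "{t\<in>{0..1}. a < t \<and> t \<le> b} = {0..1} \<inter> {a<..b}" by auto
  then show ?thesis by (auto simp: sets_restrict_space_iff)
qed

lemma meas01_shift:
  assumes "meas01 v" "0 \<le> \<tau>" "\<tau> + b \<le> 1"
  shows "meas01 (\<lambda>t. of_bool (\<tau> < t \<and> t \<le> \<tau> + b) * v (t - \<tau>))"
proof -
  define v' where "v' = (\<lambda>x. if x \<in> {0..1} then v x else 0)"
  have v': "v' \<in> borel_measurable lebesgue"
    unfolding v'_def by (rule borel_measurable_if_I) (use assms in \<open>auto simp: meas01_def\<close>)
  have "(\<lambda>x. - \<tau> + 1 * x) \<in> lebesgue \<rightarrow>\<^sub>M (lebesgue :: real measure)"
    using lebesgue_affine_measurable[of "\<lambda>_::real. 1" "-\<tau>"] by simp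
  from measurable_compose[OF this v']
  have "(\<lambda>x. v' (- \<tau> + 1 * x)) \<in> borel_measurable lebesgue" by simp
  then have m1: "(\<lambda>x. v' (- \<tau> + 1 * x)) \<in> borel_measurable L01"
    by (rule measurable_restrict_space1)
  have m2: "(\<lambda>t. of_bool (\<tau> < t \<and> t \<le> \<tau> + b) :: real) \<in> borel_measurable L01"
    using meas01_of_bool[OF sets_L01_Ioc[of \<tau> "\<tau> + b"]] by (simp add: meas01_def)
  have "(\<lambda>t. of_bool (\<tau> < t \<and> t \<le> \<tau> + b) * v' (- \<tau> + 1 * t)) \<in> borel_measurable L01"
    using m1 m2 by (rule borel_measurable_times[rotated])
  moreover have "(\<lambda>t. of_bool (\<tau> < t \<and> t \<le> \<tau> + b) * v' (- \<tau> + 1 * t)) = (\<lambda>t. of_bool (\<tau> < t \<and> t \<le> \<tau> + b) * v (t - \<tau>))"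
    using assms by (auto simp: v'_def fun_eq_iff)
  ultimately show ?thesis by (simp add: meas01_def)
qed

lemma distr_shift:
  assumes "0 \<le> \<tau>" "\<tau> + b \<le> 1" "0 \<le> s"
  shows "distr (\<lambda>t. of_bool (\<tau> < t \<and> t \<le> \<tau> + b) * v (t - \<tau>)) s = distr (\<lambda>t. of_bool (0 < t \<and> t \<le> b) * v t) s"
proof -
  have eq: "{t\<in>{0..1}. s < \<bar>of_bool (\<tau> < t \<and> t \<le> \<tau> + b) * v (t - \<tau>)\<bar>} =
      (+) \<tau> ` {t\<in>{0..1}. s < \<bar>of_bool (0 < t \<and> t \<le> b) * v t\<bar>}" (is "?A = (+) \<tau> ` ?B")
  proof (intro equalityI subsetI)
    fix t assume "t \<in> ?A"
    moreover from this have "\<tau> < t \<and> t \<le> \<tau> + b"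
      using assms(3) by (intro ccontr[of "\<tau> < t \<and> t \<le> \<tau> + b"]) simp
    ultimately have "t - \<tau> \<in> ?B" using assms by auto
    then show "t \<in> (+) \<tau> ` ?B" by (metis (no_types, lifting) add_diff_cancel_left' diff_add_cancel add.commute image_eqI)
  next
    fix t assume "t \<in> (+) \<tau> ` ?B"
    then obtain u where u: "t = \<tau> + u" "u \<in> ?B" by blast
    moreover from this have "0 < u \<and> u \<le> b"
      using assms(3) by (intro ccontr[of "0 < u \<and> u \<le> b"]) simp
    ultimately show "t \<in> ?A" using assms by auto
  qed
  have "measure lebesgue ?A = measure lebesgue ?B" unfolding eq by (rule measure_translation)
  moreover have r: "measure L01 A = measure lebesgue A" if "A \<subseteq> {0..1}" for A :: "real set"
    using that by (simp add: measure_restrict_space)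
  have "measure L01 ?A = measure lebesgue ?A" "measure L01 ?B = measure lebesgue ?B"
    by (rule r, blast)+
  ultimately show ?thesis unfolding distr_def by metis
qed

section \<open>Norm comparison in symmetric spaces\<close>

locale sym_space =
  fixes X :: "(real \<Rightarrow> real) set" and N :: "(real \<Rightarrow> real) \<Rightarrow> real"
  assumes symmetric: "symmetric_space X N"
begin

lemma meas01_X: "x \<in> X \<Longrightarrow> meas01 x"
  and zero_X: "(\<lambda>t. 0) \<in> X"
  and add_X: "x \<in> X \<Longrightarrow> y \<in> X \<Longrightarrow> (\<lambda>t. x t + y t) \<in> X"
  and cmult_X: "x \<in> X \<Longrightarrow> (\<lambda>t. c * x t) \<in> X"
  and N_nonneg: "x \<in> X \<Longrightarrow> 0 \<le> N x"
  and N_eq_0_iff: "x \<in> X \<Longrightarrow> N x = 0 \<longleftrightarrow> (AE t in L01. x t = 0)"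
  and N_add: "x \<in> X \<Longrightarrow> y \<in> X \<Longrightarrow> N (\<lambda>t. x t + y t) \<le> N x + N y"
  and N_cmult: "x \<in> X \<Longrightarrow> N (\<lambda>t. c * x t) = \<bar>c\<bar> * N x"
  and N_one: "N (\<lambda>t. 1) = 1"
  by (insert symmetric[unfolded symmetric_space_def], (elim conjE, blast)+)

lemma complete_X:
  assumes "\<And>n. s n \<in> X" "\<And>e. 0 < e \<Longrightarrow> \<exists>M. \<forall>m\<ge>M. \<forall>n\<ge>M. N (\<lambda>t. s m t - s n t) < e"
  obtains x where "x \<in> X" "(\<lambda>n. N (\<lambda>t. s n t - x t)) \<longlonglongrightarrow> 0"
proof -
  have "\<forall>s. (\<forall>n. s n \<in> X) \<longrightarrow>
          (\<forall>e>0. \<exists>M. \<forall>m\<ge>M. \<forall>n\<ge>M. N (\<lambda>t. s m t - s n t) < e) \<longrightarrow>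
          (\<exists>x\<in>X. (\<lambda>n. N (\<lambda>t. s n t - x t)) \<longlonglongrightarrow> 0)"
    using symmetric unfolding symmetric_space_def by (elim conjE)
  then show ?thesis using assms that by blast
qed

lemma ideal_X:
  assumes "y \<in> X" "meas01 x" "AE t in L01. \<bar>x t\<bar> \<le> \<bar>y t\<bar>"
  shows "x \<in> X" "N x \<le> N y"
  by (insert assms symmetric[unfolded symmetric_space_def], (elim conjE, blast)+)

lemma equimeasurable_X:
  assumes "y \<in> X" "meas01 x" "equimeasurable x y"
  shows "x \<in> X" "N x = N y"
  by (insert assms symmetric[unfolded symmetric_space_def], (elim conjE, blast)+)

lemma diff_X: "x \<in> X \<Longrightarrow> y \<in> X \<Longrightarrow> (\<lambda>t. x t - y t) \<in> X"
  using add_X[of x "\<lambda>t. (-1) * y t"] cmult_X[of y "-1"] by simp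

lemma N_diff_commute: "x \<in> X \<Longrightarrow> y \<in> X \<Longrightarrow> N (\<lambda>t. x t - y t) = N (\<lambda>t. y t - x t)"
  using N_cmult[of "\<lambda>t. x t - y t" "-1"] diff_X by simp

lemma N_diff_triangle:
  assumes "x \<in> X" "y \<in> X" "z \<in> X"
  shows "N (\<lambda>t. x t - z t) \<le> N (\<lambda>t. x t - y t) + N (\<lambda>t. y t - z t)"
  using N_add[of "\<lambda>t. x t - y t" "\<lambda>t. y t - z t"] diff_X assms by simp

lemma N_le_diff:
  assumes "x \<in> X" "y \<in> X"
  shows "N x \<le> N (\<lambda>t. x t - y t) + N y"
  using N_add[of "\<lambda>t. x t - y t" y] diff_X assms by simp

lemma sum_X:
  assumes "finite A" "\<And>i. i \<in> A \<Longrightarrow> x i \<in> X"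
  shows "(\<lambda>t. \<Sum>i\<in>A. x i t) \<in> X" "N (\<lambda>t. \<Sum>i\<in>A. x i t) \<le> (\<Sum>i\<in>A. N (x i))"
proof -
  have "(\<lambda>t. \<Sum>i\<in>A. x i t) \<in> X \<and> N (\<lambda>t. \<Sum>i\<in>A. x i t) \<le> (\<Sum>i\<in>A. N (x i))"
    using assms
  proof (induction rule: finite_induct)
    case empty
    then show ?case using zero_X N_eq_0_iff[OF zero_X] by simp
  next
    case (insert a A)
    then have IH: "(\<lambda>t. \<Sum>i\<in>A. x i t) \<in> X" "N (\<lambda>t. \<Sum>i\<in>A. x i t) \<le> (\<Sum>i\<in>A. N (x i))" by auto
    have "x a \<in> X" using insert by auto
    with IH N_add[OF this IH(1)] add_X[OF this IH(1)] insert(1,2) show ?case by simp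
  qed
  then show "(\<lambda>t. \<Sum>i\<in>A. x i t) \<in> X" "N (\<lambda>t. \<Sum>i\<in>A. x i t) \<le> (\<Sum>i\<in>A. N (x i))" by auto
qed

lemma AE_eq_X:
  assumes "x \<in> X" "AE t in L01. y t = x t"
  shows "y \<in> X" "N y = N x"
proof -
  have y: "meas01 y" by (rule meas01_AE[OF meas01_X[OF assms(1)] assms(2)])
  have "AE t in L01. \<bar>y t\<bar> \<le> \<bar>x t\<bar>" "AE t in L01. \<bar>x t\<bar> \<le> \<bar>y t\<bar>"
    using assms(2) by (eventually_elim, simp)+
  with ideal_X[OF assms(1) y] ideal_X[OF _ meas01_X[OF assms(1)], of y] show "y \<in> X" "N y = N x"
    by auto
qed

lemma abs_X: "x \<in> X \<Longrightarrow> (\<lambda>t. \<bar>x t\<bar>) \<in> X" "x \<in> X \<Longrightarrow> N (\<lambda>t. \<bar>x t\<bar>) = N x"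
proof -
  assume x: "x \<in> X"
  have "meas01 (\<lambda>t. \<bar>x t\<bar>)" using meas01_X[OF x] by (auto simp: meas01_def)
  from equimeasurable_X[OF x this] show "(\<lambda>t. \<bar>x t\<bar>) \<in> X" "N (\<lambda>t. \<bar>x t\<bar>) = N x"
    by (auto simp: equimeasurable_def distr_def)
qed

lemma rearr_X:
  assumes "x \<in> X"
  shows "rearr (distr x) \<in> X" "N (rearr (distr x)) = N x"
proof -
  have d: "distribution_fun (distr x)" using distribution_fun_distr meas01_X assms by blast
  have "equimeasurable (rearr (distr x)) x"
    by (rule equimeasurableI) (rule distr_rearr[OF d])
  then show "rearr (distr x) \<in> X" "N (rearr (distr x)) = N x"
    using equimeasurable_X[OF assms meas01_rearr[OF d]] by auto
qed

text \<open>Smaller distribution functions have pointwise smaller rearrangements, so the ideal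
  property applies to the latter. The function d may come from the square, where no function on
  [0,1] is given in advance.\<close>

lemma rearr_dominated_X:
  assumes x: "x \<in> X" and d: "distribution_fun d" and le: "\<And>s. 0 \<le> s \<Longrightarrow> d s \<le> distr x s"
  shows "rearr d \<in> X" "N (rearr d) \<le> N x"
proof -
  have dx: "distribution_fun (distr x)" using distribution_fun_distr meas01_X x by blast
  have "AE t in L01. \<bar>rearr d t\<bar> \<le> \<bar>rearr (distr x) t\<bar>"
    using AE_L01_pos
  proof eventually_elim
    case (elim t)
    then show ?case
      using rearr_mono[OF d dx le, of t] rearr_nonneg[OF d, of t] rearr_nonneg[OF dx, of t] by auto
  qed
  from ideal_X[OF rearr_X(1)[OF x] meas01_rearr[OF d] this] rearr_X(2)[OF x]
  show "rearr d \<in> X" "N (rearr d) \<le> N x" by auto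
qed

lemma distr_dominated_X:
  assumes x: "x \<in> X" and y: "meas01 y" and le: "\<And>s. 0 \<le> s \<Longrightarrow> distr y s \<le> distr x s"
  shows "y \<in> X" "N y \<le> N x"
proof -
  have d: "distribution_fun (distr y)" by (rule distribution_fun_distr[OF y])
  note r = rearr_dominated_X[OF x d le]
  have "equimeasurable y (rearr (distr y))"
    by (rule equimeasurableI) (simp add: distr_rearr[OF d])
  from equimeasurable_X[OF r(1) y this] r show "y \<in> X" "N y \<le> N x" by auto
qed

text \<open>The normalisation fixes the value of \<open>N\<close> at the constant 1; membership in X
  is derived here. A nonzero x exceeds some e > 0 on a set larger than a dyadic interval of level k,
  so x/e dominates in distribution the indicator of each such interval, and 2^k of these add up to
  1.\<close>

lemma one_X:
  assumes x: "x \<in> X" and nz: "\<not> (AE t in L01. x t = 0)"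
  shows "(\<lambda>t. 1) \<in> X"
proof -
  have xm: "meas01 x" by (rule meas01_X[OF x])
  have "distr x 0 \<noteq> 0"
  proof
    assume "distr x 0 = 0"
    then have "{t\<in>{0..1}. 0 < \<bar>x t\<bar>} \<in> null_sets L01"
      using distr_set[OF xm, of 0] by (auto simp: distr_def null_sets_def L01.emeasure_eq_measure)
    then have "AE t in L01. t \<notin> {t\<in>{0..1}. 0 < \<bar>x t\<bar>}" by (rule AE_not_in)
    with AE_off_rationals have "AE t in L01. x t = 0" by eventually_elim auto
    with nz show False ..
  qed
  then have "0 < distr x 0" using distr_nonneg[of x 0] by linarith
  moreover have "(\<lambda>n. distr x (0 + 1 / Suc n)) \<longlonglongrightarrow> distr x 0"
    using distribution_fun_distr[OF xm] unfolding distribution_fun_def by blast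
  ultimately obtain n where "0 < distr x (0 + 1 / Suc n)"
    using order_tendstoD(1)[of "\<lambda>n. distr x (0 + 1 / Suc n)" "distr x 0" sequentially 0] by (auto simp: eventually_sequentially)
  then obtain e where e: "0 < e" "0 < distr x e" by (metis add_0 divide_pos_pos of_nat_0_less_iff zero_less_Suc zero_less_one)
  obtain k :: nat where k: "(1 / 2) ^ k < distr x e"
    using real_arch_pow_inv[OF e(2), of "1/2"] by auto
  have "(\<lambda>t. of_bool (dig k t = \<alpha>)) \<in> X" if "length \<alpha> = k" for \<alpha>
  proof (rule distr_dominated_X)
    show "(\<lambda>t. (1 / e) * x t) \<in> X" by (rule cmult_X[OF x])
    show "meas01 (\<lambda>t. of_bool (dig k t = \<alpha>))" by (rule meas01_step)
    fix s :: real assume s: "0 \<le> s"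
    have "distr (\<lambda>t. of_bool (dig k t = \<alpha>)) s = (\<Sum>\<beta>\<in>words k. distr (\<lambda>t. of_bool (\<beta> = \<alpha>)) s) / 2 ^ k"
      by (rule distr_dig[of k "\<lambda>\<beta> t. of_bool (\<beta> = \<alpha>)"]) (simp add: meas01_def)
    also have "\<dots> = (\<Sum>\<beta>\<in>words k. if \<beta> = \<alpha> then of_bool (s < 1) else 0) / 2 ^ k"
      using s by (intro arg_cong2[where f = "(/)"] sum.cong) (auto simp: distr_const_of_bool)
    also have "\<dots> = of_bool (s < 1) / 2 ^ k" using that by simp
    also have "\<dots> \<le> distr (\<lambda>t. (1 / e) * x t) s"
    proof (cases "s < 1")
      case True
      then have "distr x e \<le> distr x (s * e)"
        using e by (intro distr_mono_arg[OF xm]) auto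
      then show ?thesis using e k True by (simp add: distr_cmult power_one_over del: times_divide_eq_left)
    qed (simp add: distr_nonneg)
    finally show "distr (\<lambda>t. of_bool (dig k t = \<alpha>)) s \<le> distr (\<lambda>t. (1 / e) * x t) s" .
  qed
  then have "(\<lambda>t. \<Sum>\<alpha>\<in>words k. of_bool (dig k t = \<alpha>)) \<in> X"
    by (intro sum_X(1)) auto
  moreover have "(\<Sum>\<alpha>\<in>words k. of_bool (dig k t = \<alpha>)) = (1 :: real)" for t
    by (simp add: of_bool_def)
  ultimately show ?thesis by simp
qed

end

section \<open>Separability and order continuity\<close>

locale sep_sym_space = sym_space +
  assumes separable: "separable_fnspace X N"
    and one_in: "(\<lambda>t. 1) \<in> X"
begin

lemma bounded_X:
  assumes "meas01 x" "\<And>t. t \<in> {0..1} \<Longrightarrow> \<bar>x t\<bar> \<le> B"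
  shows "x \<in> X" "N x \<le> B"
proof -
  have B: "0 \<le> B" using assms(2)[of 0] by auto
  have "AE t in L01. \<bar>x t\<bar> \<le> \<bar>B * 1\<bar>"
    using assms(2) B by (intro AE_I2) auto
  from ideal_X[OF cmult_X[OF one_in, of B] assms(1) this] N_cmult[OF one_in, of B] N_one B
  show "x \<in> X" "N x \<le> B" by auto
qed

text \<open>Pigeonhole: uncountably many indices share countably many approximants, so two indices
  have the same one.\<close>

lemma separable_collision:
  assumes "\<And>\<tau>. \<tau> \<in> {0..1/2::real} \<Longrightarrow> w \<tau> \<in> X" "0 < e"
  obtains \<tau> \<sigma> where "0 \<le> \<tau>" "\<tau> < \<sigma>" "\<sigma> \<le> 1/2" "N (\<lambda>t. w \<sigma> t - w \<tau> t) < e"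
proof -
  obtain D where D: "countable D" "D \<subseteq> X" "\<And>x e. x \<in> X \<Longrightarrow> 0 < e \<Longrightarrow> \<exists>d\<in>D. N (\<lambda>t. x t - d t) < e"
    using separable unfolding separable_fnspace_def by blast
  have "\<forall>\<tau>\<in>{0..1/2}. \<exists>d\<in>D. N (\<lambda>t. w \<tau> t - d t) < e / 2"
    by (intro ballI D(3)) (use assms in auto)
  then obtain d where d: "\<And>\<tau>. \<tau> \<in> {0..1/2} \<Longrightarrow> d \<tau> \<in> D" "\<And>\<tau>. \<tau> \<in> {0..1/2} \<Longrightarrow> N (\<lambda>t. w \<tau> t - d \<tau> t) < e / 2"
    by metis
  have "\<not> inj_on d {0..1/2}"
  proof
    assume "inj_on d {0..1/2}"
    moreover have "countable (d ` {0..1/2})" using d(1) D(1) by (meson countable_subset image_subsetI)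
    ultimately have "countable {0..1/2::real}" by (metis countable_image_inj_on)
    then show False using uncountable_closed_interval[of 0 "1/2::real"] by simp
  qed
  then obtain a b where ab: "a \<in> {0..1/2}" "b \<in> {0..1/2}" "a < b" "d a = d b"
    unfolding inj_on_def by (metis linorder_neqE_linordered_idom)
  have X: "w a \<in> X" "w b \<in> X" "d b \<in> X" using ab assms(1) d(1) D(2) by auto
  have "N (\<lambda>t. w b t - w a t) \<le> N (\<lambda>t. w b t - d b t) + N (\<lambda>t. d b t - w a t)"
    by (rule N_diff_triangle[OF X(2,3,1)])
  also have "N (\<lambda>t. d b t - w a t) = N (\<lambda>t. w a t - d a t)"
    using N_diff_commute[OF X(3,1)] ab by simp
  also have "N (\<lambda>t. w b t - d b t) + N (\<lambda>t. w a t - d a t) < e"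
    using d(2)[OF ab(1)] d(2)[OF ab(2)] by simp
  finally show ?thesis using that[of a b] ab by auto
qed

lemma of_bool_X: "{t\<in>{0..1}. P t} \<in> sets L01 \<Longrightarrow> (\<lambda>t. of_bool (P t)) \<in> X"
  by (rule bounded_X[of _ 1]) (auto intro: meas01_of_bool)

lemma N_of_bool_mono:
  assumes "{t\<in>{0..1}. P t} \<in> sets L01" "{t\<in>{0..1}. Q t} \<in> sets L01"
    and "measure L01 {t\<in>{0..1}. P t} \<le> measure L01 {t\<in>{0..1}. Q t}"
  shows "N (\<lambda>t. of_bool (P t)) \<le> N (\<lambda>t. of_bool (Q t))"
  by (rule distr_dominated_X) (use assms in \<open>auto intro: of_bool_X meas01_of_bool simp: distr_of_bool\<close>)

text \<open>Two indicators of initial intervals collide by \<open>separable_collision\<close>. Their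
  difference is the indicator of an interval of positive length, and by symmetry it controls every
  set of at most that measure.\<close>

lemma N_indicator_small:
  assumes "0 < e"
  obtains \<delta> where "0 < \<delta>" "\<delta> \<le> 1/2"
    "\<And>P. {t\<in>{0..1}. P t} \<in> sets L01 \<Longrightarrow> measure L01 {t\<in>{0..1}. P t} \<le> \<delta> \<Longrightarrow> N (\<lambda>t. of_bool (P t)) < e"
proof -
  obtain \<tau> \<sigma> :: real where ts: "0 \<le> \<tau>" "\<tau> < \<sigma>" "\<sigma> \<le> 1/2"
    and small: "N (\<lambda>t. of_bool (0 < t \<and> t \<le> \<sigma>) - of_bool (0 < t \<and> t \<le> \<tau>)) < e"
    using separable_collision[of "\<lambda>\<tau> t. of_bool (0 < t \<and> t \<le> \<tau>)", OF of_bool_X[OF sets_L01_Ioc] assms] by blast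
  have "(\<lambda>t. of_bool (0 < t \<and> t \<le> \<sigma>) - of_bool (0 < t \<and> t \<le> \<tau>) :: real) = (\<lambda>t. of_bool (\<tau> < t \<and> t \<le> \<sigma>))"
    using ts by (auto simp: fun_eq_iff)
  with small have small: "N (\<lambda>t. of_bool (\<tau> < t \<and> t \<le> \<sigma>)) < e" by simp
  show ?thesis
  proof (rule that[of "\<sigma> - \<tau>"])
    fix P assume P: "{t\<in>{0..1}. P t} \<in> sets L01" "measure L01 {t\<in>{0..1}. P t} \<le> \<sigma> - \<tau>"
    have "N (\<lambda>t. of_bool (P t)) \<le> N (\<lambda>t. of_bool (\<tau> < t \<and> t \<le> \<sigma>))"
      using measure_L01_Ioc[of \<tau> \<sigma>] ts P by (intro N_of_bool_mono sets_L01_Ioc) auto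
    with small show "N (\<lambda>t. of_bool (P t)) < e" by simp
  qed (use ts in auto)
qed

text \<open>Order continuity of the norm: if the norms of the initial pieces of the rearrangement stayed
  above a positive constant, its translates would form an uncountable separated family.\<close>

lemma N_rearr_initial_small:
  assumes x: "x \<in> X" and "0 < e"
  obtains \<delta> where "0 < \<delta>" "\<delta> \<le> 1/2" "N (\<lambda>t. of_bool (0 < t \<and> t \<le> \<delta>) * rearr (distr x) t) < e"
proof -
  define r where "r = rearr (distr x)"
  have d: "distribution_fun (distr x)" using distribution_fun_distr meas01_X x by blast
  have r: "r \<in> X" unfolding r_def by (rule rearr_X(1)[OF x])
  have rm: "meas01 r" by (rule meas01_X[OF r])
  have r0: "0 \<le> r t" if "0 < t" for t unfolding r_def using rearr_nonneg[OF d that] .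
  have ranti: "r t' \<le> r t" if "0 < t" "t \<le> t'" for t t' unfolding r_def using rearr_antimono[OF d that] .
  \<comment> \<open>Cutting at 1/2 keeps all translates with \<tau> \<le> 1/2 inside [0,1].\<close>
  define w where "w \<tau> t = of_bool (\<tau> < t \<and> t \<le> \<tau> + 1/2) * r (t - \<tau>)" for \<tau> t
  have mcut: "meas01 (\<lambda>t. of_bool (0 < t \<and> t \<le> b) * r t)" for b
    using meas01_of_bool[OF sets_L01_Ioc[of 0 b]] rm by (auto simp: meas01_def)
  have cut: "(\<lambda>t. of_bool (0 < t \<and> t \<le> b) * r t) \<in> X" for b
    by (rule ideal_X(1)[OF r mcut]) auto
  have shift: "(\<lambda>t. of_bool (\<tau> < t \<and> t \<le> \<tau> + b) * r (t - \<tau>)) \<in> X"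
    "N (\<lambda>t. of_bool (\<tau> < t \<and> t \<le> \<tau> + b) * r (t - \<tau>)) = N (\<lambda>t. of_bool (0 < t \<and> t \<le> b) * r t)"
    if "0 \<le> \<tau>" "\<tau> + b \<le> 1" for \<tau> b
    using equimeasurable_X[OF cut meas01_shift[OF rm that] equimeasurableI[OF distr_shift[OF that]]] by auto
  have wX: "w \<tau> \<in> X" if "\<tau> \<in> {0..1/2}" for \<tau>
    using shift(1)[of \<tau> "1/2"] that by (simp add: w_def[abs_def])
  obtain \<tau> \<sigma> where ts: "0 \<le> \<tau>" "\<tau> < \<sigma>" "\<sigma> \<le> 1/2" and small: "N (\<lambda>t. w \<sigma> t - w \<tau> t) < e / 2"
    using separable_collision[of w "e / 2", OF wX] \<open>0 < e\<close> by auto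
  \<comment> \<open>To the right of \<sigma> the translate starting at \<tau> has come down to at
    most \<open>M\<close>, whereas the one starting at \<sigma> begins its peak there. So the peak
    is bounded by the difference of the two plus \<open>M\<close> on a short interval, whose length
    is still free.\<close>
  define M where "M = r (\<sigma> - \<tau>)"
  have M: "0 \<le> M" unfolding M_def using r0 ts by simp
  obtain \<delta> where \<delta>: "0 < \<delta>" "\<delta> \<le> 1/2"
    "\<And>P. {t\<in>{0..1}. P t} \<in> sets L01 \<Longrightarrow> measure L01 {t\<in>{0..1}. P t} \<le> \<delta> \<Longrightarrow> N (\<lambda>t. of_bool (P t)) < e / 2 / (M + 1)"
    using N_indicator_small[of "e / 2 / (M + 1)"] M \<open>0 < e\<close> by auto
  let ?E = "\<lambda>t. of_bool (\<sigma> < t \<and> t \<le> \<sigma> + \<delta>) :: real"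
  have EX: "?E \<in> X" by (rule of_bool_X[OF sets_L01_Ioc])
  have "N ?E < e / 2 / (M + 1)"
    using \<delta> ts measure_L01_Ioc[of \<sigma> "\<sigma> + \<delta>"] by (intro \<delta>(3) sets_L01_Ioc) auto
  then have "M * N ?E \<le> e / 2"
    using M N_nonneg[OF EX] by (simp add: field_simps)
  have dX: "(\<lambda>t. \<bar>w \<sigma> t - w \<tau> t\<bar>) \<in> X" using ts by (intro abs_X(1) diff_X wX) auto
  have sX: "(\<lambda>t. \<bar>w \<sigma> t - w \<tau> t\<bar> + M * ?E t) \<in> X"
    by (rule add_X[OF dX cmult_X[OF EX]])
  have "N (\<lambda>t. of_bool (0 < t \<and> t \<le> \<delta>) * r t) = N (\<lambda>t. ?E t * r (t - \<sigma>))"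
    using shift(2)[of \<sigma> \<delta>] ts \<delta> by simp
  also have "\<dots> \<le> N (\<lambda>t. \<bar>w \<sigma> t - w \<tau> t\<bar> + M * ?E t)"
  proof (rule ideal_X(2)[OF sX])
    show "meas01 (\<lambda>t. ?E t * r (t - \<sigma>))"
      using meas01_X[OF shift(1)[of \<sigma> \<delta>]] ts \<delta> by simp
    have "\<bar>?E t * r (t - \<sigma>)\<bar> \<le> \<bar>\<bar>w \<sigma> t - w \<tau> t\<bar> + M * ?E t\<bar>" for t
    proof (cases "\<sigma> < t \<and> t \<le> \<sigma> + \<delta>")
      case True
      then have "w \<sigma> t = r (t - \<sigma>)" using \<delta> by (simp add: w_def)
      moreover have "0 \<le> r (t - \<sigma>)" using r0 True by simp
      moreover have "0 \<le> r (t - \<tau>)" "r (t - \<tau>) \<le> M"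
        using r0[of "t - \<tau>"] ranti[of "\<sigma> - \<tau>" "t - \<tau>"] True ts by (auto simp: M_def)
      then have "w \<tau> t \<le> M" using M by (auto simp: w_def)
      ultimately show ?thesis using True by auto
    next
      case False
      then have "?E t = 0" by simp
      then show ?thesis by (simp del: of_bool_eq_0_iff)
    qed
    then show "AE t in L01. \<bar>?E t * r (t - \<sigma>)\<bar> \<le> \<bar>\<bar>w \<sigma> t - w \<tau> t\<bar> + M * ?E t\<bar>"
      by (intro AE_I2)
  qed
  also have "\<dots> \<le> N (\<lambda>t. \<bar>w \<sigma> t - w \<tau> t\<bar>) + N (\<lambda>t. M * ?E t)"
    by (rule N_add[OF dX cmult_X[OF EX]])
  also have "N (\<lambda>t. \<bar>w \<sigma> t - w \<tau> t\<bar>) < e / 2"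
    using small abs_X(2)[OF diff_X[OF wX wX], of \<sigma> \<tau>] ts by simp
  also have "N (\<lambda>t. M * ?E t) \<le> e / 2"
    using N_cmult[OF EX, of M] M \<open>M * N ?E \<le> e / 2\<close> by simp
  finally have "N (\<lambda>t. of_bool (0 < t \<and> t \<le> \<delta>) * r t) < e" by simp
  then show ?thesis using that \<delta>(1,2) unfolding r_def by blast
qed

text \<open>As soon as |x| > n holds only on a set of measure below \<delta>, the part of x above n
  is dominated in distribution by the piece of the rearrangement on (0, \<delta>].\<close>

lemma N_large_part_small:
  assumes x: "x \<in> X" and "0 < e"
  obtains n :: nat where "(\<lambda>t. if real n < \<bar>x t\<bar> then x t else 0) \<in> X"
    "N (\<lambda>t. if real n < \<bar>x t\<bar> then x t else 0) < e"
proof -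
  have xm: "meas01 x" by (rule meas01_X[OF x])
  have d: "distribution_fun (distr x)" by (rule distribution_fun_distr[OF xm])
  obtain \<delta> where \<delta>: "0 < \<delta>" "\<delta> \<le> 1/2" "N (\<lambda>t. of_bool (0 < t \<and> t \<le> \<delta>) * rearr (distr x) t) < e"
    using N_rearr_initial_small[OF assms] .
  let ?r = "\<lambda>t. of_bool (0 < t \<and> t \<le> \<delta>) * rearr (distr x) t"
  have rm: "meas01 ?r"
    using meas01_of_bool[OF sets_L01_Ioc[of 0 \<delta>]] meas01_rearr[OF d] by (auto simp: meas01_def)
  have rX: "?r \<in> X"
    by (rule ideal_X(1)[OF rearr_X(1)[OF x] rm]) auto
  have "(\<lambda>n. distr x (real n)) \<longlonglongrightarrow> 0" using d by (simp add: distribution_fun_def)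
  from order_tendstoD(2)[OF this \<open>0 < \<delta>\<close>] obtain n where n: "distr x (real n) < \<delta>"
    by (auto simp: eventually_sequentially)
  let ?y = "\<lambda>t. if real n < \<bar>x t\<bar> then x t else 0"
  have ym: "meas01 ?y" using xm unfolding meas01_def by measurable
  have le: "distr ?y s \<le> distr ?r s" if "0 \<le> s" for s
  proof -
    have "distr ?y s = distr x (max s (real n))"
      using that unfolding distr_def by (intro arg_cong[where f = "measure L01"]) auto
    also have "\<dots> \<le> min \<delta> (distr x s)"
      using n distr_mono_arg[OF xm, of s "max s (real n)"] distr_mono_arg[OF xm, of "real n" "max s (real n)"] by auto
    also have "\<dots> = measure L01 {0<..<min \<delta> (distr x s)}"
      using \<delta> distr_nonneg[of x s] by (intro measure_L01_interval[symmetric]) auto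
    also have "\<dots> \<le> distr ?r s"
      unfolding distr_def[of ?r]
    proof (rule L01.finite_measure_mono[OF _ distr_set[OF rm]])
      show "{0<..<min \<delta> (distr x s)} \<subseteq> {t \<in> {0..1}. s < \<bar>?r t\<bar>}"
      proof
        fix t assume t: "t \<in> {0<..<min \<delta> (distr x s)}"
        then have "s < rearr (distr x) t" using less_rearr_iff[OF d, of t s] that by auto
        then show "t \<in> {t \<in> {0..1}. s < \<bar>?r t\<bar>}" using t \<delta> that by auto
      qed
    qed
    finally show ?thesis .
  qed
  show ?thesis
    using that[of n] distr_dominated_X[OF rX ym le] \<delta>(3) by auto
qed

text \<open>Chebyshev's inequality makes |u| > e/2 a set of small measure, on which the bound B and
  order continuity apply; elsewhere |u| is at most e/2.\<close>

lemma N_small_of_square_integral: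
  assumes "0 < e" "0 \<le> B"
  obtains \<delta> where "0 < \<delta>"
    "\<And>u. meas01 u \<Longrightarrow> (\<And>t. t \<in> {0..1} \<Longrightarrow> \<bar>u t\<bar> \<le> B) \<Longrightarrow> integral\<^sup>L L01 (\<lambda>t. (u t)\<^sup>2) \<le> \<delta> \<Longrightarrow> N u < e"
proof -
  obtain \<eta> where \<eta>: "0 < \<eta>" "\<eta> \<le> 1/2"
    "\<And>P. {t\<in>{0..1}. P t} \<in> sets L01 \<Longrightarrow> measure L01 {t\<in>{0..1}. P t} \<le> \<eta> \<Longrightarrow> N (\<lambda>t. of_bool (P t)) < e / 2 / (B + 1)"
    using N_indicator_small[of "e / 2 / (B + 1)"] assms by auto
  show ?thesis
  proof (rule that[of "\<eta> * (e / 2)\<^sup>2"])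
    show "0 < \<eta> * (e / 2)\<^sup>2" using \<eta> assms by simp
    fix u assume u: "meas01 u" and b: "\<And>t. t \<in> {0..1} \<Longrightarrow> \<bar>u t\<bar> \<le> B"
      and i: "integral\<^sup>L L01 (\<lambda>t. (u t)\<^sup>2) \<le> \<eta> * (e / 2)\<^sup>2"
    let ?E = "\<lambda>t. of_bool (e / 2 < \<bar>u t\<bar>) :: real"
    have S: "{t\<in>{0..1}. e / 2 < \<bar>u t\<bar>} \<in> sets L01" by (rule distr_set[OF u])
    have um: "u \<in> borel_measurable L01" using u by (simp add: meas01_def)
    have "integrable L01 (\<lambda>t. (u t)\<^sup>2)"
    proof (rule integrable_L01_bounded[of _ "B\<^sup>2"])
      show "meas01 (\<lambda>t. (u t)\<^sup>2)" using um by (simp add: meas01_def)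
      show "\<bar>(u t)\<^sup>2\<bar> \<le> B\<^sup>2" if "t \<in> {0..1}" for t
        using power_mono[OF b[OF that], of 2] by simp
    qed
    then have "integral\<^sup>L L01 (\<lambda>t. (e/2)\<^sup>2 * ?E t) \<le> integral\<^sup>L L01 (\<lambda>t. (u t)\<^sup>2)"
    proof (rule integral_mono[rotated])
      show "integrable L01 (\<lambda>t. (e/2)\<^sup>2 * ?E t)"
        by (rule integrable_mult_right) (rule integrable_L01_bounded[of _ 1], rule meas01_distr_pred[OF u], simp)
      show "(e/2)\<^sup>2 * ?E t \<le> (u t)\<^sup>2" if "t \<in> space L01" for t
      proof (cases "e / 2 < \<bar>u t\<bar>")
        case True
        then show ?thesis using power_mono[of "e/2" "\<bar>u t\<bar>" 2] assms by simp
      qed simp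
    qed
    also have "integral\<^sup>L L01 (\<lambda>t. (e/2)\<^sup>2 * ?E t) = (e/2)\<^sup>2 * distr u (e / 2)"
      unfolding distr_integral[OF u] by simp
    finally have "(e/2)\<^sup>2 * distr u (e / 2) \<le> (e/2)\<^sup>2 * \<eta>" using i by (simp add: mult.commute)
    then have "distr u (e / 2) \<le> \<eta>" using assms by simp
    then have "N ?E < e / 2 / (B + 1)" using \<eta>(3)[OF S] by (simp add: distr_def)
    moreover have EX: "?E \<in> X" by (rule of_bool_X[OF S])
    ultimately have BE: "B * N ?E < e / 2"
      using N_nonneg[OF EX] assms by (cases "N ?E = 0") (auto simp: field_simps)
    have c: "(\<lambda>t. e / 2 :: real) \<in> X" "N (\<lambda>t. e / 2) = e / 2"
      using cmult_X[OF one_in, of "e / 2"] N_cmult[OF one_in, of "e / 2"] N_one assms by auto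
    have "N u \<le> N (\<lambda>t. e / 2 + B * ?E t)"
    proof (rule ideal_X(2)[OF add_X[OF c(1) cmult_X[OF EX]] u], rule AE_I2)
      fix t assume "t \<in> space L01"
      then show "\<bar>u t\<bar> \<le> \<bar>e / 2 + B * ?E t\<bar>" using b[of t] assms by auto
    qed
    also have "\<dots> \<le> e / 2 + B * N ?E"
      using N_add[OF c(1) cmult_X[OF EX, of B]] N_cmult[OF EX, of B] c(2) assms by simp
    finally show "N u < e" using BE by simp
  qed
qed

end

section \<open>Dyadic step functions in a separable symmetric space\<close>

text \<open>The left endpoint of the dyadic interval coded by the word, used as sampling
  point.\<close>

primrec dyadic_point :: "bool list \<Rightarrow> real" where
  "dyadic_point [] = 0"
| "dyadic_point (a # \<alpha>) = (of_bool a + dyadic_point \<alpha>) / 2"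

lemma dyadic_point_in01: "dyadic_point \<alpha> \<in> {0..1}"
  by (induction \<alpha>) auto

lemma dist_dyadic_point_dig: "t \<in> {0..1} \<Longrightarrow> \<bar>t - dyadic_point (dig k t)\<bar> \<le> (1 / 2) ^ k"
proof (induction k arbitrary: t)
  case (Suc k)
  have "t - dyadic_point (dig (Suc k) t) = (dbl t - dyadic_point (dig k (dbl t))) / 2"
    by (cases "1/2 < t") (auto simp: dbl_def field_simps)
  then have "\<bar>t - dyadic_point (dig (Suc k) t)\<bar> = \<bar>dbl t - dyadic_point (dig k (dbl t))\<bar> / 2"
    by (metis abs_divide abs_numeral)
  with Suc.IH[OF dbl_in01[OF Suc.prems]] show ?case by simp
qed auto

lemma step_approx_square_integral:
  assumes u: "meas01 u" and b: "\<And>t. t \<in> {0..1} \<Longrightarrow> \<bar>u t\<bar> \<le> B" and \<delta>: "0 < \<delta>"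
  obtains k \<xi> where "\<And>\<alpha>. \<bar>\<xi> \<alpha>\<bar> \<le> B" "integral\<^sup>L L01 (\<lambda>t. (u t - \<xi> (dig k t))\<^sup>2) \<le> \<delta>"
proof -
  have B: "0 \<le> B" using b[of 0] by auto
  have um: "u \<in> borel_measurable L01" using u by (simp add: meas01_def)
  have "u measurable_on {0..1}"
    using um by (simp add: measurable_on_iff_borel_measurable)
  then obtain Z g where Z: "negligible Z" and gc: "\<And>n. continuous_on UNIV (g n)"
    and g: "\<And>t. t \<notin> Z \<Longrightarrow> (\<lambda>n. g n t) \<longlonglongrightarrow> (if t \<in> {0..1} then u t else 0)"
    unfolding measurable_on_def by blast
  \<comment> \<open>Clipping to [-B, B] provides the dominating constant and passes the bound B on
    to the coefficients.\<close>
  define c where "c n t = max (- B) (min B (g n t))" for n and t :: real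
  have cc: "continuous_on UNIV (c n)" for n
    unfolding c_def using gc by (intro continuous_intros)
  have cb: "\<bar>c n t\<bar> \<le> B" for n t using B by (auto simp: c_def)
  have cm: "c n \<in> borel_measurable L01" for n
    by (rule measurable_restrict_space1, rule measurable_completion)
       (use borel_measurable_continuous_onI[OF cc] in simp)
  have ZAE: "AE t in L01. t \<notin> Z"
    using AE_not_in[of Z lebesgue] Z by (subst AE_restrict_space_iff) (auto simp: negligible_iff_null_sets)
  have lim: "(\<lambda>n. integral\<^sup>L L01 (\<lambda>t. (u t - c n t)\<^sup>2)) \<longlonglongrightarrow> integral\<^sup>L L01 (\<lambda>t. 0)"
  proof (rule integral_dominated_convergence[where w = "\<lambda>t. (2 * B)\<^sup>2"])
    show "AE t in L01. (\<lambda>n. (u t - c n t)\<^sup>2) \<longlonglongrightarrow> 0"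
      using ZAE AE_off_rationals
    proof eventually_elim
      case (elim t)
      then have "(\<lambda>n. g n t) \<longlonglongrightarrow> u t" using g[of t] by auto
      then have "(\<lambda>n. c n t) \<longlonglongrightarrow> max (- B) (min B (u t))"
        unfolding c_def by (intro tendsto_intros)
      moreover have "max (- B) (min B (u t)) = u t" using b[of t] elim by auto
      ultimately have "(\<lambda>n. (u t - c n t)\<^sup>2) \<longlonglongrightarrow> (u t - u t)\<^sup>2"
        by (intro tendsto_intros) simp
      then show ?case by simp
    qed
    show "AE t in L01. norm ((u t - c n t)\<^sup>2) \<le> (2 * B)\<^sup>2" for n
    proof (rule AE_I2)
      fix t assume "t \<in> space L01"
      then have "\<bar>u t - c n t\<bar> \<le> 2 * B" using b[of t] cb[of n t] by auto
      then show "norm ((u t - c n t)\<^sup>2) \<le> (2 * B)\<^sup>2"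
        using power_mono[of "\<bar>u t - c n t\<bar>" "2 * B" 2] by simp
    qed
  qed (use um cm in auto)
  then have "(\<lambda>n. integral\<^sup>L L01 (\<lambda>t. (u t - c n t)\<^sup>2)) \<longlonglongrightarrow> 0" by simp
  from order_tendstoD(2)[OF this, of "\<delta> / 4"] \<delta> obtain n where n: "integral\<^sup>L L01 (\<lambda>t. (u t - c n t)\<^sup>2) < \<delta> / 4"
    by (auto simp: eventually_sequentially)
  \<comment> \<open>In (p + q)^2 \<le> 2 p^2 + 2 q^2 each of the two squared errors may use
    \<delta>/4.\<close>
  define \<epsilon> where "\<epsilon> = sqrt \<delta> / 2"
  have \<epsilon>: "0 < \<epsilon>" "\<epsilon>\<^sup>2 = \<delta> / 4" using \<delta> by (auto simp: \<epsilon>_def power_divide)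
  have "uniformly_continuous_on {0..1} (c n)"
    using cc continuous_on_subset by (intro compact_uniformly_continuous) blast+
  then obtain d where d: "0 < d" "\<And>s t. s \<in> {0..1} \<Longrightarrow> t \<in> {0..1} \<Longrightarrow> dist s t < d \<Longrightarrow> dist (c n s) (c n t) < \<epsilon>"
    using \<epsilon>(1) unfolding uniformly_continuous_on_def by metis
  obtain k :: nat where k: "(1 / 2) ^ k < d"
    using real_arch_pow_inv[OF d(1), of "1/2"] by auto
  define \<xi> where "\<xi> \<alpha> = c n (dyadic_point \<alpha>)" for \<alpha>
  have \<xi>b: "\<bar>\<xi> \<alpha>\<bar> \<le> B" for \<alpha> by (simp add: \<xi>_def cb)
  have int1: "integrable L01 (\<lambda>t. (u t - c n t)\<^sup>2)"
  proof (rule integrable_L01_bounded[of _ "(2 * B)\<^sup>2"])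
    show "meas01 (\<lambda>t. (u t - c n t)\<^sup>2)" using um cm by (simp add: meas01_def)
    show "\<bar>(u t - c n t)\<^sup>2\<bar> \<le> (2 * B)\<^sup>2" if "t \<in> {0..1}" for t
      using power_mono[of "\<bar>u t - c n t\<bar>" "2 * B" 2] b[OF that] cb[of n t] by auto
  qed
  have int2: "integrable L01 (\<lambda>t. (u t - \<xi> (dig k t))\<^sup>2)"
  proof (rule integrable_L01_bounded[of _ "(2 * B)\<^sup>2"])
    show "meas01 (\<lambda>t. (u t - \<xi> (dig k t))\<^sup>2)" using um meas01_step[of \<xi> k] by (simp add: meas01_def)
    show "\<bar>(u t - \<xi> (dig k t))\<^sup>2\<bar> \<le> (2 * B)\<^sup>2" if "t \<in> {0..1}" for t
      using power_mono[of "\<bar>u t - \<xi> (dig k t)\<bar>" "2 * B" 2] b[OF that] \<xi>b[of "dig k t"] by auto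
  qed
  have int3: "integrable L01 (\<lambda>t. 2 * (u t - c n t)\<^sup>2 + 2 * \<epsilon>\<^sup>2)"
    using int1 by (intro Bochner_Integration.integrable_add integrable_mult_right) auto
  have "integral\<^sup>L L01 (\<lambda>t. (u t - \<xi> (dig k t))\<^sup>2) \<le> integral\<^sup>L L01 (\<lambda>t. 2 * (u t - c n t)\<^sup>2 + 2 * \<epsilon>\<^sup>2)"
  proof (rule integral_mono[OF int2 int3])
    fix t assume "t \<in> space L01"
    then have t: "t \<in> {0..1}" by simp
    have "dist (c n t) (c n (dyadic_point (dig k t))) < \<epsilon>"
      using dist_dyadic_point_dig[OF t, of k] k by (intro d(2) t dyadic_point_in01) (auto simp: dist_real_def)
    then have "\<bar>c n t - \<xi> (dig k t)\<bar> \<le> \<epsilon>" by (simp add: \<xi>_def dist_real_def)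
    then have "(c n t - \<xi> (dig k t))\<^sup>2 \<le> \<epsilon>\<^sup>2" using power_mono[of "\<bar>c n t - \<xi> (dig k t)\<bar>" \<epsilon> 2] by simp
    moreover have "(u t - \<xi> (dig k t))\<^sup>2 \<le> 2 * (u t - c n t)\<^sup>2 + 2 * (c n t - \<xi> (dig k t))\<^sup>2"
      using zero_le_power2[of "(u t - c n t) - (c n t - \<xi> (dig k t))"]
      by (simp add: power2_eq_square algebra_simps)
    ultimately show "(u t - \<xi> (dig k t))\<^sup>2 \<le> 2 * (u t - c n t)\<^sup>2 + 2 * \<epsilon>\<^sup>2" by linarith
  qed
  also have "\<dots> = 2 * integral\<^sup>L L01 (\<lambda>t. (u t - c n t)\<^sup>2) + 2 * \<epsilon>\<^sup>2"
    using int1 measure_L01 by simp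
  also have "\<dots> \<le> \<delta>" using n \<epsilon>(2) by simp
  finally show ?thesis using that[of \<xi> k] \<xi>b by blast
qed

text \<open>The representative of \<open>block\<close> given by \<open>block_AE\<close>. Its
  algebraic identities hold at every point, which confines a.e. arguments to the passage between the
  two.\<close>

definition dblock :: "(bool list \<Rightarrow> real) \<Rightarrow> (real \<Rightarrow> real) \<Rightarrow> nat \<Rightarrow> real \<Rightarrow> real" where
  "dblock \<xi> f k t = \<xi> (dig k t) * f ((dbl ^^ k) t)"

text \<open>Conditional expectation onto the next coarser dyadic level, written on coefficients; its
  powers average over all extensions of a word.\<close>

definition avg :: "(bool list \<Rightarrow> real) \<Rightarrow> bool list \<Rightarrow> real" where
  "avg \<eta> \<beta> = (\<eta> (\<beta> @ [False]) + \<eta> (\<beta> @ [True])) / 2"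

lemma avg_pow: "(avg ^^ m) \<eta> \<alpha> = (\<Sum>\<gamma>\<in>words m. \<eta> (\<alpha> @ \<gamma>)) / 2 ^ m"
proof (induction m arbitrary: \<alpha>)
  case 0
  have "words 0 = {[]}" by auto
  then show ?case by simp
next
  case (Suc m)
  have "(avg ^^ Suc m) \<eta> \<alpha> = ((avg ^^ m) \<eta> (\<alpha> @ [False]) + (avg ^^ m) \<eta> (\<alpha> @ [True])) / 2"
    by (simp add: avg_def)
  then show ?case
    unfolding Suc.IH sum_words_Suc by (simp add: add_divide_distrib mult.commute)
qed

lemma distr_dblock:
  assumes "meas01 f"
  shows "distr (dblock \<xi> f k) s = (\<Sum>\<alpha>\<in>words k. distr (\<lambda>t. \<xi> \<alpha> * f t) s) / 2 ^ k"
  using distr_dig[of k "\<lambda>\<alpha> t. \<xi> \<alpha> * f t" s] assms by (simp add: meas01_def dblock_def[abs_def])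

lemma meas01_dblock: "meas01 f \<Longrightarrow> meas01 (dblock \<xi> f k)"
  using meas01_dig[of k "\<lambda>\<alpha> t. \<xi> \<alpha> * f t"] by (simp add: meas01_def dblock_def[abs_def])

lemma step_bound:
  fixes \<xi> :: "bool list \<Rightarrow> real"
  shows "\<bar>\<xi> (dig k t)\<bar> \<le> (\<Sum>\<alpha>\<in>words k. \<bar>\<xi> \<alpha>\<bar>)"
  by (rule member_le_sum[of "dig k t" "words k" "\<lambda>\<alpha>. \<bar>\<xi> \<alpha>\<bar>"]) auto

lemma meas01_dbl: "meas01 f \<Longrightarrow> meas01 (\<lambda>t. f ((dbl ^^ k) t))"
  using meas01_dig[of k "\<lambda>\<alpha>. f"] by simp

lemma distr_dbl: "meas01 f \<Longrightarrow> distr (\<lambda>t. f ((dbl ^^ k) t)) s = distr f s"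
  using distr_dig[of k "\<lambda>\<alpha>. f" s] by (simp add: card_words)

lemma integral_dbl:
  fixes f :: "real \<Rightarrow> real"
  shows "integrable L01 f \<Longrightarrow> integral\<^sup>L L01 (\<lambda>t. f ((dbl ^^ k) t)) = integral\<^sup>L L01 f"
  using integral_dig(2)[of k "\<lambda>\<alpha>. f"] by (simp add: card_words)

lemma integrable_dbl:
  fixes f :: "real \<Rightarrow> real"
  shows "integrable L01 f \<Longrightarrow> integrable L01 (\<lambda>t. f ((dbl ^^ k) t))"
  using integral_dig(1)[of k "\<lambda>\<alpha>. f"] by simp

lemma integrable_step: "integrable L01 (\<lambda>t. \<xi> (dig k t) :: real)"
  by (rule integrable_L01_bounded[OF meas01_step step_bound])

lemma integral_step:
  fixes \<xi> :: "bool list \<Rightarrow> real"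
  shows "integral\<^sup>L L01 (\<lambda>t. \<xi> (dig k t)) = (\<Sum>\<alpha>\<in>words k. \<xi> \<alpha>) / 2 ^ k"
  using integral_dig(2)[of k "\<lambda>\<alpha> t. \<xi> \<alpha>"] measure_L01 by simp

lemma dbl_pow_add: "(dbl ^^ (m + n)) t = (dbl ^^ n) ((dbl ^^ m) t)"
  by (metis add.commute comp_apply funpow_add)

section \<open>Averaging of coefficients and density of step functions\<close>

context sep_sym_space
begin

lemma dbl_X:
  assumes "f \<in> X"
  shows "(\<lambda>t. f ((dbl ^^ k) t)) \<in> X" "N (\<lambda>t. f ((dbl ^^ k) t)) = N f"
  using equimeasurable_X[OF assms meas01_dbl[OF meas01_X[OF assms], of k]] distr_dbl[OF meas01_X[OF assms], of k]
  by (auto simp: equimeasurable_def)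

lemma dblock_X: "f \<in> X \<Longrightarrow> dblock \<xi> f k \<in> X"
proof -
  assume f: "f \<in> X"
  let ?B = "\<Sum>\<alpha>\<in>words k. \<bar>\<xi> \<alpha>\<bar>"
  have "\<bar>dblock \<xi> f k t\<bar> \<le> \<bar>?B * f ((dbl ^^ k) t)\<bar>" for t
    using step_bound[of \<xi> k t] by (simp add: dblock_def abs_mult mult_right_mono sum_nonneg)
  then show ?thesis
    by (intro ideal_X(1)[OF cmult_X[OF dbl_X(1)[OF f]] meas01_dblock[OF meas01_X[OF f]]] AE_I2)
qed

lemma N_dblock_cong:
  assumes "f \<in> X" "\<And>s. (\<Sum>\<alpha>\<in>words k. distr (\<lambda>t. \<xi> \<alpha> * f t) s) / 2 ^ k = (\<Sum>\<alpha>\<in>words j. distr (\<lambda>t. \<eta> \<alpha> * f t) s) / 2 ^ j"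
  shows "N (dblock \<xi> f k) = N (dblock \<eta> f j)"
  using equimeasurable_X(2)[OF dblock_X[OF assms(1)] meas01_dblock[OF meas01_X[OF assms(1)]], of \<xi> k \<eta> j]
    assms(2) distr_dblock[OF meas01_X[OF assms(1)]] by (auto simp: equimeasurable_def)

text \<open>Repeating each averaged coefficient on both halves of its interval gives an
  equimeasurable block of level \<open>Suc k\<close>. That block is the midpoint of the original one
  and the one with last digits flipped, and these have equal norms because flipping permutes the
  words.\<close>

lemma N_dblock_avg:
  assumes f: "f \<in> X"
  shows "N (dblock (avg \<eta>) f k) \<le> N (dblock \<eta> f (Suc k))"
proof -
  define flip where "flip \<beta> = butlast \<beta> @ [\<not> last \<beta>]" for \<beta> :: "bool list"
  have "N (dblock (avg \<eta>) f k) = N (dblock (\<lambda>\<beta>. avg \<eta> (butlast \<beta>)) f (Suc k))"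
    by (rule N_dblock_cong[OF f]) (simp add: sum_words_snoc flip: sum_distrib_left mult_2)
  also have "dblock (\<lambda>\<beta>. avg \<eta> (butlast \<beta>)) f (Suc k) =
      (\<lambda>t. (1/2) * dblock \<eta> f (Suc k) t + (1/2) * dblock (\<lambda>\<beta>. \<eta> (flip \<beta>)) f (Suc k) t)"
  proof
    fix t
    obtain \<beta> b where "dig (Suc k) t = \<beta> @ [b]"
      by (metis length_dig length_Suc_conv_rev)
    then show "dblock (\<lambda>\<beta>. avg \<eta> (butlast \<beta>)) f (Suc k) t =
        (1/2) * dblock \<eta> f (Suc k) t + (1/2) * dblock (\<lambda>\<beta>. \<eta> (flip \<beta>)) f (Suc k) t"
      unfolding dblock_def by (cases b) (auto simp: avg_def flip_def algebra_simps)
  qed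
  also have "N \<dots> \<le> N (\<lambda>t. (1/2) * dblock \<eta> f (Suc k) t) + N (\<lambda>t. (1/2) * dblock (\<lambda>\<beta>. \<eta> (flip \<beta>)) f (Suc k) t)"
    by (intro N_add cmult_X dblock_X f)
  also have "\<dots> = (1/2) * N (dblock \<eta> f (Suc k)) + (1/2) * N (dblock (\<lambda>\<beta>. \<eta> (flip \<beta>)) f (Suc k))"
    by (simp add: N_cmult dblock_X f del: times_divide_eq_left)
  also have "N (dblock (\<lambda>\<beta>. \<eta> (flip \<beta>)) f (Suc k)) = N (dblock \<eta> f (Suc k))"
    by (rule N_dblock_cong[OF f]) (simp add: sum_words_snoc flip_def add.commute)
  finally show ?thesis by simp
qed

lemma N_dblock_avg_pow:
  assumes f: "f \<in> X"
  shows "N (dblock ((avg ^^ m) \<eta>) f k) \<le> N (dblock \<eta> f (k + m))"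
proof (induction m arbitrary: k)
  case (Suc m)
  have "N (dblock ((avg ^^ Suc m) \<eta>) f k) \<le> N (dblock ((avg ^^ m) \<eta>) f (Suc k))"
    using N_dblock_avg[OF f, of "(avg ^^ m) \<eta>"] by simp
  also have "\<dots> \<le> N (dblock \<eta> f (k + Suc m))" using Suc.IH[of "Suc k"] by simp
  finally show ?case .
qed simp

lemma step_X: "(\<lambda>t. \<xi> (dig k t)) \<in> X"
  by (rule bounded_X(1)[OF meas01_step step_bound])

text \<open>For the constant function 1 in place of \<open>f\<close> a block is its own step
  function. Averaging down to level 0 leaves the mean as a constant, and 1 has norm 1.\<close>

lemma integral_step_le_N: "\<bar>integral\<^sup>L L01 (\<lambda>t. \<xi> (dig k t))\<bar> \<le> N (\<lambda>t. \<xi> (dig k t))"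
proof -
  have "\<bar>integral\<^sup>L L01 (\<lambda>t. \<xi> (dig k t))\<bar> = \<bar>(avg ^^ k) \<xi> []\<bar>"
    unfolding integral_step avg_pow by simp
  also have "\<dots> = N (dblock ((avg ^^ k) \<xi>) (\<lambda>t. 1) 0)"
    using N_cmult[OF one_in, of "(avg ^^ k) \<xi> []"] N_one by (simp add: dblock_def[abs_def])
  also have "\<dots> \<le> N (dblock \<xi> (\<lambda>t. 1) k)"
    using N_dblock_avg_pow[OF one_in, of k \<xi> 0] by simp
  finally show ?thesis by (simp add: dblock_def[abs_def])
qed

text \<open>The integral is controlled along with the norm because the inequality between the two,
  \<open>integral_le_N\<close>, is itself obtained from this approximation.\<close>

lemma bounded_step_approx:
  assumes u: "meas01 u" and b: "\<And>t. t \<in> {0..1} \<Longrightarrow> \<bar>u t\<bar> \<le> B" and e: "0 < e"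
  obtains k \<xi> where "N (\<lambda>t. u t - \<xi> (dig k t)) < e" "\<bar>integral\<^sup>L L01 (\<lambda>t. u t - \<xi> (dig k t))\<bar> < e"
proof -
  have B: "0 \<le> B" using b[of 0] by auto
  obtain \<delta> where \<delta>: "0 < \<delta>"
    "\<And>u. meas01 u \<Longrightarrow> (\<And>t. t \<in> {0..1} \<Longrightarrow> \<bar>u t\<bar> \<le> 2 * B) \<Longrightarrow> integral\<^sup>L L01 (\<lambda>t. (u t)\<^sup>2) \<le> \<delta> \<Longrightarrow> N u < e"
    using N_small_of_square_integral[OF e, of "2 * B"] B by auto
  obtain k \<xi> where \<xi>: "\<And>\<alpha>. \<bar>\<xi> \<alpha>\<bar> \<le> B" "integral\<^sup>L L01 (\<lambda>t. (u t - \<xi> (dig k t))\<^sup>2) \<le> min \<delta> (e\<^sup>2 / 2)"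
    by (rule step_approx_square_integral[OF u b, of "min \<delta> (e\<^sup>2 / 2)"]) (use \<delta>(1) e in auto)
  let ?v = "\<lambda>t. u t - \<xi> (dig k t)"
  have vm: "meas01 ?v" using u meas01_step[of \<xi> k] by (simp add: meas01_def)
  have vb: "\<bar>?v t\<bar> \<le> 2 * B" if "t \<in> {0..1}" for t using b[OF that] \<xi>(1)[of "dig k t"] by auto
  have Nv: "N ?v < e" by (rule \<delta>(2)[OF vm vb]) (use \<xi>(2) in auto)
  have vi: "integrable L01 ?v" by (rule integrable_L01_bounded[OF vm vb])
  have v2i: "integrable L01 (\<lambda>t. (?v t)\<^sup>2)"
  proof (rule integrable_L01_bounded[of _ "(2 * B)\<^sup>2"])
    show "meas01 (\<lambda>t. (?v t)\<^sup>2)" using vm by (simp add: meas01_def)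
    show "\<bar>(?v t)\<^sup>2\<bar> \<le> (2 * B)\<^sup>2" if "t \<in> {0..1}" for t
      using power_mono[OF vb[OF that], of 2] by simp
  qed
  have "\<bar>integral\<^sup>L L01 ?v\<bar> \<le> integral\<^sup>L L01 (\<lambda>t. \<bar>?v t\<bar>)"
    by (rule integral_abs_bound)
  \<comment> \<open>From 2 e |v| \<le> e^2 + v^2; as the integral of v^2 is at most e^2/2, the total
    is at most e/2 + e/4.\<close>
  also have "\<dots> \<le> integral\<^sup>L L01 (\<lambda>t. e / 2 + (1 / (2 * e)) * (?v t)\<^sup>2)"
  proof (rule integral_mono)
    show "integrable L01 (\<lambda>t. e / 2 + (1 / (2 * e)) * (?v t)\<^sup>2)"
      using v2i by (intro Bochner_Integration.integrable_add integrable_mult_right) auto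
    show "\<bar>?v t\<bar> \<le> e / 2 + (1 / (2 * e)) * (?v t)\<^sup>2" for t
    proof -
      have "0 \<le> (\<bar>?v t\<bar> - e)\<^sup>2" by simp
      then have "2 * e * \<bar>?v t\<bar> \<le> e\<^sup>2 + (?v t)\<^sup>2" by (simp add: power2_diff mult.commute)
      then show ?thesis using e by (simp add: field_simps power2_eq_square)
    qed
  qed (use vi in simp)
  also have "\<dots> = e / 2 + (1 / (2 * e)) * integral\<^sup>L L01 (\<lambda>t. (?v t)\<^sup>2)"
    using v2i measure_L01 by (subst Bochner_Integration.integral_add) auto
  also have "\<dots> \<le> e / 2 + (1 / (2 * e)) * (e\<^sup>2 / 2)"
    using \<xi>(2) e by (intro add_left_mono mult_left_mono) auto
  also have "\<dots> < e" using e by (simp add: power2_eq_square field_simps)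
  finally show ?thesis using that Nv by blast
qed

lemma truncation_X:
  assumes x: "x \<in> X"
  shows "(\<lambda>t. if real n < \<bar>x t\<bar> then 0 else x t) \<in> X" "N (\<lambda>t. if real n < \<bar>x t\<bar> then 0 else x t) \<le> N x"
proof -
  have "meas01 (\<lambda>t. if real n < \<bar>x t\<bar> then 0 else x t)"
    using meas01_X[OF x] unfolding meas01_def by measurable
  from ideal_X[OF x this] show "(\<lambda>t. if real n < \<bar>x t\<bar> then 0 else x t) \<in> X" "N (\<lambda>t. if real n < \<bar>x t\<bar> then 0 else x t) \<le> N x"
    by auto
qed

lemma step_dense:
  assumes x: "x \<in> X" and e: "0 < e"
  obtains k \<xi> where "N (\<lambda>t. x t - \<xi> (dig k t)) < e"
proof -
  obtain n :: nat where n: "(\<lambda>t. if real n < \<bar>x t\<bar> then x t else 0) \<in> X"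
    "N (\<lambda>t. if real n < \<bar>x t\<bar> then x t else 0) < e / 2"
    using N_large_part_small[OF x, of "e / 2"] e by auto
  let ?u = "\<lambda>t. if real n < \<bar>x t\<bar> then 0 else x t"
  have u: "?u \<in> X" by (rule truncation_X[OF x])
  obtain k \<xi> where \<xi>: "N (\<lambda>t. ?u t - \<xi> (dig k t)) < e / 2"
    by (rule bounded_step_approx[OF meas01_X[OF u], of "real n" "e / 2"]) (use e in auto)
  have "N (\<lambda>t. x t - \<xi> (dig k t)) = N (\<lambda>t. (if real n < \<bar>x t\<bar> then x t else 0) + (?u t - \<xi> (dig k t)))"
    by (rule arg_cong[where f = N]) auto
  also have "\<dots> \<le> N (\<lambda>t. if real n < \<bar>x t\<bar> then x t else 0) + N (\<lambda>t. ?u t - \<xi> (dig k t))"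
    by (intro N_add n diff_X u step_X)
  finally show ?thesis using that[of \<xi> k] n(2) \<xi> by linarith
qed

text \<open>The inequality passes from step functions to bounded functions by approximation, and
  from these to u by truncation: |u| is the dominating function, and truncating does not increase
  the norm.\<close>

lemma integral_le_N:
  assumes u: "u \<in> X" and i: "integrable L01 u"
  shows "\<bar>integral\<^sup>L L01 u\<bar> \<le> N u"
proof -
  have bounded: "\<bar>integral\<^sup>L L01 v\<bar> \<le> N v" if v: "meas01 v" and b: "\<And>t. t \<in> {0..1} \<Longrightarrow> \<bar>v t\<bar> \<le> B" for v B
  proof (rule field_le_epsilon)
    fix e :: real assume e: "0 < e"
    obtain k \<xi> where \<xi>: "N (\<lambda>t. v t - \<xi> (dig k t)) < e / 2" "\<bar>integral\<^sup>L L01 (\<lambda>t. v t - \<xi> (dig k t))\<bar> < e / 2"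
      by (rule bounded_step_approx[OF v b, of "e / 2"]) (use e in auto)
    have vX: "v \<in> X" by (rule bounded_X(1)[OF v b])
    have "integral\<^sup>L L01 (\<lambda>t. v t - \<xi> (dig k t)) = integral\<^sup>L L01 v - integral\<^sup>L L01 (\<lambda>t. \<xi> (dig k t))"
      by (rule Bochner_Integration.integral_diff[OF integrable_L01_bounded[OF v b] integrable_step])
    moreover have "N (\<lambda>t. \<xi> (dig k t)) \<le> N (\<lambda>t. v t - \<xi> (dig k t)) + N v"
      using N_le_diff[OF step_X[of \<xi> k] vX] N_diff_commute[OF vX step_X[of \<xi> k]] by simp
    ultimately show "\<bar>integral\<^sup>L L01 v\<bar> \<le> N v + e"
      using \<xi> integral_step_le_N[of \<xi> k] by linarith
  qed
  let ?u = "\<lambda>n t. if real n < \<bar>u t\<bar> then 0 else u t"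
  have um: "u \<in> borel_measurable L01" using meas01_X[OF u] by (simp add: meas01_def)
  have lim: "(\<lambda>n. integral\<^sup>L L01 (?u n)) \<longlonglongrightarrow> integral\<^sup>L L01 u"
  proof (rule integral_dominated_convergence[where w = "\<lambda>t. \<bar>u t\<bar>"])
    show "AE t in L01. (\<lambda>n. ?u n t) \<longlonglongrightarrow> u t"
    proof (rule AE_I2)
      fix t
      obtain m :: nat where "\<bar>u t\<bar> < real m" using reals_Archimedean2 by blast
      then have "\<forall>n\<ge>m. ?u n t = u t" by auto
      then show "(\<lambda>n. ?u n t) \<longlonglongrightarrow> u t"
        by (intro tendsto_eventually) (simp only: eventually_sequentially, blast)
    qed
    show "?u n \<in> borel_measurable L01" for n using um by measurable
  qed (use um i in auto)
  have "\<bar>integral\<^sup>L L01 (?u n)\<bar> \<le> N u" for n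
  proof -
    have "\<bar>integral\<^sup>L L01 (?u n)\<bar> \<le> N (?u n)"
      by (rule bounded[OF meas01_X[OF truncation_X(1)[OF u, of n]], of "real n"]) auto
    then show ?thesis using truncation_X(2)[OF u, of n] by linarith
  qed
  then show ?thesis
    by (intro LIMSEQ_le_const2[OF tendsto_rabs[OF lim]]) auto
qed

text \<open>A law of large numbers: for a dyadic step function of mean zero, the compositions with
  sufficiently spread powers of the doubling map are orthogonal, and their averages are uniformly
  bounded, so convergence to zero in \<open>L\<^sub>2\<close> yields convergence in the norm of \<open>X\<close>.\<close>

lemma mean_zero_averages:
  assumes g: "g \<in> X" and gi: "integrable L01 g" and g0: "integral\<^sup>L L01 g = 0" and e: "0 < e"
  obtains R where "finite R" "R \<noteq> {}" "\<And>r. r \<in> R \<Longrightarrow> r0 \<le> r"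
    "N (\<lambda>t. (\<Sum>r\<in>R. g ((dbl ^^ r) t)) / card R) < e"
proof -
  obtain p \<eta> where \<eta>: "N (\<lambda>t. g t - \<eta> (dig p t)) < e / 4"
    by (rule step_dense[OF g, of "e / 4"]) (use e in auto)
  \<comment> \<open>The approximating step function need not have mean zero; its mean is below e/4
    in absolute value, so subtracting it costs only that much.\<close>
  define c where "c = integral\<^sup>L L01 (\<lambda>t. \<eta> (dig p t))"
  have "\<bar>integral\<^sup>L L01 (\<lambda>t. g t - \<eta> (dig p t))\<bar> \<le> N (\<lambda>t. g t - \<eta> (dig p t))"
    using gi by (intro integral_le_N diff_X g step_X Bochner_Integration.integrable_diff integrable_step)
  moreover have "integral\<^sup>L L01 (\<lambda>t. g t - \<eta> (dig p t)) = - c"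
    unfolding c_def using gi g0 by (subst Bochner_Integration.integral_diff) (auto intro: integrable_step)
  ultimately have c: "\<bar>c\<bar> < e / 4" using \<eta> by simp
  define h where "h \<alpha> = \<eta> \<alpha> - c" for \<alpha>
  define H where "H t = h (dig p t)" for t
  define B where "B = (\<Sum>\<alpha>\<in>words p. \<bar>h \<alpha>\<bar>)"
  have Hb: "\<bar>H t\<bar> \<le> B" for t unfolding H_def B_def by (rule step_bound)
  have B: "0 \<le> B" by (simp add: B_def sum_nonneg)
  have Hm: "meas01 H" unfolding H_def by (rule meas01_step)
  have HX: "H \<in> X" unfolding H_def by (rule step_X)
  have gH: "N (\<lambda>t. g t - H t) < e / 2"
  proof -
    have "N (\<lambda>t. g t - H t) = N (\<lambda>t. (g t - \<eta> (dig p t)) + c * 1)"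
      by (simp add: H_def h_def algebra_simps)
    also have "\<dots> \<le> N (\<lambda>t. g t - \<eta> (dig p t)) + N (\<lambda>t. c * 1)"
      by (intro N_add diff_X g step_X cmult_X one_in)
    also have "N (\<lambda>t. c * 1) = \<bar>c\<bar>" using N_cmult[OF one_in, of c] N_one by simp
    finally show ?thesis using \<eta> c by simp
  qed
  have H0: "integral\<^sup>L L01 H = 0"
    unfolding H_def h_def using measure_L01
    by (subst Bochner_Integration.integral_diff) (auto intro: integrable_step simp: c_def)
  then have h0: "(\<Sum>\<alpha>\<in>words p. h \<alpha>) = 0"
    unfolding H_def integral_step by simp
  \<comment> \<open>\<open>H\<close> depends on the first p digits only, so shifts by more than p
    digits separate the copies. \<open>Suc p\<close> is positive even for p = 0, which keeps the
    exponents in \<open>R\<close> distinct.\<close>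
  define q where "q = Suc p"
  define S where "S n t = (\<Sum>j<n. H ((dbl ^^ (q * j)) t))" for n t
  \<comment> \<open>The first summand is split off, not the last: what remains is a function of
    \<open>(dbl ^^ q) t\<close>, hence orthogonal to \<open>H\<close>.\<close>
  have S_Suc: "S (Suc n) t = H t + S n ((dbl ^^ q) t)" for n t
    unfolding S_def by (subst sum.lessThan_Suc_shift) (simp add: dbl_pow_add)
  have Sm: "meas01 (S n)" for n
    unfolding S_def[abs_def] using meas01_dbl[OF Hm] by (auto simp: meas01_def intro!: borel_measurable_sum)
  have Sb: "\<bar>S n t\<bar> \<le> real n * B" for n t
  proof -
    have "\<bar>S n t\<bar> \<le> (\<Sum>j<n. \<bar>H ((dbl ^^ (q * j)) t)\<bar>)" unfolding S_def by (rule sum_abs)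
    also have "\<dots> \<le> (\<Sum>j<n. B)" by (rule sum_mono) (rule Hb)
    finally show ?thesis by simp
  qed
  have sq_int: "integrable L01 (\<lambda>t. (w t)\<^sup>2)" if "meas01 w" "\<And>t. \<bar>w t\<bar> \<le> C" for w C
  proof (rule integrable_L01_bounded[of _ "C\<^sup>2"])
    show "meas01 (\<lambda>t. (w t)\<^sup>2)" using that(1) by (simp add: meas01_def)
    show "\<bar>(w t)\<^sup>2\<bar> \<le> C\<^sup>2" for t using power_mono[OF that(2)[of t], of 2] by simp
  qed
  have orth: "integral\<^sup>L L01 (\<lambda>t. H t * w ((dbl ^^ q) t)) = 0" "integrable L01 (\<lambda>t. H t * w ((dbl ^^ q) t))"
    if "integrable L01 w" for w
  proof -
    have eq: "(dbl ^^ q) t = dbl ((dbl ^^ p) t)" for t by (simp add: q_def)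
    have wi: "integrable L01 (\<lambda>t. w (dbl t))" using integrable_dbl[OF that, of 1] by simp
    note I = integral_dig[of p "\<lambda>\<alpha> t. h \<alpha> * w (dbl t)", OF integrable_mult_right[OF wi]]
    show "integrable L01 (\<lambda>t. H t * w ((dbl ^^ q) t))"
      using I(1) by (simp add: H_def eq)
    have "integral\<^sup>L L01 (\<lambda>t. H t * w ((dbl ^^ q) t)) = (\<Sum>\<alpha>\<in>words p. h \<alpha> * integral\<^sup>L L01 (\<lambda>t. w (dbl t))) / 2 ^ p"
      using I(2) by (simp add: H_def eq)
    also have "\<dots> = 0" using h0 by (simp flip: sum_distrib_right)
    finally show "integral\<^sup>L L01 (\<lambda>t. H t * w ((dbl ^^ q) t)) = 0" .
  qed
  have S2: "integral\<^sup>L L01 (\<lambda>t. (S n t)\<^sup>2) = real n * integral\<^sup>L L01 (\<lambda>t. (H t)\<^sup>2)" for n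
  proof (induction n)
    case 0
    then show ?case by (simp add: S_def)
  next
    case (Suc n)
    have i1: "integrable L01 (\<lambda>t. (H t)\<^sup>2)" by (rule sq_int[OF Hm Hb])
    have i2: "integrable L01 (S n)" by (rule integrable_L01_bounded[OF Sm Sb])
    have i3: "integrable L01 (\<lambda>t. (S n t)\<^sup>2)" by (rule sq_int[OF Sm Sb])
    have i4: "integrable L01 (\<lambda>t. (S n ((dbl ^^ q) t))\<^sup>2)" by (rule integrable_dbl[OF i3])
    have "integral\<^sup>L L01 (\<lambda>t. (S (Suc n) t)\<^sup>2) =
        integral\<^sup>L L01 (\<lambda>t. (H t)\<^sup>2 + 2 * (H t * S n ((dbl ^^ q) t)) + (S n ((dbl ^^ q) t))\<^sup>2)"
      unfolding S_Suc by (intro Bochner_Integration.integral_cong refl) (simp add: power2_eq_square algebra_simps)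
    also have "\<dots> = integral\<^sup>L L01 (\<lambda>t. (H t)\<^sup>2) + 2 * 0 + integral\<^sup>L L01 (\<lambda>t. (S n ((dbl ^^ q) t))\<^sup>2)"
      using i1 i4 orth[OF i2] by simp
    also have "integral\<^sup>L L01 (\<lambda>t. (S n ((dbl ^^ q) t))\<^sup>2) = integral\<^sup>L L01 (\<lambda>t. (S n t)\<^sup>2)"
      by (rule integral_dbl[OF i3])
    finally show ?case using Suc.IH by (simp add: algebra_simps)
  qed
  obtain \<delta> where \<delta>: "0 < \<delta>"
    "\<And>u. meas01 u \<Longrightarrow> (\<And>t. t \<in> {0..1} \<Longrightarrow> \<bar>u t\<bar> \<le> B) \<Longrightarrow> integral\<^sup>L L01 (\<lambda>t. (u t)\<^sup>2) \<le> \<delta> \<Longrightarrow> N u < e / 2"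
    using N_small_of_square_integral[of "e / 2" B] e B by auto
  obtain n0 :: nat where n0: "integral\<^sup>L L01 (\<lambda>t. (H t)\<^sup>2) / \<delta> < real n0"
    using reals_Archimedean2 by blast
  define n where "n = Suc n0"
  have n: "0 < n" "integral\<^sup>L L01 (\<lambda>t. (H t)\<^sup>2) \<le> real n * \<delta>"
    using n0 \<delta>(1) by (auto simp: n_def field_simps)
  define U where "U t = S n t / real n" for t
  have U: "U \<in> X" "N U < e / 2"
  proof -
    have Um: "meas01 U" using Sm[of n] by (simp add: U_def[abs_def] meas01_def)
    have Ub: "\<bar>U t\<bar> \<le> B" for t using Sb[of n t] n(1) by (simp add: U_def field_simps)
    show "U \<in> X" by (rule bounded_X(1)[OF Um Ub])
    have "integral\<^sup>L L01 (\<lambda>t. (U t)\<^sup>2) = integral\<^sup>L L01 (\<lambda>t. (S n t)\<^sup>2) / (real n)\<^sup>2"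
      by (simp add: U_def power_divide)
    also have "\<dots> = integral\<^sup>L L01 (\<lambda>t. (H t)\<^sup>2) / real n"
      unfolding S2 using n(1) by (simp add: power2_eq_square)
    also have "\<dots> \<le> \<delta>" using n by (simp add: field_simps)
    finally show "N U < e / 2" using \<delta>(2)[OF Um Ub] by blast
  qed
  define R where "R = (\<lambda>j. r0 + q * j) ` {..<n}"
  have inj: "inj_on (\<lambda>j. r0 + q * j) {..<n}"
    using q_def by (auto simp: inj_on_def simp del: mult_Suc)
  have R: "finite R" "R \<noteq> {}" "card R = n" "\<And>r. r \<in> R \<Longrightarrow> r0 \<le> r"
    using n(1) card_image[OF inj] by (auto simp: R_def)
  \<comment> \<open>Composition with powers of the doubling map preserves the norm. So the first
    term costs at most the norm of \<open>g - H\<close>, whatever the number of exponents, and the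
    start at r0 does not affect the second.\<close>
  have "(\<Sum>r\<in>R. g ((dbl ^^ r) t)) / card R =
      (1 / real n) * (\<Sum>r\<in>R. g ((dbl ^^ r) t) - H ((dbl ^^ r) t)) + U ((dbl ^^ r0) t)" for t
  proof -
    have "(\<Sum>r\<in>R. H ((dbl ^^ r) t)) = S n ((dbl ^^ r0) t)"
      unfolding R_def S_def by (subst sum.reindex[OF inj]) (simp add: dbl_pow_add)
    then show ?thesis using n(1) R(3) by (simp add: sum_subtractf U_def field_simps)
  qed
  then have "N (\<lambda>t. (\<Sum>r\<in>R. g ((dbl ^^ r) t)) / card R) =
      N (\<lambda>t. (1 / real n) * (\<Sum>r\<in>R. g ((dbl ^^ r) t) - H ((dbl ^^ r) t)) + U ((dbl ^^ r0) t))"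
    by simp
  also have "\<dots> \<le> N (\<lambda>t. (1 / real n) * (\<Sum>r\<in>R. g ((dbl ^^ r) t) - H ((dbl ^^ r) t))) + N (\<lambda>t. U ((dbl ^^ r0) t))"
    using R(1) by (intro N_add cmult_X sum_X dbl_X(1)[where f = "\<lambda>t. g t - H t"] diff_X g HX dbl_X(1) U)
  also have "N (\<lambda>t. U ((dbl ^^ r0) t)) = N U" by (rule dbl_X(2)[OF U(1)])
  also have "N (\<lambda>t. (1 / real n) * (\<Sum>r\<in>R. g ((dbl ^^ r) t) - H ((dbl ^^ r) t))) =
      (1 / real n) * N (\<lambda>t. \<Sum>r\<in>R. g ((dbl ^^ r) t) - H ((dbl ^^ r) t))"
    using N_cmult[OF sum_X(1)[OF R(1), where x = "\<lambda>r t. g ((dbl ^^ r) t) - H ((dbl ^^ r) t)", OF dbl_X(1)[OF diff_X[OF g HX]]], of "1 / real n"]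
    by simp
  also have "\<dots> \<le> (1 / real n) * (\<Sum>r\<in>R. N (\<lambda>t. g ((dbl ^^ r) t) - H ((dbl ^^ r) t)))"
    by (intro mult_left_mono sum_X(2)[OF R(1), where x = "\<lambda>r t. g ((dbl ^^ r) t) - H ((dbl ^^ r) t)"] dbl_X(1)[OF diff_X[OF g HX]]) auto
  also have "\<dots> = N (\<lambda>t. g t - H t)"
    using dbl_X(2)[OF diff_X[OF g HX]] R(3) n(1) by simp
  finally have "N (\<lambda>t. (\<Sum>r\<in>R. g ((dbl ^^ r) t)) / card R) < e"
    using gH U(2) by linarith
  with R show ?thesis using that by blast
qed

end

section \<open>Multiplicators yield representing systems\<close>

context sep_sym_space
begin

lemma block_X:
  assumes "f \<in> X"
  shows "block \<xi> f k \<in> X" "N (block \<xi> f k) = N (dblock \<xi> f k)"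
proof -
  have "AE t in L01. block \<xi> f k t = dblock \<xi> f k t"
    using block_AE[of \<xi> f k] by (simp add: dblock_def)
  from AE_eq_X[OF dblock_X[OF assms] this] show "block \<xi> f k \<in> X" "N (block \<xi> f k) = N (dblock \<xi> f k)"
    by auto
qed

lemma N_diff_sum_block:
  assumes "x \<in> X" "f \<in> X"
  shows "N (\<lambda>t. x t - (\<Sum>k=m..n. block \<xi> f k t)) = N (\<lambda>t. x t - (\<Sum>k=m..n. dblock \<xi> f k t))"
proof (rule AE_eq_X(2))
  show "(\<lambda>t. x t - (\<Sum>k=m..n. dblock \<xi> f k t)) \<in> X"
    using assms by (intro diff_X sum_X dblock_X) auto
  have "AE t in L01. \<forall>k\<in>{m..n}. block \<xi> f k t = dblock \<xi> f k t"
    using block_AE[of \<xi> f] by (intro AE_finite_allI) (auto simp: dblock_def)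
  then show "AE t in L01. x t - (\<Sum>k=m..n. block \<xi> f k t) = x t - (\<Sum>k=m..n. dblock \<xi> f k t)"
    by eventually_elim simp
qed

text \<open>The rearranged tensor product of \<open>f\<close> with a step function is equimeasurable
  with the block, so the multiplicator inequality can be read off. The absolute value is taken
  because \<open>multiplicator\<close> leaves the sign of its constant open.\<close>

lemma multiplicator_dblock_bound:
  assumes "f \<in> multiplicator X N"
  obtains C where "0 \<le> C" "\<And>k \<xi>. N (dblock \<xi> f k) \<le> C * N (\<lambda>t. \<xi> (dig k t))"
proof -
  obtain C where C: "\<And>y. y \<in> X \<Longrightarrow> in_X2 X (tensor f y) \<and> norm_X2 N (tensor f y) \<le> C * N y" and fm: "meas01 f"
    using assms unfolding multiplicator_def by blast
  have bound: "N (dblock \<xi> f k) \<le> \<bar>C\<bar> * N (\<lambda>t. \<xi> (dig k t))" for k \<xi>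
  proof -
    let ?y = "\<lambda>t. \<xi> (dig k t)"
    have d: "distribution_fun (distr (dblock \<xi> f k))"
      by (rule distribution_fun_distr[OF meas01_dblock[OF fm]])
    have "distr2 (tensor f ?y) = distr (dblock \<xi> f k)"
      using distr2_tensor_step[OF fm] by (auto simp: dblock_def[abs_def])
    then have r: "rearr (distr (dblock \<xi> f k)) \<in> X" "N (rearr (distr (dblock \<xi> f k))) \<le> C * N ?y"
      using C[OF step_X[of \<xi> k]] by (auto simp: in_X2_def norm_X2_def drearr2_eq_rearr)
    have "equimeasurable (dblock \<xi> f k) (rearr (distr (dblock \<xi> f k)))"
      by (rule equimeasurableI) (simp add: distr_rearr[OF d])
    from equimeasurable_X(2)[OF r(1) meas01_dblock[OF fm] this]
    have "N (dblock \<xi> f k) \<le> C * N ?y" using r(2) by simp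
    also have "\<dots> \<le> \<bar>C\<bar> * N ?y"
      by (rule mult_right_mono) (auto intro: N_nonneg step_X)
    finally show ?thesis .
  qed
  show ?thesis by (rule that[of "\<bar>C\<bar>"]) (use bound in auto)
qed

end

locale bounded_blocks = sep_sym_space +
  fixes f :: "real \<Rightarrow> real" and C a :: real
  assumes f_in: "f \<in> X" and C_nonneg: "0 \<le> C"
    and dblock_bound: "\<And>k \<xi>. N (dblock \<xi> f k) \<le> C * N (\<lambda>t. \<xi> (dig k t))"
    and f_integral: "integral\<^sup>L L01 f = a" and a_nonzero: "a \<noteq> 0"
begin

text \<open>A function that is not integrable has integral 0 by convention, so a nonzero integral
  forces integrability.\<close>

lemma f_integrable: "integrable L01 f"
  using f_integral a_nonzero not_integrable_integral_eq by blast

text \<open>One step function is spread over n levels with weight 1/(n a). The error is averaged out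
  over these levels, while the sum of the n block norms stays below C/|a| times the norm of the step
  function, independently of n.\<close>

lemma block_approximation:
  assumes x: "x \<in> X" and e: "0 < e"
  obtains k1 \<xi> where "k0 < k1" "N (\<lambda>t. x t - (\<Sum>k=k0..<k1. dblock \<xi> f k t)) \<le> e"
    "(\<Sum>k=k0..<k1. N (dblock \<xi> f k)) \<le> C / \<bar>a\<bar> * (N x + e)"
proof -
  obtain p \<eta> where \<eta>: "N (\<lambda>t. x t - \<eta> (dig p t)) < e / 2"
    by (rule step_dense[OF x, of "e / 2"]) (use e in auto)
  define y where "y t = \<eta> (dig p t)" for t
  have yX: "y \<in> X" unfolding y_def by (rule step_X)
  define B where "B = (\<Sum>\<alpha>\<in>words p. \<bar>\<eta> \<alpha>\<bar>)"
  have B: "0 \<le> B" by (simp add: B_def sum_nonneg)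
  have yb: "\<bar>y t\<bar> \<le> B" for t unfolding y_def B_def by (rule step_bound)
  define g where "g t = 1 - (1 / a) * f t" for t
  have gX: "g \<in> X" unfolding g_def by (intro diff_X one_in cmult_X f_in)
  have gi: "integrable L01 g"
    unfolding g_def using f_integrable by (intro Bochner_Integration.integrable_diff integrable_mult_right) auto
  have g0: "integral\<^sup>L L01 g = 0"
    unfolding g_def using f_integrable f_integral a_nonzero measure_L01
    by (subst Bochner_Integration.integral_diff) auto
  \<comment> \<open>From level p on, the coefficients of y can be read off from a prefix of the
    word. \<open>B + 1\<close> in place of \<open>B\<close> avoids a division by zero.\<close>
  obtain R where R: "finite R" "R \<noteq> {}" "\<And>r. r \<in> R \<Longrightarrow> max k0 p \<le> r"
    "N (\<lambda>t. (\<Sum>r\<in>R. g ((dbl ^^ r) t)) / card R) < e / 2 / (B + 1)"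
    using mean_zero_averages[OF gX gi g0, of "e / 2 / (B + 1)" "max k0 p"] e B by auto
  define n where "n = real (card R)"
  have n: "0 < n" using R(1,2) by (simp add: n_def card_gt_0_iff)
  define k1 where "k1 = Suc (Max R)"
  have Rsub: "R \<subseteq> {k0..<k1}"
    using R(1,3) by (auto simp: k1_def less_Suc_eq_le)
  have k1: "k0 < k1" using Rsub R(2) by auto
  define \<xi> where "\<xi> \<beta> = (if length \<beta> \<in> R then (1 / (n * a)) * \<eta> (take p \<beta>) else 0)" for \<beta>
  have \<xi>R: "\<xi> (dig k t) = (1 / (n * a)) * y t" if "k \<in> R" for k t
    using that R(3)[OF that] by (simp add: \<xi>_def y_def take_dig)
  have \<xi>nR: "dblock \<xi> f k = (\<lambda>t. 0)" if "k \<notin> R" for k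
    using that by (auto simp: dblock_def \<xi>_def)
  have sum_eq: "(\<Sum>k=k0..<k1. dblock \<xi> f k t) = y t * ((1 / (n * a)) * (\<Sum>r\<in>R. f ((dbl ^^ r) t)))" for t
  proof -
    have "(\<Sum>k=k0..<k1. dblock \<xi> f k t) = (\<Sum>k\<in>R. dblock \<xi> f k t)"
      using Rsub \<xi>nR by (intro sum.mono_neutral_right) auto
    also have "\<dots> = (\<Sum>k\<in>R. (1 / (n * a)) * y t * f ((dbl ^^ k) t))"
      by (rule sum.cong) (auto simp: dblock_def \<xi>R)
    finally show ?thesis by (simp add: sum_distrib_left mult_ac)
  qed
  let ?A = "\<lambda>t. (\<Sum>r\<in>R. g ((dbl ^^ r) t)) / card R"
  have A: "?A t = 1 - (1 / (n * a)) * (\<Sum>r\<in>R. f ((dbl ^^ r) t))" for t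
    using n a_nonzero by (simp add: g_def sum_subtractf n_def field_simps flip: sum_divide_distrib)
  have AX: "?A \<in> X"
  proof -
    have "(\<lambda>t. (1 / n) * (\<Sum>r\<in>R. g ((dbl ^^ r) t))) \<in> X"
      using R(1) by (intro cmult_X sum_X dbl_X(1) gX)
    then show ?thesis by (simp add: n_def)
  qed
  have yAm: "meas01 (\<lambda>t. y t * ?A t)"
    using meas01_X[OF yX] meas01_X[OF AX] unfolding meas01_def by (rule borel_measurable_times)
  have yA: "(\<lambda>t. y t * ?A t) \<in> X" "N (\<lambda>t. y t * ?A t) \<le> e / 2"
  proof -
    have "\<bar>y t * ?A t\<bar> \<le> \<bar>B * ?A t\<bar>" for t
      unfolding abs_mult using yb[of t] B by (intro mult_right_mono) auto
    then have ae: "AE t in L01. \<bar>y t * ?A t\<bar> \<le> \<bar>B * ?A t\<bar>" by (intro AE_I2)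
    show "(\<lambda>t. y t * ?A t) \<in> X" by (rule ideal_X(1)[OF cmult_X[OF AX] yAm ae])
    have "N (\<lambda>t. y t * ?A t) \<le> B * N ?A"
      using ideal_X(2)[OF cmult_X[OF AX] yAm ae] N_cmult[OF AX, of B] B by simp
    also have "\<dots> \<le> (B + 1) * (e / 2 / (B + 1))"
      using R(4) B N_nonneg[OF AX] by (intro mult_mono) auto
    also have "\<dots> = e / 2" using B by (simp add: field_simps)
    finally show "N (\<lambda>t. y t * ?A t) \<le> e / 2" .
  qed
  have "N (\<lambda>t. x t - (\<Sum>k=k0..<k1. dblock \<xi> f k t)) = N (\<lambda>t. (x t - y t) + y t * ?A t)"
    unfolding A sum_eq by (simp add: algebra_simps)
  also have "\<dots> \<le> N (\<lambda>t. x t - y t) + N (\<lambda>t. y t * ?A t)"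
    by (intro N_add diff_X x yX yA)
  also have "\<dots> \<le> e" using \<eta> yA(2) by (simp add: y_def)
  finally have 1: "N (\<lambda>t. x t - (\<Sum>k=k0..<k1. dblock \<xi> f k t)) \<le> e" .
  have N0: "N (\<lambda>t. 0) = 0" using N_eq_0_iff[OF zero_X] by simp
  have "(\<Sum>k=k0..<k1. N (dblock \<xi> f k)) = (\<Sum>k\<in>R. N (dblock \<xi> f k))"
    using Rsub \<xi>nR N0 by (intro sum.mono_neutral_right) auto
  also have "\<dots> \<le> (\<Sum>k\<in>R. C * ((1 / (n * \<bar>a\<bar>)) * N y))"
  proof (rule sum_mono)
    fix k assume k: "k \<in> R"
    have "N (dblock \<xi> f k) \<le> C * N (\<lambda>t. \<xi> (dig k t))" by (rule dblock_bound)
    also have "N (\<lambda>t. \<xi> (dig k t)) = (1 / (n * \<bar>a\<bar>)) * N y"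
      unfolding \<xi>R[OF k] N_cmult[OF yX] using n by (simp add: abs_mult)
    finally show "N (dblock \<xi> f k) \<le> C * ((1 / (n * \<bar>a\<bar>)) * N y)" .
  qed
  also have "\<dots> = C / \<bar>a\<bar> * N y" using n by (simp add: n_def)
  also have "\<dots> \<le> C / \<bar>a\<bar> * (N x + e)"
  proof (rule mult_left_mono)
    show "N y \<le> N x + e"
      using N_le_diff[OF yX x] N_diff_commute[OF x yX] \<eta> e by (simp add: y_def)
  qed (use C_nonneg in auto)
  finally show ?thesis using that k1 1 by blast
qed

text \<open>Successive approximation with tolerances \<nu>/2^(n+1), where \<nu> is the norm of x.
  With A = C/|a|, stage n costs at most A times \<nu>/2^n + \<nu>/2^(n+1), and the geometric series
  yields the factor 3.\<close>

lemma block_expansion: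
  assumes x: "x \<in> X"
  obtains \<xi> where "(\<lambda>n. N (\<lambda>t. x t - (\<Sum>k=k0..n. dblock \<xi> f k t))) \<longlonglongrightarrow> 0"
    "summable (\<lambda>j. N (dblock \<xi> f (k0 + j)))" "(\<Sum>j. N (dblock \<xi> f (k0 + j))) \<le> 3 * (C / \<bar>a\<bar>) * N x"
proof (cases "N x = 0")
  \<comment> \<open>The tolerances would vanish here, so zero coefficients are used.\<close>
  case True
  have "dblock (\<lambda>_. 0) f k = (\<lambda>t. 0)" for k by (auto simp: dblock_def)
  then show ?thesis using that[of "\<lambda>_. 0"] True N_eq_0_iff[OF zero_X] by simp
next
  case False
  define \<nu> where "\<nu> = N x"
  define A where "A = C / \<bar>a\<bar>"
  have \<nu>: "0 < \<nu>" using False N_nonneg[OF x] by (simp add: \<nu>_def)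
  have A: "0 \<le> A" using C_nonneg by (simp add: A_def)
  define rem where "rem K \<xi> t = x t - (\<Sum>k=k0..<K. dblock \<xi> f k t)" for K \<xi> t
  have remX: "rem K \<xi> \<in> X" for K \<xi>
    unfolding rem_def[abs_def] by (intro diff_X x sum_X dblock_X f_in) auto
  define P where "P n s \<longleftrightarrow> (n = 0 \<longrightarrow> fst s = k0) \<and> k0 + n \<le> fst s \<and> N (rem (fst s) (snd s)) \<le> \<nu> / 2 ^ n"
    for n and s :: "nat \<times> (bool list \<Rightarrow> real)"
  define Q where "Q n s s' \<longleftrightarrow> fst s < fst s' \<and> (\<forall>\<beta>. length \<beta> < fst s \<longrightarrow> snd s' \<beta> = snd s \<beta>) \<and>
      (\<Sum>k=fst s..<fst s'. N (dblock (snd s') f k)) \<le> A * (\<nu> / 2 ^ n + \<nu> / 2 ^ Suc n)"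
    for n and s s' :: "nat \<times> (bool list \<Rightarrow> real)"
  have "\<exists>\<sigma>. \<forall>n. P n (\<sigma> n) \<and> Q n (\<sigma> n) (\<sigma> (Suc n))"
  proof (rule dependent_nat_choice)
    show "\<exists>s. P 0 s"
      by (rule exI[of _ "(k0, \<lambda>_. 0)"]) (simp add: P_def rem_def[abs_def] \<nu>_def)
    fix s n assume s: "P n s"
    obtain K \<xi> where s_eq: "s = (K, \<xi>)" by (cases s)
    have K: "k0 + n \<le> K" "N (rem K \<xi>) \<le> \<nu> / 2 ^ n" using s by (auto simp: P_def s_eq)
    obtain K' \<zeta> where K': "K < K'" "N (\<lambda>t. rem K \<xi> t - (\<Sum>k=K..<K'. dblock \<zeta> f k t)) \<le> \<nu> / 2 ^ Suc n"
      "(\<Sum>k=K..<K'. N (dblock \<zeta> f k)) \<le> C / \<bar>a\<bar> * (N (rem K \<xi>) + \<nu> / 2 ^ Suc n)"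
      by (rule block_approximation[OF remX[of K \<xi>], of "\<nu> / 2 ^ Suc n" K]) (use \<nu> in auto)
    define \<xi>' where "\<xi>' \<beta> = (if length \<beta> < K then \<xi> \<beta> else \<zeta> \<beta>)" for \<beta>
    have lo: "dblock \<xi>' f k = dblock \<xi> f k" if "k < K" for k
      using that by (auto simp: dblock_def \<xi>'_def)
    have hi: "dblock \<xi>' f k = dblock \<zeta> f k" if "K \<le> k" for k
      using that by (auto simp: dblock_def \<xi>'_def)
    have "rem K' \<xi>' = (\<lambda>t. rem K \<xi> t - (\<Sum>k=K..<K'. dblock \<zeta> f k t))"
    proof
      fix t
      have "(\<Sum>k=k0..<K'. dblock \<xi>' f k t) = (\<Sum>k=k0..<K. dblock \<xi>' f k t) + (\<Sum>k=K..<K'. dblock \<xi>' f k t)"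
        using K K' by (intro sum.atLeastLessThan_concat[symmetric]) auto
      then show "rem K' \<xi>' t = rem K \<xi> t - (\<Sum>k=K..<K'. dblock \<zeta> f k t)"
        using lo hi by (simp add: rem_def)
    qed
    then have "P (Suc n) (K', \<xi>')" using K K' by (simp add: P_def)
    moreover have "(\<Sum>k=K..<K'. N (dblock \<xi>' f k)) \<le> A * (\<nu> / 2 ^ n + \<nu> / 2 ^ Suc n)"
    proof -
      have "(\<Sum>k=K..<K'. N (dblock \<xi>' f k)) = (\<Sum>k=K..<K'. N (dblock \<zeta> f k))" using hi by simp
      also have "\<dots> \<le> A * (N (rem K \<xi>) + \<nu> / 2 ^ Suc n)" using K'(3) by (simp add: A_def)
      also have "\<dots> \<le> A * (\<nu> / 2 ^ n + \<nu> / 2 ^ Suc n)"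
        using A K(2) by (intro mult_left_mono) auto
      finally show ?thesis .
    qed
    then have "Q n s (K', \<xi>')" using K' by (simp add: Q_def s_eq \<xi>'_def)
    ultimately show "\<exists>s'. P (Suc n) s' \<and> Q n s s'" by blast
  qed
  then obtain \<sigma> where \<sigma>: "\<And>n. P n (\<sigma> n)" "\<And>n. Q n (\<sigma> n) (\<sigma> (Suc n))" by blast
  define K where "K n = fst (\<sigma> n)" for n
  define \<Xi> where "\<Xi> n = snd (\<sigma> n)" for n
  have K0: "K 0 = k0" and Kge: "k0 + n \<le> K n" and remK: "N (rem (K n) (\<Xi> n)) \<le> \<nu> / 2 ^ n" for n
    using \<sigma>(1)[of 0] \<sigma>(1)[of n] by (auto simp: P_def K_def \<Xi>_def)
  have KSuc: "K n < K (Suc n)" and agree: "\<And>\<beta>. length \<beta> < K n \<Longrightarrow> \<Xi> (Suc n) \<beta> = \<Xi> n \<beta>"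
    and stage: "(\<Sum>k=K n..<K (Suc n). N (dblock (\<Xi> (Suc n)) f k)) \<le> A * (\<nu> / 2 ^ n + \<nu> / 2 ^ Suc n)" for n
    using \<sigma>(2)[of n] by (auto simp: Q_def K_def \<Xi>_def)
  have Kmono: "K m \<le> K n" if "m \<le> n" for m n
    using that by (rule lift_Suc_mono_le[of K, rotated]) (rule less_imp_le[OF KSuc])
  have agree_le: "\<Xi> n \<beta> = \<Xi> m \<beta>" if "m \<le> n" "length \<beta> < K m" for m n \<beta>
    using that
  proof (induction rule: dec_induct)
    case (step n)
    have "length \<beta> < K n" using step.prems step.hyps Kmono[of m n] by linarith
    with agree[of \<beta> n] step show ?case by simp
  qed simp
  define \<xi> where "\<xi> \<beta> = \<Xi> (Suc (length \<beta>)) \<beta>" for \<beta>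
  have \<xi>_eq: "\<xi> \<beta> = \<Xi> n \<beta>" if "length \<beta> < K n" for \<beta> n
  proof -
    have "length \<beta> < K (Suc (length \<beta>))" using Kge[of "Suc (length \<beta>)"] by linarith
    then show ?thesis
      using that agree_le[of n "Suc (length \<beta>)" \<beta>] agree_le[of "Suc (length \<beta>)" n \<beta>]
      unfolding \<xi>_def by (metis nle_le)
  qed
  have dblock_eq: "dblock \<xi> f k = dblock (\<Xi> n) f k" if "k < K n" for k n
    using that \<xi>_eq by (auto simp: dblock_def)
  have rem_eq: "rem (K n) \<xi> = rem (K n) (\<Xi> n)" for n
    unfolding rem_def[abs_def] by (intro ext arg_cong2[where f = "(-)"] refl sum.cong) (simp add: dblock_eq[of _ n])
  define u where "u k = N (dblock \<xi> f k)" for k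
  have u0: "0 \<le> u k" for k unfolding u_def by (intro N_nonneg dblock_X f_in)
  \<comment> \<open>Writing the stage costs as differences lets them telescope.\<close>
  have tail: "(\<Sum>k=K m..<K n. u k) \<le> 3 * A * \<nu> * (1 / 2 ^ m - 1 / 2 ^ n)" if "m \<le> n" for m n
    using that
  proof (induction rule: dec_induct)
    case (step n)
    have "(\<Sum>k=K m..<K (Suc n). u k) = (\<Sum>k=K m..<K n. u k) + (\<Sum>k=K n..<K (Suc n). u k)"
      using Kmono[OF step(1)] KSuc[of n] by (intro sum.atLeastLessThan_concat[symmetric]) auto
    also have "(\<Sum>k=K n..<K (Suc n). u k) = (\<Sum>k=K n..<K (Suc n). N (dblock (\<Xi> (Suc n)) f k))"
      using dblock_eq by (intro sum.cong) (auto simp: u_def)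
    also have "\<dots> \<le> A * (\<nu> / 2 ^ n + \<nu> / 2 ^ Suc n)" by (rule stage)
    also have "A * (\<nu> / 2 ^ n + \<nu> / 2 ^ Suc n) = 3 * A * \<nu> * (1 / 2 ^ n - 1 / 2 ^ Suc n)"
      by (simp add: field_simps)
    finally show ?case using step.IH by (simp add: algebra_simps)
  qed simp
  have tail': "(\<Sum>k=K m..<n. u k) \<le> 3 * A * \<nu> / 2 ^ m" for m n
  proof -
    have "(\<Sum>k=K m..<n. u k) \<le> (\<Sum>k=K m..<K (max m n). u k)"
      using Kge[of "max m n"] u0 by (intro sum_mono2) auto
    also have "\<dots> \<le> 3 * A * \<nu> * (1 / 2 ^ m - 1 / 2 ^ max m n)" by (rule tail) simp
    also have "\<dots> \<le> 3 * A * \<nu> * (1 / 2 ^ m)" using A \<nu> by (intro mult_left_mono) auto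
    finally show ?thesis by simp
  qed
  have partial: "(\<Sum>j<n. u (k0 + j)) \<le> 3 * A * \<nu>" for n
  proof -
    have "(\<Sum>j<n. u (k0 + j)) = (\<Sum>k=k0..<k0 + n. u k)"
      using sum.shift_bounds_nat_ivl[of u 0 k0 n] by (simp add: add.commute atLeast0LessThan)
    then show ?thesis using tail'[of 0 "k0 + n"] K0 by simp
  qed
  have sm: "summable (\<lambda>j. u (k0 + j))"
    by (rule summableI_nonneg_bounded[OF u0 partial])
  have "(\<Sum>j. u (k0 + j)) \<le> 3 * A * \<nu>"
    by (rule suminf_le_const[OF sm partial])
  moreover have "(\<lambda>n. N (\<lambda>t. x t - (\<Sum>k=k0..n. dblock \<xi> f k t))) \<longlonglongrightarrow> 0"
  proof (rule LIMSEQ_I)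
    fix e :: real assume e: "0 < e"
    obtain m :: nat where m: "(1 / 2) ^ m < e / (\<nu> + 3 * A * \<nu> + 1)"
      using real_arch_pow_inv[of "e / (\<nu> + 3 * A * \<nu> + 1)" "1/2"] e \<nu> A by (auto simp: add_pos_nonneg)
    have small: "\<nu> / 2 ^ m + 3 * A * \<nu> / 2 ^ m < e"
    proof -
      have "0 < \<nu> + 3 * A * \<nu> + 1" using \<nu> A by (simp add: add_pos_nonneg)
      with m have "(1 / 2) ^ m * (\<nu> + 3 * A * \<nu> + 1) < e" by (simp add: pos_less_divide_eq)
      moreover have "(\<nu> + 3 * A * \<nu>) / 2 ^ m \<le> (1 / 2) ^ m * (\<nu> + 3 * A * \<nu> + 1)"
        by (simp add: power_one_over field_simps)
      ultimately show ?thesis by (simp add: add_divide_distrib)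
    qed
    \<comment> \<open>Partial sums may stop inside a stage; what they add to the remainder at
      \<open>K m\<close> is bounded by the tail of the block norms.\<close>
    have "N (\<lambda>t. x t - (\<Sum>k=k0..n. dblock \<xi> f k t)) < e" if n: "K m \<le> n" for n
    proof -
      have split: "(\<Sum>k=k0..n. v k) = (\<Sum>k=k0..<K m. v k) + (\<Sum>k=K m..<Suc n. v k)" for v :: "nat \<Rightarrow> real"
        unfolding atLeastLessThanSuc_atLeastAtMost[symmetric]
        using Kge[of m] n by (intro sum.atLeastLessThan_concat[symmetric]) auto
      have "N (\<lambda>t. x t - (\<Sum>k=k0..n. dblock \<xi> f k t)) = N (\<lambda>t. rem (K m) \<xi> t + (-1) * (\<Sum>k=K m..<Suc n. dblock \<xi> f k t))"
        unfolding split rem_def by (simp add: algebra_simps)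
      also have "\<dots> \<le> N (rem (K m) \<xi>) + N (\<lambda>t. (-1) * (\<Sum>k=K m..<Suc n. dblock \<xi> f k t))"
        by (intro N_add remX cmult_X sum_X dblock_X f_in) auto
      also have "N (\<lambda>t. (-1) * (\<Sum>k=K m..<Suc n. dblock \<xi> f k t)) = N (\<lambda>t. \<Sum>k=K m..<Suc n. dblock \<xi> f k t)"
        unfolding N_cmult[OF sum_X(1)[OF finite_atLeastLessThan dblock_X[OF f_in]]] by simp
      also have "\<dots> \<le> (\<Sum>k=K m..<Suc n. u k)"
        unfolding u_def by (intro sum_X(2) dblock_X f_in) auto
      also have "\<dots> \<le> 3 * A * \<nu> / 2 ^ m" by (rule tail')
      finally show ?thesis using remK[of m] small by (simp add: rem_eq)
    qed
    moreover have "0 \<le> N (\<lambda>t. x t - (\<Sum>k=k0..n. dblock \<xi> f k t))" for n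
      by (intro N_nonneg diff_X x sum_X dblock_X f_in) auto
    ultimately show "\<exists>no. \<forall>n\<ge>no. norm (N (\<lambda>t. x t - (\<Sum>k=k0..n. dblock \<xi> f k t)) - 0) < e"
      by (intro exI[of _ "K m"]) auto
  qed
  ultimately show ?thesis using that sm unfolding u_def A_def \<nu>_def by blast
qed

text \<open>The added 1 makes the constant strictly positive whatever the value of C/|a|.\<close>

lemma abs_representing_blocks: "abs_representing X N f k0 (3 * (C / \<bar>a\<bar>) + 1)"
  unfolding abs_representing_def
proof (intro ballI)
  fix x assume x: "x \<in> X"
  obtain \<xi> where \<xi>: "(\<lambda>n. N (\<lambda>t. x t - (\<Sum>k=k0..n. dblock \<xi> f k t))) \<longlonglongrightarrow> 0"
    "summable (\<lambda>j. N (dblock \<xi> f (k0 + j)))" "(\<Sum>j. N (dblock \<xi> f (k0 + j))) \<le> 3 * (C / \<bar>a\<bar>) * N x"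
    by (rule block_expansion[OF x])
  have "3 * (C / \<bar>a\<bar>) * N x \<le> (3 * (C / \<bar>a\<bar>) + 1) * N x"
    using N_nonneg[OF x] by (intro mult_right_mono) auto
  with \<xi> show "\<exists>\<xi>. (\<lambda>n. N (\<lambda>t. x t - (\<Sum>k = k0..n. block \<xi> f k t))) \<longlonglongrightarrow> 0 \<and>
        summable (\<lambda>j. N (block \<xi> f (k0 + j))) \<and> (\<Sum>j. N (block \<xi> f (k0 + j))) \<le> (3 * (C / \<bar>a\<bar>) + 1) * N x"
    by (intro exI[of _ \<xi>]) (auto simp: N_diff_sum_block[OF x f_in] block_X[OF f_in])
qed

end

section \<open>Representing systems yield multiplicators\<close>

lemma sum_words_prefix:
  fixes F :: "bool list \<Rightarrow> real"
  assumes "length \<alpha> = k"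
  shows "(\<Sum>\<beta>\<in>words (k + m). of_bool (take k \<beta> = \<alpha>) * F \<beta>) = (\<Sum>\<gamma>\<in>words m. F (\<alpha> @ \<gamma>))"
proof -
  have "(\<Sum>\<gamma>\<in>words m. F (\<alpha> @ \<gamma>)) = (\<Sum>\<beta>\<in>(@) \<alpha> ` words m. F \<beta>)"
    by (subst sum.reindex) (auto simp: inj_on_def)
  also have "\<dots> = (\<Sum>\<beta>\<in>(@) \<alpha> ` words m. of_bool (take k \<beta> = \<alpha>) * F \<beta>)"
    using assms by (intro sum.cong) auto
  also have "\<dots> = (\<Sum>\<beta>\<in>words (k + m). of_bool (take k \<beta> = \<alpha>) * F \<beta>)"
  proof (rule sum.mono_neutral_left)
    show "\<forall>\<beta>\<in>words (k + m) - (@) \<alpha> ` words m. of_bool (take k \<beta> = \<alpha>) * F \<beta> = 0"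
    proof
      fix \<beta> assume \<beta>: "\<beta> \<in> words (k + m) - (@) \<alpha> ` words m"
      then have "drop k \<beta> \<in> words m" by auto
      then have "take k \<beta> \<noteq> \<alpha>" using \<beta> by (metis DiffD2 append_take_drop_id image_eqI)
      then show "of_bool (take k \<beta> = \<alpha>) * F \<beta> = 0" by simp
    qed
  qed (use assms in auto)
  finally show ?thesis ..
qed

context sep_sym_space
begin

text \<open>The step function is expanded from its own level k on. Integrating over the interval of
  \<alpha> turns the block of level j into a times the mean \<open>c j \<alpha>\<close> of its
  coefficients there, up to the length of the interval. So \<open>\<xi> \<alpha>\<close> is a times
  the sum of these means, and \<open>dblock \<xi> f k\<close> is a times the sum of averaged blocks,
  whose norms the expansion controls.\<close>

lemma abs_representing_dblock_bound:
  assumes f: "f \<in> X" and fi: "integrable L01 f" and a: "integral\<^sup>L L01 f = a"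
    and rep: "abs_representing X N f k C"
  shows "N (dblock \<xi> f k) \<le> \<bar>a\<bar> * C * N (\<lambda>t. \<xi> (dig k t))"
proof -
  let ?y = "\<lambda>t. \<xi> (dig k t)"
  obtain \<eta> where \<eta>: "(\<lambda>n. N (\<lambda>t. ?y t - (\<Sum>j=k..n. block \<eta> f j t))) \<longlonglongrightarrow> 0"
    "summable (\<lambda>j. N (block \<eta> f (k + j)))" "(\<Sum>j. N (block \<eta> f (k + j))) \<le> C * N ?y"
    using bspec[OF rep[unfolded abs_representing_def] step_X] by blast
  define w where "w n t = ?y t - (\<Sum>j=k..n. dblock \<eta> f j t)" for n t
  have wX: "w n \<in> X" for n
    unfolding w_def[abs_def] by (intro diff_X step_X sum_X dblock_X f) auto
  have wlim: "(\<lambda>n. N (w n)) \<longlonglongrightarrow> 0"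
    using \<eta>(1) unfolding N_diff_sum_block[OF step_X f] w_def[abs_def] .
  define c where "c j = (avg ^^ (j - k)) \<eta>" for j
  \<comment> \<open>The defect after finitely many blocks. It is at most 2^k times the norm of the
    remainder, and as k is fixed it tends to zero.\<close>
  define d where "d n \<alpha> = \<xi> \<alpha> - a * (\<Sum>j=k..n. c j \<alpha>)" for n \<alpha>
  have dbound: "\<bar>d n \<alpha>\<bar> \<le> 2 ^ k * N (w n)" if \<alpha>: "length \<alpha> = k" for n \<alpha>
  proof -
    define e :: "real \<Rightarrow> real" where "e t = of_bool (dig k t = \<alpha>)" for t
    have ey_eq: "e t * ?y t = (\<lambda>\<beta>. of_bool (\<beta> = \<alpha>) * \<xi> \<beta>) (dig k t)" for t
      by (simp add: e_def)
    have ey: "integrable L01 (\<lambda>t. e t * ?y t)" "integral\<^sup>L L01 (\<lambda>t. e t * ?y t) = \<xi> \<alpha> / 2 ^ k"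
    proof -
      have "(\<Sum>\<beta>\<in>words k. of_bool (\<beta> = \<alpha>) * \<xi> \<beta>) = \<xi> \<alpha>"
        using \<alpha> by (simp add: of_bool_def if_distrib[of "\<lambda>c. c * _"] cong: if_cong)
      then show "integrable L01 (\<lambda>t. e t * ?y t)" "integral\<^sup>L L01 (\<lambda>t. e t * ?y t) = \<xi> \<alpha> / 2 ^ k"
        unfolding ey_eq using integrable_step[of "\<lambda>\<beta>. of_bool (\<beta> = \<alpha>) * \<xi> \<beta>" k] integral_step[of "\<lambda>\<beta>. of_bool (\<beta> = \<alpha>) * \<xi> \<beta>" k]
        by simp_all
    qed
    have eb: "integrable L01 (\<lambda>t. e t * dblock \<eta> f j t)" "integral\<^sup>L L01 (\<lambda>t. e t * dblock \<eta> f j t) = a * c j \<alpha> / 2 ^ k"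
      if "k \<le> j" for j
    proof -
      have eq: "e t * dblock \<eta> f j t = (\<lambda>\<beta> t. (of_bool (take k \<beta> = \<alpha>) * \<eta> \<beta>) * f t) (dig j t) ((dbl ^^ j) t)" for t
        using that by (simp add: e_def dblock_def take_dig)
      note I = integral_dig[of j "\<lambda>\<beta> t. (of_bool (take k \<beta> = \<alpha>) * \<eta> \<beta>) * f t", OF integrable_mult_right[OF fi]]
      show "integrable L01 (\<lambda>t. e t * dblock \<eta> f j t)" unfolding eq by (rule I(1))
      have "integral\<^sup>L L01 (\<lambda>t. e t * dblock \<eta> f j t) = (\<Sum>\<beta>\<in>words j. of_bool (take k \<beta> = \<alpha>) * \<eta> \<beta>) * a / 2 ^ j"
        unfolding eq I(2) sum_distrib_right by (simp only: integral_mult_right_zero a)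
      also have "(\<Sum>\<beta>\<in>words j. of_bool (take k \<beta> = \<alpha>) * \<eta> \<beta>) = (\<Sum>\<gamma>\<in>words (j - k). \<eta> (\<alpha> @ \<gamma>))"
        using sum_words_prefix[OF \<alpha>, of \<eta> "j - k"] that by simp
      also have "\<dots> = 2 ^ (j - k) * c j \<alpha>" unfolding c_def avg_pow by simp
      also have "2 ^ (j - k) * c j \<alpha> * a / 2 ^ j = a * c j \<alpha> / 2 ^ k"
        using that by (simp add: power_diff)
      finally show "integral\<^sup>L L01 (\<lambda>t. e t * dblock \<eta> f j t) = a * c j \<alpha> / 2 ^ k" .
    qed
    have ew: "e t * w n t = e t * ?y t - (\<Sum>j=k..n. e t * dblock \<eta> f j t)" for t
      unfolding w_def by (simp add: right_diff_distrib sum_distrib_left)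
    have si: "integrable L01 (\<lambda>t. \<Sum>j=k..n. e t * dblock \<eta> f j t)"
      by (intro Bochner_Integration.integrable_sum eb) auto
    have int: "integral\<^sup>L L01 (\<lambda>t. e t * w n t) = d n \<alpha> / 2 ^ k"
    proof -
      have "integral\<^sup>L L01 (\<lambda>t. e t * w n t) = \<xi> \<alpha> / 2 ^ k - (\<Sum>j=k..n. a * c j \<alpha> / 2 ^ k)"
        unfolding ew Bochner_Integration.integral_diff[OF ey(1) si] ey(2)
        by (subst Bochner_Integration.integral_sum) (auto simp: eb)
      then show ?thesis
        by (simp add: d_def diff_divide_distrib sum_divide_distrib sum_distrib_left)
    qed
    have ewi: "integrable L01 (\<lambda>t. e t * w n t)"
      unfolding ew by (rule Bochner_Integration.integrable_diff[OF ey(1) si])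
    have ewm: "meas01 (\<lambda>t. e t * w n t)"
      using ewi by (auto simp: meas01_def)
    have ae: "AE t in L01. \<bar>e t * w n t\<bar> \<le> \<bar>w n t\<bar>"
      by (intro AE_I2) (simp add: e_def)
    have "\<bar>integral\<^sup>L L01 (\<lambda>t. e t * w n t)\<bar> \<le> N (\<lambda>t. e t * w n t)"
      by (rule integral_le_N[OF ideal_X(1)[OF wX ewm ae] ewi])
    also have "\<dots> \<le> N (w n)" by (rule ideal_X(2)[OF wX ewm ae])
    finally show ?thesis unfolding int by (simp add: field_simps)
  qed
  have main: "N (dblock \<xi> f k) \<le> 2 ^ k * N f * N (w n) + \<bar>a\<bar> * C * N ?y" for n
  proof -
    have dX: "dblock (d n) f k \<in> X" by (rule dblock_X[OF f])
    have sX: "(\<lambda>t. \<Sum>j=k..n. dblock (c j) f k t) \<in> X" by (intro sum_X dblock_X f) auto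
    have "dblock \<xi> f k = (\<lambda>t. dblock (d n) f k t + a * (\<Sum>j=k..n. dblock (c j) f k t))"
      by (auto simp: dblock_def d_def sum_distrib_left sum_distrib_right algebra_simps)
    then have "N (dblock \<xi> f k) \<le> N (dblock (d n) f k) + N (\<lambda>t. a * (\<Sum>j=k..n. dblock (c j) f k t))"
      using N_add[OF dX cmult_X[OF sX]] by simp
    moreover have "N (dblock (d n) f k) \<le> 2 ^ k * N f * N (w n)"
    proof -
      have "\<bar>dblock (d n) f k t\<bar> \<le> \<bar>(2 ^ k * N (w n)) * f ((dbl ^^ k) t)\<bar>" for t
        unfolding dblock_def abs_mult
        using dbound[of "dig k t" n] N_nonneg[OF wX[of n]] by (intro mult_right_mono) (auto simp: abs_mult)
      then have "N (dblock (d n) f k) \<le> N (\<lambda>t. (2 ^ k * N (w n)) * f ((dbl ^^ k) t))"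
        by (intro ideal_X(2)[OF cmult_X[OF dbl_X(1)[OF f]] meas01_X[OF dX]] AE_I2)
      also have "\<dots> = 2 ^ k * N f * N (w n)"
        using N_cmult[OF dbl_X(1)[OF f, of k], of "2 ^ k * N (w n)"] dbl_X(2)[OF f, of k] N_nonneg[OF wX[of n]]
        by (simp add: abs_mult)
      finally show ?thesis .
    qed
    moreover have "N (\<lambda>t. a * (\<Sum>j=k..n. dblock (c j) f k t)) \<le> \<bar>a\<bar> * C * N ?y"
    proof -
      have "N (\<lambda>t. \<Sum>j=k..n. dblock (c j) f k t) \<le> (\<Sum>j=k..n. N (dblock (c j) f k))"
        by (intro sum_X(2) dblock_X f) auto
      also have "\<dots> \<le> (\<Sum>j=k..n. N (block \<eta> f j))"
      proof (rule sum_mono)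
        fix j assume "j \<in> {k..n}"
        then show "N (dblock (c j) f k) \<le> N (block \<eta> f j)"
          using N_dblock_avg_pow[OF f, of "j - k" \<eta> k] by (simp add: c_def block_X(2)[OF f])
      qed
      also have "\<dots> \<le> (\<Sum>j<Suc n. N (block \<eta> f (k + j)))"
      proof -
        have "(\<Sum>j=k..n. N (block \<eta> f j)) = (\<Sum>j\<in>(\<lambda>j. j - k) ` {k..n}. N (block \<eta> f (k + j)))"
          by (subst sum.reindex) (auto simp: inj_on_def)
        also have "\<dots> \<le> (\<Sum>j<Suc n. N (block \<eta> f (k + j)))"
          by (intro sum_mono2) (auto intro: N_nonneg block_X f)
        finally show ?thesis .
      qed
      also have "\<dots> \<le> (\<Sum>j. N (block \<eta> f (k + j)))"
        by (rule sum_le_suminf[OF \<eta>(2)]) (auto intro: N_nonneg block_X f)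
      also note \<eta>(3)
      finally have "\<bar>a\<bar> * N (\<lambda>t. \<Sum>j=k..n. dblock (c j) f k t) \<le> \<bar>a\<bar> * (C * N ?y)"
        by (intro mult_left_mono) auto
      then show ?thesis using N_cmult[OF sX, of a] by simp
    qed
    ultimately show ?thesis by linarith
  qed
  have "(\<lambda>n. 2 ^ k * N f * N (w n) + \<bar>a\<bar> * C * N ?y) \<longlonglongrightarrow> 2 ^ k * N f * 0 + \<bar>a\<bar> * C * N ?y"
    by (intro tendsto_intros wlim)
  then show ?thesis
    by (intro LIMSEQ_le_const[where X = "\<lambda>n. 2 ^ k * N f * N (w n) + \<bar>a\<bar> * C * N ?y"]) (use main in auto)
qed

end

text \<open>On \<open>(2^-(i+1), 2^-i]\<close> with \<open>i < n\<close> the function \<open>ladder n c f\<close> is a compressed copy of \<open>c i * f\<close>, and it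
  vanishes on \<open>[0, 2^-n]\<close>. Unlike the blocks equimeasurable with them, ladders of different heights \<open>n\<close>
  extend each other.\<close>

fun ladder :: "nat \<Rightarrow> (nat \<Rightarrow> real) \<Rightarrow> (real \<Rightarrow> real) \<Rightarrow> real \<Rightarrow> real" where
  "ladder 0 c f t = 0"
| "ladder (Suc n) c f t = (if t \<le> 1/2 then ladder n (\<lambda>i. c (Suc i)) f (2 * t) else c 0 * f (2 * t - 1))"

text \<open>On words of length n the value is \<open>c i\<close>, with i the number of zeros before
  the first digit 1, and it is 0 for the word of zeros. The step function with these coefficients is
  the ladder over the constant 1.\<close>

fun ladder_coeff :: "nat \<Rightarrow> (nat \<Rightarrow> real) \<Rightarrow> bool list \<Rightarrow> real" where
  "ladder_coeff 0 c \<beta> = 0"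
| "ladder_coeff (Suc n) c \<beta> = (if hd \<beta> then c 0 else ladder_coeff n (\<lambda>i. c (Suc i)) (tl \<beta>))"

lemma ladder_one: "ladder n c (\<lambda>t. 1) t = ladder_coeff n c (dig n t)"
  by (induction n arbitrary: c t) (auto simp: dbl_def)

lemma ladder_eval:
  "(1/2) ^ Suc i < t \<Longrightarrow> t \<le> (1/2) ^ i \<Longrightarrow> ladder n c (\<lambda>t. 1) t = (if i < n then c i else 0)"
proof (induction n arbitrary: i c t)
  case (Suc n)
  show ?case
  proof (cases i)
    case 0
    then show ?thesis using Suc.prems by simp
  next
    case (Suc j)
    have "t \<le> 1/2"
      using Suc.prems(2) power_le_one[of "1/2::real" j] by (simp add: \<open>i = Suc j\<close>)
    then show ?thesis using Suc.IH[of j "2 * t" "\<lambda>i. c (Suc i)"] Suc.prems by (simp add: \<open>i = Suc j\<close>)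
  qed
qed simp

lemma ladder_diff: "ladder n c f t - ladder n c' f t = ladder n (\<lambda>i. c i - c' i) f t"
  by (induction n arbitrary: c c' t) (auto simp: algebra_simps)

lemma ladder_extend: "m \<le> n \<Longrightarrow> ladder m c f t = ladder n (\<lambda>i. if i < m then c i else 0) f t"
proof (induction m arbitrary: n c t)
  case 0
  have "ladder n (\<lambda>i. 0) f t = 0"
    by (induction n arbitrary: t) auto
  then show ?case by simp
next
  case (Suc m)
  then obtain n' where "n = Suc n'" "m \<le> n'" by (cases n) auto
  with Suc.IH[of n' "\<lambda>i. c (Suc i)" "2 * t"] show ?case by (simp cong: if_cong)
qed

text \<open>A taller ladder differs from a shorter one only where the latter vanishes.\<close>

lemma ladder_mono: "m \<le> n \<Longrightarrow> \<bar>ladder m c f t\<bar> \<le> \<bar>ladder n c f t\<bar>"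
proof (induction m arbitrary: n c t)
  case (Suc m)
  then obtain n' where "n = Suc n'" "m \<le> n'" by (cases n) auto
  with Suc.IH[of n' "\<lambda>i. c (Suc i)" "2 * t"] show ?case by simp
qed simp

lemma meas01_ladder: "meas01 f \<Longrightarrow> meas01 (ladder n c f)"
proof (induction n arbitrary: c)
  case 0
  then show ?case by (simp add: meas01_def)
next
  case (Suc n)
  have "(\<lambda>t. if t \<le> 1/2 then ladder n (\<lambda>i. c (Suc i)) f (2 * t) else c 0 * f (2 * t - 1)) \<in> borel_measurable L01"
    by (rule borel_measurable_join[where v = "\<lambda>t. c 0 * f t"]) (use Suc in \<open>auto simp: meas01_def\<close>)
  then show ?case by (simp add: meas01_def)
qed

text \<open>Where the ladder has one copy of \<open>c 0 * f\<close> on the right half, the block has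
  2^n smaller copies; both contribute the same to the distribution. The left half is handled by
  induction.\<close>

lemma distr_ladder:
  assumes f: "meas01 f"
  shows "distr (ladder n c f) s = distr (dblock (ladder_coeff n c) f n) s"
proof (induction n arbitrary: c)
  case 0
  have "ladder 0 c f = dblock (ladder_coeff 0 c) f 0" by (auto simp: dblock_def)
  then show ?case by (simp only:)
next
  case (Suc n)
  define G where "G \<beta> = (if hd \<beta> then (\<lambda>t. c 0 * f t) else ladder n (\<lambda>i. c (Suc i)) f)" for \<beta> :: "bool list"
  have "ladder (Suc n) c f = (\<lambda>t. G (dig 1 t) ((dbl ^^ 1) t))"
    by (auto simp: G_def dbl_def)
  then have "distr (ladder (Suc n) c f) s = (\<Sum>\<beta>\<in>words 1. distr (G \<beta>) s) / 2 ^ 1"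
    using distr_dig[of 1 G s] meas01_ladder[OF f] f by (auto simp: G_def meas01_def)
  also have "words 1 = {[False], [True]}" by (auto simp: length_Suc_conv)
  also have "(\<Sum>\<beta>\<in>{[False], [True]}. distr (G \<beta>) s) / 2 ^ 1 =
      (distr (dblock (ladder_coeff n (\<lambda>i. c (Suc i))) f n) s + distr (\<lambda>t. c 0 * f t) s) / 2"
    by (simp add: G_def Suc.IH)
  also have "\<dots> = distr (dblock (ladder_coeff (Suc n) c) f (Suc n)) s"
    unfolding distr_dblock[OF f] by (simp add: sum_words_Suc card_words add_divide_distrib mult.commute)
  finally show ?case .
qed

lemma dyadic_shell:
  fixes t :: real
  assumes "0 < t" "t \<le> 1"
  obtains i :: nat where "(1/2) ^ Suc i < t" "t \<le> (1/2) ^ i"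
proof -
  define n where "n = (LEAST n. (1/2::real) ^ n < t)"
  obtain n0 :: nat where "(1/2::real) ^ n0 < t"
    using real_arch_pow_inv[OF assms(1), of "1/2"] by auto
  then have n: "(1/2::real) ^ n < t" unfolding n_def by (rule LeastI)
  then have "n \<noteq> 0" using assms(2) by (metis not_less power_0)
  then obtain i where i: "n = Suc i" by (cases n) auto
  then have "\<not> (1/2::real) ^ i < t" unfolding n_def by (metis lessI not_less_Least n_def)
  then show ?thesis using that n i by auto
qed

section \<open>Arbitrary second factors\<close>

context sep_sym_space
begin

text \<open>\<open>u (dbl t)\<close> has the norm of u and is the sum of its restrictions to the two
  halves, which are equimeasurable. The factor 2 pays for replacing a decreasing function on each
  shell by its value at the left end.\<close>

lemma N_le_half:
  assumes u: "u \<in> X"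
  shows "N u \<le> 2 * N (\<lambda>t. of_bool (t \<le> 1/2) * u (dbl t))"
proof -
  let ?h = "\<lambda>b \<beta>. of_bool (\<beta> = [b]) :: real"
  have eq: "dblock (?h False) u 1 = (\<lambda>t. of_bool (t \<le> 1/2) * u (dbl t))"
    by (auto simp: dblock_def)
  have w1: "words 1 = {[False], [True]}" by (auto simp: length_Suc_conv)
  have "N u = N (\<lambda>t. u ((dbl ^^ 1) t))" using dbl_X(2)[OF u, of 1] by simp
  also have "(\<lambda>t. u ((dbl ^^ 1) t)) = (\<lambda>t. dblock (?h False) u 1 t + dblock (?h True) u 1 t)"
    by (auto simp: dblock_def)
  also have "N \<dots> \<le> N (dblock (?h False) u 1) + N (dblock (?h True) u 1)"
    by (intro N_add dblock_X u)
  also have "N (dblock (?h True) u 1) = N (dblock (?h False) u 1)"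
    by (rule N_dblock_cong[OF u], unfold w1) simp
  finally show ?thesis unfolding eq by simp
qed

text \<open>The block bound is applied to ladders whose coefficients majorise the rearrangement of y
  shell by shell. They converge in norm to a function \<open>G\<close> that dominates the tensor
  product in distribution, so the norm of \<open>G\<close> controls it.\<close>

lemma multiplicatorI:
  assumes f: "f \<in> X" and K: "0 \<le> K" and bound: "\<And>k \<xi>. N (dblock \<xi> f k) \<le> K * N (\<lambda>t. \<xi> (dig k t))"
  shows "f \<in> multiplicator X N"
proof -
  have fm: "meas01 f" by (rule meas01_X[OF f])
  have "in_X2 X (tensor f y) \<and> norm_X2 N (tensor f y) \<le> 2 * K * N y" if y: "y \<in> X" for y
  proof -
    have ym: "meas01 y" by (rule meas01_X[OF y])
    have dy: "distribution_fun (distr y)" by (rule distribution_fun_distr[OF ym])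
    define r where "r = rearr (distr y)"
    have rX: "r \<in> X" "N r = N y" unfolding r_def using rearr_X[OF y] by auto
    have rm: "meas01 r" by (rule meas01_X[OF rX(1)])
    have r0: "0 \<le> r t" if "0 < t" for t unfolding r_def by (rule rearr_nonneg[OF dy that])
    have ranti: "r t' \<le> r t" if "0 < t" "t \<le> t'" for t t' unfolding r_def by (rule rearr_antimono[OF dy that])
    \<comment> \<open>The value at the left end of the shell (2^-(i+1), 2^-i], an upper bound for
      the decreasing r there.\<close>
    define c where "c i = r ((1/2) ^ Suc i)" for i
    have c0: "0 \<le> c i" for i unfolding c_def by (rule r0) simp
    define cut where "cut \<delta> t = of_bool (0 < t \<and> t \<le> \<delta>) * r t" for \<delta> t :: real
    have cutm: "meas01 (cut \<delta>)" for \<delta>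
      using meas01_of_bool[OF sets_L01_Ioc[of 0 \<delta>]] rm by (auto simp: meas01_def cut_def[abs_def])
    have cutX: "cut \<delta> \<in> X" for \<delta>
      by (rule ideal_X(1)[OF rX(1) cutm]) (auto simp: cut_def)
    define tl where "tl m i = (if m \<le> i then c i else 0)" for m i :: nat
    have lX: "ladder n c' f \<in> X" for n c'
      using equimeasurable_X(1)[OF dblock_X[OF f] meas01_ladder[OF fm], of n c' "ladder_coeff n c'" n]
        distr_ladder[OF fm] by (auto simp: equimeasurable_def)
    have tail: "N (ladder n (tl m) f) \<le> 2 * K * N (cut ((1/2) ^ Suc m))" for m n
    proof -
      let ?Y = "ladder n (tl m) (\<lambda>t. 1)"
      have Yeq: "?Y = (\<lambda>t. ladder_coeff n (tl m) (dig n t))" by (simp add: ladder_one fun_eq_iff)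
      have YX: "?Y \<in> X" unfolding Yeq by (rule step_X)
      have hm: "meas01 (\<lambda>t. of_bool (t \<le> 1/2) * ?Y (dbl t))"
      proof -
        have "{t \<in> {0..1::real}. t \<le> 1/2} \<in> sets L01"
        proof -
          have "{t \<in> {0..1::real}. t \<le> 1/2} = {0..1/2}" by auto
          then show ?thesis by (auto simp: sets_restrict_space_iff)
        qed
        from meas01_of_bool[OF this] meas01_dbl[OF meas01_X[OF YX], of 1] show ?thesis
          by (auto simp: meas01_def)
      qed
      have "N (ladder n (tl m) f) = N (dblock (ladder_coeff n (tl m)) f n)"
        using equimeasurable_X(2)[OF dblock_X[OF f] meas01_ladder[OF fm], of n "tl m" "ladder_coeff n (tl m)" n]
          distr_ladder[OF fm] by (auto simp: equimeasurable_def)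
      also have "\<dots> \<le> K * N ?Y" unfolding Yeq by (rule bound)
      also have "\<dots> \<le> K * (2 * N (\<lambda>t. of_bool (t \<le> 1/2) * ?Y (dbl t)))"
        using K N_le_half[OF YX] by (intro mult_left_mono) auto
      also have "\<dots> \<le> K * (2 * N (cut ((1/2) ^ Suc m)))"
      proof (intro mult_left_mono K)
        \<comment> \<open>After squeezing, the value \<open>c i\<close> sits on (2^-(i+2),
          2^-(i+1)], at or to the left of the point where r takes it, so the squeezed step function
          lies below r.\<close>
        show "N (\<lambda>t. of_bool (t \<le> 1/2) * ?Y (dbl t)) \<le> N (cut ((1/2) ^ Suc m))"
        proof (rule ideal_X(2)[OF cutX hm], use AE_L01_pos in eventually_elim)
          case (elim t)
          show "\<bar>of_bool (t \<le> 1/2) * ?Y (dbl t)\<bar> \<le> \<bar>cut ((1/2) ^ Suc m) t\<bar>"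
          proof (cases "t \<le> 1/2")
            case True
            then obtain i where i: "(1/2) ^ Suc i < 2 * t" "2 * t \<le> (1/2) ^ i"
              using dyadic_shell[of "2 * t"] elim by auto
            then have Y: "?Y (dbl t) = (if i < n then tl m i else 0)"
              using ladder_eval[OF i, of n "tl m"] True by (simp add: dbl_def)
            show ?thesis
            proof (cases "i < n \<and> m \<le> i")
              case im: True
              have ti: "t \<le> (1/2) ^ Suc i" using i(2) by simp
              have "(1/2::real) ^ Suc i \<le> (1/2) ^ Suc m"
                using im by (intro power_decreasing) auto
              then have "cut ((1/2) ^ Suc m) t = r t"
                using ti elim order_trans[of t "(1/2) ^ Suc i" "(1/2) ^ Suc m"] by (simp add: cut_def del: power_Suc)
              moreover have "c i \<le> r t" unfolding c_def using ranti[of t "(1/2) ^ Suc i"] ti elim by auto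
              ultimately show ?thesis using Y im c0[of i] True by (simp add: tl_def)
            qed (auto simp: Y tl_def)
          qed simp
        qed
      qed auto
      finally show ?thesis by simp
    qed
    have diff: "ladder n c f t - ladder m c f t = ladder n (tl m) f t" if "m \<le> n" for m n t
      unfolding ladder_extend[OF that] ladder_diff by (rule arg_cong[where f = "\<lambda>c. ladder n c f t"]) (auto simp: tl_def)
    have cut_mono: "N (cut \<delta>) \<le> N (cut \<delta>')" if "\<delta> \<le> \<delta>'" for \<delta> \<delta>'
      by (rule ideal_X(2)[OF cutX cutm]) (use that in \<open>auto simp: cut_def\<close>)
    obtain G where G: "G \<in> X" "(\<lambda>n. N (\<lambda>t. ladder n c f t - G t)) \<longlonglongrightarrow> 0"
    proof (rule complete_X[of "\<lambda>n. ladder n c f"])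
      show "ladder n c f \<in> X" for n by (rule lX)
      fix e :: real assume e: "0 < e"
      obtain \<delta> where \<delta>: "0 < \<delta>" "N (cut \<delta>) < e / (2 * K + 1)"
        using N_rearr_initial_small[OF y, of "e / (2 * K + 1)"] e K unfolding cut_def[abs_def] r_def by auto
      obtain M :: nat where M: "(1/2) ^ M < \<delta>"
        using real_arch_pow_inv[OF \<delta>(1), of "1/2"] by auto
      have small: "N (ladder n (tl m) f) < e" if "M \<le> m" for m n
      proof -
        have "(1/2::real) ^ Suc m \<le> (1/2) ^ M" using that by (intro power_decreasing) auto
        then have "N (cut ((1/2) ^ Suc m)) \<le> N (cut \<delta>)" using M by (intro cut_mono) auto
        then have "2 * K * N (cut ((1/2) ^ Suc m)) \<le> 2 * K * N (cut \<delta>)"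
          using K by (intro mult_left_mono) auto
        also have "\<dots> \<le> (2 * K + 1) * N (cut \<delta>)"
          using N_nonneg[OF cutX] by (intro mult_right_mono) auto
        also have "\<dots> < (2 * K + 1) * (e / (2 * K + 1))"
          using \<delta>(2) K by (intro mult_strict_left_mono) auto
        also have "\<dots> = e" using K by simp
        finally show ?thesis using tail[of n m] by linarith
      qed
      have "N (\<lambda>t. ladder m c f t - ladder n c f t) < e" if "M \<le> m" "M \<le> n" for m n
      proof (cases "n \<le> m")
        case True
        then show ?thesis using small[OF that(2), of m] diff by simp
      next
        case False
        then show ?thesis using small[OF that(1), of n] diff[of m n] N_diff_commute[OF lX lX, of m c n c] by simp
      qed
      then show "\<exists>M. \<forall>m\<ge>M. \<forall>n\<ge>M. N (\<lambda>t. ladder m c f t - ladder n c f t) < e" by blast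
    qed
    have NG: "N G \<le> 2 * K * N y"
    proof -
      have tl0: "tl 0 = c" by (auto simp: tl_def)
      have "N G \<le> N (\<lambda>t. ladder n c f t - G t) + 2 * K * N y" for n
      proof -
        have "N G \<le> N (\<lambda>t. ladder n c f t - G t) + N (ladder n c f)"
          using N_le_diff[OF G(1) lX, of n c] N_diff_commute[OF G(1) lX, of n c] by simp
        moreover have "N (ladder n c f) \<le> 2 * K * N (cut ((1/2) ^ Suc 0))" using tail[of n 0] by (simp add: tl0)
        moreover have "N (cut ((1/2) ^ Suc 0)) \<le> N y"
          unfolding rX(2)[symmetric] by (rule ideal_X(2)[OF rX(1) cutm]) (auto simp: cut_def)
        then have "2 * K * N (cut ((1/2) ^ Suc 0)) \<le> 2 * K * N y" using K by (intro mult_left_mono) auto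
        ultimately show ?thesis by linarith
      qed
      moreover have "(\<lambda>n. N (\<lambda>t. ladder n c f t - G t) + 2 * K * N y) \<longlonglongrightarrow> 0 + 2 * K * N y"
        by (intro tendsto_intros G(2))
      ultimately show ?thesis
        by (intro LIMSEQ_le_const[where X = "\<lambda>n. N (\<lambda>t. ladder n c f t - G t) + 2 * K * N y"]) auto
    qed
    have Gm: "meas01 G" by (rule meas01_X[OF G(1)])
    have lG: "AE t in L01. \<bar>ladder n c f t\<bar> \<le> \<bar>G t\<bar>" for n
    proof -
      \<comment> \<open>The excess of the ladder over \<open>G\<close>. Absolute values grow with
        the height, so v is below \<open>ladder m c f - G\<close> in absolute value for every m
        \<ge> n, and its norm is zero.\<close>
      define v where "v t = max 0 (\<bar>ladder n c f t\<bar> - \<bar>G t\<bar>)" for t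
      have vm: "meas01 v"
        using meas01_ladder[OF fm, of n c] Gm by (auto simp: meas01_def v_def[abs_def])
      have v: "\<bar>v t\<bar> \<le> \<bar>ladder m c f t - G t\<bar>" if "n \<le> m" for m t
        using ladder_mono[OF that, of c f t] by (auto simp: v_def)
      have vle: "v \<in> X" "N v \<le> N (\<lambda>t. ladder m c f t - G t)" if "n \<le> m" for m
        using ideal_X[OF diff_X[OF lX G(1)] vm, of m c] v[OF that] by auto
      have "N v \<le> 0"
        by (rule LIMSEQ_le_const[OF G(2)]) (use vle(2) in blast)
      then have "AE t in L01. v t = 0"
        using N_eq_0_iff[OF vle(1)[OF le_refl]] N_nonneg[OF vle(1)[OF le_refl]] by simp
      then show ?thesis by eventually_elim (auto simp: v_def)
    qed
    have dl: "distr (ladder n c f) s \<le> distr G s" for n s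
    proof -
      have "distr (ladder n c f) s = integral\<^sup>L L01 (\<lambda>t. of_bool (s < \<bar>ladder n c f t\<bar>))"
        by (rule distr_integral[OF meas01_ladder[OF fm]])
      also have "\<dots> \<le> integral\<^sup>L L01 (\<lambda>t. of_bool (s < \<bar>G t\<bar>))"
      proof (rule integral_mono_AE)
        show "AE t in L01. (of_bool (s < \<bar>ladder n c f t\<bar>) :: real) \<le> of_bool (s < \<bar>G t\<bar>)"
          using lG[of n] by eventually_elim auto
      qed (auto intro!: integrable_L01_bounded[of _ 1] meas01_distr_pred meas01_ladder fm Gm)
      also have "\<dots> = distr G s" by (rule distr_integral[OF Gm, symmetric])
      finally show ?thesis .
    qed
    \<comment> \<open>For t above 2^-n the ladder coefficient already majorises r(t); the remaining
      t form a set of measure 2^-n, on which the slice contributes at most 1.\<close>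
    have step: "distr2 (tensor f y) s \<le> distr G s + (1/2) ^ n" if s: "0 \<le> s" for s n
    proof -
      let ?z = "ladder_coeff n c"
      let ?E = "{t \<in> {0..1::real}. t \<le> (1/2) ^ n}"
      have E: "?E = {0..(1/2) ^ n}" using power_le_one[of "1/2::real" n] by auto
      have Es: "?E \<in> sets L01" unfolding E using power_le_one[of "1/2::real" n] by (auto simp: sets_restrict_space_iff)
      have Em: "emeasure L01 ?E = ennreal ((1/2) ^ n)"
        unfolding E using power_le_one[of "1/2::real" n] by (subst emeasure_restrict_space) auto
      have zi: "integrable L01 (\<lambda>t. distr (\<lambda>u. ?z (dig n t) * f u) s)"
        using integrable_step[of "\<lambda>\<alpha>. distr (\<lambda>u. ?z \<alpha> * f u) s" n] .
      have "distr2 (tensor f y) s \<le> distr2 (tensor f r) s"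
        by (rule distr2_tensor_mono[OF fm ym rm s]) (simp add: r_def distr_rearr[OF dy])
      then have "ennreal (distr2 (tensor f y) s) \<le> ennreal (distr2 (tensor f r) s)" by (rule ennreal_leI)
      also have "\<dots> = (\<integral>\<^sup>+ t. ennreal (distr (\<lambda>u. r t * f u) s) \<partial>L01)"
        by (rule distr2_tensor_snd[OF fm rm])
      also have "\<dots> \<le> (\<integral>\<^sup>+ t. ennreal (distr (\<lambda>u. ?z (dig n t) * f u) s) + indicator ?E t \<partial>L01)"
      proof (rule nn_integral_mono_AE, use AE_L01_pos in eventually_elim)
        case (elim t)
        have cfm: "meas01 (\<lambda>u. b * f u)" for b using fm by (auto simp: meas01_def)
        show "ennreal (distr (\<lambda>u. r t * f u) s) \<le> ennreal (distr (\<lambda>u. ?z (dig n t) * f u) s) + indicator ?E t"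
        proof (cases "t \<le> (1/2) ^ n")
          case True
          then have "indicator ?E t = (1 :: ennreal)" using elim by simp
          moreover have "ennreal (distr (\<lambda>u. r t * f u) s) \<le> 1" using distr_le_1[OF cfm] by simp
          ultimately show ?thesis by (metis add_increasing zero_le)
        next
          case False
          obtain i where i: "(1/2) ^ Suc i < t" "t \<le> (1/2) ^ i" using dyadic_shell[of t] elim by auto
          have "i < n"
          proof (rule ccontr)
            assume "\<not> i < n"
            then have "(1/2::real) ^ i \<le> (1/2) ^ n" by (intro power_decreasing) auto
            with i(2) False show False by simp
          qed
          then have z: "?z (dig n t) = c i"
            using ladder_eval[OF i, of n c] by (simp add: ladder_one)
          have le: "r t \<le> c i" unfolding c_def using ranti[of "(1/2) ^ Suc i" t] i by simp
          have "distr (\<lambda>u. r t * f u) s \<le> distr (\<lambda>u. c i * f u) s"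
            unfolding distr_def
          proof (rule L01.finite_measure_mono[OF _ distr_set[OF cfm]])
            have "\<bar>r t * f u\<bar> \<le> \<bar>c i * f u\<bar>" for u
              unfolding abs_mult using le r0[of t] elim by (intro mult_right_mono) auto
            then show "{u \<in> {0..1}. s < \<bar>r t * f u\<bar>} \<subseteq> {u \<in> {0..1}. s < \<bar>c i * f u\<bar>}"
              by (auto intro: less_le_trans)
          qed
          then show ?thesis unfolding z by (meson add_increasing2 ennreal_leI zero_le)
        qed
      qed
      also have "\<dots> = (\<integral>\<^sup>+ t. ennreal (distr (\<lambda>u. ?z (dig n t) * f u) s) \<partial>L01) + emeasure L01 ?E"
        using zi Es by (subst nn_integral_add) auto
      also have "(\<integral>\<^sup>+ t. ennreal (distr (\<lambda>u. ?z (dig n t) * f u) s) \<partial>L01) = ennreal (distr2 (tensor f (\<lambda>t. ?z (dig n t))) s)"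
        by (rule distr2_tensor_snd[OF fm meas01_step, symmetric])
      also have "distr2 (tensor f (\<lambda>t. ?z (dig n t))) s = distr (ladder n c f) s"
        unfolding distr2_tensor_step[OF fm] distr_ladder[OF fm] by (simp add: dblock_def[abs_def])
      also have "ennreal (distr (ladder n c f) s) + emeasure L01 ?E = ennreal (distr (ladder n c f) s + (1/2) ^ n)"
        unfolding Em by (rule ennreal_plus[symmetric]) (auto simp: distr_nonneg)
      finally have "distr2 (tensor f y) s \<le> distr (ladder n c f) s + (1/2) ^ n"
        by (subst (asm) ennreal_le_iff) (auto simp: distr_nonneg)
      then show ?thesis using dl[of n s] by linarith
    qed
    have le: "distr2 (tensor f y) s \<le> distr G s" if "0 \<le> s" for s
    proof -
      have "(\<lambda>n. distr G s + (1/2) ^ n) \<longlonglongrightarrow> distr G s + 0"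
        by (intro tendsto_intros LIMSEQ_power_zero) auto
      then show ?thesis
        by (intro LIMSEQ_le_const[where X = "\<lambda>n. distr G s + (1/2) ^ n"]) (use step[OF that] in auto)
    qed
    have tm: "tensor f y \<in> borel_measurable (lebesgue_on ({0..1} \<times> {0..1}))"
      by (rule borel_measurable_tensor[OF fm ym])
    from rearr_dominated_X[OF G(1) distribution_fun_distr2[OF tm] le] NG tm
    show ?thesis by (auto simp: in_X2_def norm_X2_def drearr2_eq_rearr)
  qed
  then show ?thesis unfolding multiplicator_def using fm by blast
qed

end

theorem theorem2:
  fixes X :: "(real \<Rightarrow> real) set" and N :: "(real \<Rightarrow> real) \<Rightarrow> real" and f :: "real \<Rightarrow> real"
  assumes "symmetric_space X N" and "separable_fnspace X N"
    and "f \<in> X" and "integral\<^sup>L (lebesgue_on {0..1}) f \<noteq> 0"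
  shows "f \<in> multiplicator X N \<longleftrightarrow>
         (\<exists>C>0. \<forall>k0. abs_representing X N f k0 C)"
proof -
  interpret sym_space X N by unfold_locales (rule assms)
  have nz: "\<not> (AE t in L01. f t = 0)"
  proof
    assume "AE t in L01. f t = 0"
    then have "integral\<^sup>L L01 f = 0" by (rule integral_eq_zero_AE)
    with assms(4) show False by simp
  qed
  interpret sep_sym_space X N
    by unfold_locales (rule assms, rule one_X[OF assms(3) nz])
  have fi: "integrable L01 f"
    using assms(4) not_integrable_integral_eq by blast
  show ?thesis
  proof
    assume mult: "f \<in> multiplicator X N"
    obtain C where C: "0 \<le> C" "\<And>k \<xi>. N (dblock \<xi> f k) \<le> C * N (\<lambda>t. \<xi> (dig k t))"
      using multiplicator_dblock_bound[OF mult] by blast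
    interpret bounded_blocks X N f C "integral\<^sup>L L01 f"
      by unfold_locales (use assms C in auto)
    have "0 < 3 * (C / \<bar>integral\<^sup>L L01 f\<bar>) + 1" using C(1) by (simp add: add_nonneg_pos)
    then show "\<exists>C>0. \<forall>k0. abs_representing X N f k0 C"
      using abs_representing_blocks by blast
  next
    assume "\<exists>C>0. \<forall>k0. abs_representing X N f k0 C"
    then obtain C where C: "0 < C" "\<And>k0. abs_representing X N f k0 C" by blast
    \<comment> \<open>Blocks of level k are bounded through the expansion with k0 = k, and one
      constant C serves all k.\<close>
    show "f \<in> multiplicator X N"
      by (rule multiplicatorI[OF assms(3), of "\<bar>integral\<^sup>L L01 f\<bar> * C"])
         (use C(1) abs_representing_dblock_bound[OF assms(3) fi refl C(2)] in auto)
  qed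
qed

end
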